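(* Let $p:\mathcal{A}\to X$ and $q:\mathcal{B}\to Y$ be fibrations with respective fibres $A$ and $B$ over the base points. Suppose that $X=K\cup_\alpha CS$ is the cofibre of a map $\alpha:S\to K$, and $Y=L\cup_\beta CT$ is the cofibre of a map $\beta:T\to L$, where $S$ and $T$ are reduced suspensions. Let $n,m\ge1$. Suppose $\mathrm{secat}_K(p)\le n$ with Hopf invariant $H^n_{\phi,\alpha}(p):S\to J^n(A)$ associated to a pointed homotopy lifting $\phi:K\to J^n_X(\mathcal{A})$ of the inclusion $K\hookrightarrow X$ through $p_n$, and $\mathrm{secat}_L(q)\le m$ with Hopf invariant $H^m_{\psi,\beta}(q):T\to J^m(B)$ associated to a pointed homotopy lifting $\psi:L\to J^m_Y(\mathcal{B})$ of the inclusion $L\hookrightarrow Y$ through $q_m$. Then $$\mathrm{secat}_{X\times L\cup K\times Y}(p\times q)\le n+m+1,$$ and the composition $$S\circledast T\xrightarrow{\;H^n_{\phi,\alpha}(p)\circledast H^m_{\psi,\beta}(q)\;}J^n(A)\circledast J^m(B)\xrightarrow{\;\Phi^{A,B}_{n,m}\;}J^{n+m+1}(A\times B)$$ is a Hopf invariant for $p\times q:\mathcal{A}\times\mathcal{B}\to X\times Y$, i.e. an element of the Hopf set $\mathcal{H}^{n+m+1}_{W}(p\times q)$, where $X\times Y$ is regarded as the mapping cone of $W:S\circledast T\to X\times L\cup K\times Y$.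
   Context: Conventions: spaces are well-pointed, compactly generated, of the homotopy type of CW-complexes; base points are $*$; maps, homotopies, fibrations and cofibrations are pointed unless stated otherwise. $CA=A\times I/A\times1$ with $A\hookrightarrow CA$, $a\mapsto[a,0]$; $A\circledast B=CA\times B\cup A\times CB$. Sectional category: for a (surjective) fibration $p:\mathcal{A}\to X$, $\mathrm{secat}(p)$ is the least $n\ge0$ such that $X$ has a cover by $n+1$ open sets each admitting a continuous local section of $p$. For $K\subseteq X$ (more generally a map $K\to X$), $\mathrm{secat}_K(p)$ is the sectional category of the pullback of $p$ to $K$. Fibred joins: $p_n:J^n_X(\mathcal{A})\to X$ is the $(n+1)$-fold fibred join: $J^n_X(\mathcal{A})=\mathcal{A}^{n+1}_X\times\Delta^n/\!\sim$, where $\mathcal{A}^{n+1}_X$ is the $(n+1)$-fold fibred product and $(\mathbf a,\mathbf t)\sim(\mathbf a',\mathbf t)$ if $a_i=a_i'$ whenever $t_i\ne0$ (the relation generated by changing $a_i$ when $t_i=0$); classes are written $\langle\mathbf a\mid\mathbf t\rangle$, and $p_n$ is the obvious projection. The fibre over $*$ is $J^n(A)=A^{n+1}\times\Delta^n/\!\sim$, with inclusion $i_n:J^n(A)\to J^n_X(\mathcal{A})$; base points are $\langle *,\dots,*\mid 1,0,\dots,0\rangle$. Hopf invariants: let $X=K\cup_\alpha CS$ with $\mathrm{secat}_K(p)\le n$, $n\ge1$, $S$ a reduced suspension (up to homotopy), and let $\phi:K\to J^n_X(\mathcal{A})$ satisfy $p_n\circ\phi\simeq(K\hookrightarrow X)$.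 Then $p_n\circ\phi\circ\alpha\simeq*$, so there is $H:S\to J^n(A)$ with $i_n\circ H\simeq\phi\circ\alpha$; its pointed homotopy class is uniquely determined by the classes of $\alpha$ and $\phi$ and is denoted $H^n_{\phi,\alpha}(p)$, the Hopf invariant associated to $(p,n,\phi,\alpha)$. The Hopf set $\mathcal{H}^n_\alpha(p)$ is the set of all $H^n_{\phi,\alpha}(p)$ as $\phi$ varies. The map $W$: $X\times L\cup K\times Y$ is the push-out of $X\times L\leftarrow K\times L\to K\times Y$. Writing $\bar\alpha:CS\to X$ and $\bar\beta:CT\to Y$ for the canonical maps, $W:S\circledast T=CS\times T\cup S\times CT\to X\times L\cup K\times Y$ is $\bar\alpha\times\beta$ on $CS\times T$ and $\alpha\times\bar\beta$ on $S\times CT$. There is a homeomorphism $CS\times CT\cong C(S\circledast T)$ under which $S\circledast T\hookrightarrow CS\times CT$ is the base inclusion, and $X\times Y$ is thereby the mapping cone of $W$. The topological shuffle map $\Phi^{A,B}_{n,m}$: let $\mathcal{S}_{n,m}$ be the set of $(n,m)$ shuffles, i.e. permutations $\theta$ of $\{1,\dots,n+m\}$ with $\theta(1)<\dots<\theta(n)$ and $\theta(n+1)<\dots<\theta(n+m)$. Represent $\theta$ by the edgepath from $(0,0)$ to $(n,m)$ in the integer grid whose $k$-th edge is horizontal (a unit step in the first coordinate) if $\theta^{-1}(k)\le n$ and vertical otherwise, with successive vertices $(i_k,j_k)$, $1\le k\le n+m+1$. Let $\Delta_\theta\subset\Delta^n\times\Delta^m$ be the simplex with ordered vertices $(e_{i_k},e'_{j_k})$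 ($e_i,e'_j$ the vertices of $\Delta^n,\Delta^m$); these simplices subdivide $\Delta^n\times\Delta^m$. Let $\psi_\theta:\Delta_\theta\to\Delta^{n+m}$ be the order-preserving affine isomorphism, and let $\delta_\theta:A^{n+1}\times B^{m+1}\to(A\times B)^{n+m+1}$ be $\delta_\theta((a_0,\dots,a_n),(b_0,\dots,b_m))=((a_{i_1},b_{j_1}),\dots,(a_{i_{n+m+1}},b_{j_{n+m+1}}))$. There is a well-defined map $\psi^{A,B}_{n,m}:J^n(A)\times J^m(B)\to J^{n+m}(A\times B)$, $(\langle\mathbf a\mid\mathbf t\rangle,\langle\mathbf b\mid\mathbf s\rangle)\mapsto\langle\delta_\theta(\mathbf a,\mathbf b)\mid\psi_\theta(\mathbf t,\mathbf s)\rangle$ for $(\mathbf t,\mathbf s)\in\Delta_\theta$. Then $\Phi^{A,B}_{n,m}:J^n(A)\circledast J^m(B)\to J^{n+m+1}(A\times B)$ is given on $J^n(A)\times CJ^m(B)$ by $(\langle\mathbf a\mid\mathbf t\rangle,[\langle\mathbf b\mid\mathbf s\rangle,u])\mapsto\psi^{A,B}_{n,m+1}(\langle\mathbf a\mid\mathbf t\rangle,\langle\mathbf b,*\mid(1-u)\mathbf s,u\rangle)$ and on $CJ^n(A)\times J^m(B)$ by $([\langle\mathbf a\mid\mathbf t\rangle,u],\langle\mathbf b\mid\mathbf s\rangle)\mapsto\psi^{A,B}_{n+1,m}(\langle\mathbf a,*\mid(1-u)\mathbf t,u\rangle,\langle\mathbf b\mid\mathbf s\rangle)$. *)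

theory Defs
  imports "HOL-Analysis.Analysis" "HOL-Homology.Homology" "HOL-Library.Extended_Nat" "HOL-Combinatorics.Permutations"
begin

section \<open>Spaces\<close>

text \<open>Compactly generated spaces are taken in Steenrod's sense (Hausdorff k-spaces); products and
  pullbacks carry the k-ification of the usual topology. The product of a k-space with a compact
  Hausdorff space is already a k-space, so cylinders and the library's \<^const>\<open>homotopic_with\<close> need no
  k-ification.\<close>

abbreviation unit_interval :: "real topology" where
  "unit_interval \<equiv> top_of_set {0..1}"

definition kprod :: "'a topology \<Rightarrow> 'b topology \<Rightarrow> ('a \<times> 'b) topology" where
  "kprod X Y = kification (prod_topology X Y)"

definition compactly_generated :: "'a topology \<Rightarrow> bool" where
  "compactly_generated X \<longleftrightarrow> k_space X \<and> Hausdorff_space X"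

text \<open>The inclusion of the base point has the homotopy extension property. HOL cannot quantify over
  types inside a definition; targets on the type \<open>'a \<times> real\<close> are enough, because the universal
  target, the mapping cylinder \<open>X \<times> {0} \<union> {x\<^sub>0} \<times> I\<close>, lives there.\<close>

definition well_pointed :: "'a topology \<Rightarrow> 'a \<Rightarrow> bool" where
  "well_pointed X x0 \<longleftrightarrow> x0 \<in> topspace X \<and>
     (\<forall>(Z :: ('a \<times> real) topology) f \<gamma>.
        compactly_generated Z \<and> continuous_map X Z f \<and> continuous_map unit_interval Z \<gamma> \<and> \<gamma> 0 = f x0
        \<longrightarrow> (\<exists>h. continuous_map (prod_topology unit_interval X) Z h \<and>
                 (\<forall>x\<in>topspace X. h (0, x) = f x) \<and> (\<forall>t\<in>{0..1}. h (t, x0) = \<gamma> t)))"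

definition disc :: "nat \<Rightarrow> (nat \<Rightarrow> real) topology" where
  "disc n = subtopology (Euclidean_space n) {x. (\<Sum>i<n. (x i)\<^sup>2) \<le> 1}"

definition open_disc :: "nat \<Rightarrow> (nat \<Rightarrow> real) set" where
  "open_disc n = {x \<in> topspace (disc n). (\<Sum>i<n. (x i)\<^sup>2) < 1}"

definition boundary_sphere :: "nat \<Rightarrow> (nat \<Rightarrow> real) set" where
  "boundary_sphere n = {x \<in> topspace (disc n). (\<Sum>i<n. (x i)\<^sup>2) = 1}"

text \<open>Whitehead's definition. A cell is given by its dimension and characteristic map: the open cells
  partition the space, the boundary of a cell meets finitely many cells, all of lower dimension, and
  the topology is the weak one.\<close>

definition CW_complex :: "'a topology \<Rightarrow> bool" where
  "CW_complex X \<longleftrightarrow> Hausdorff_space X \<and>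
     (\<exists>C :: (nat \<times> ((nat \<Rightarrow> real) \<Rightarrow> 'a)) set.
        (\<forall>(n, f) \<in> C. continuous_map (disc n) X f \<and> inj_on f (open_disc n)) \<and>
        topspace X = (\<Union>(n, f) \<in> C. f ` open_disc n) \<and>
        (\<forall>(n, f) \<in> C. \<forall>(m, g) \<in> C. (n, f) \<noteq> (m, g) \<longrightarrow> f ` open_disc n \<inter> g ` open_disc m = {}) \<and>
        (\<forall>(n, f) \<in> C. \<exists>F \<subseteq> C. finite F \<and> (\<forall>(k, g) \<in> F. k < n) \<and>
             f ` boundary_sphere n \<subseteq> (\<Union>(k, g) \<in> F. g ` open_disc k)) \<and>
        (\<forall>U \<subseteq> topspace X.
             (\<forall>(n, f) \<in> C. openin (disc n) {x \<in> topspace (disc n). f x \<in> U}) \<longrightarrow> openin X U))"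

text \<open>The type of the CW complex is large enough for the geometric realisation of the singular complex
  of \<open>X\<close> (a point is a nondegenerate singular simplex with a point of a standard simplex), which is
  homotopy equivalent to \<open>X\<close> whenever any CW complex is. So nothing is lost by fixing it.\<close>

definition CW_homotopy_type :: "'a topology \<Rightarrow> bool" where
  "CW_homotopy_type X \<longleftrightarrow>
     (\<exists>Y :: (((nat \<Rightarrow> real) \<Rightarrow> 'a) \<times> (nat \<Rightarrow> real)) topology. CW_complex Y \<and> X homotopy_equivalent_space Y)"

definition pointed_space :: "'a topology \<Rightarrow> 'a \<Rightarrow> bool" where
  "pointed_space X x0 \<longleftrightarrow> compactly_generated X \<and> well_pointed X x0 \<and> CW_homotopy_type X"

definition pointed_map :: "'a topology \<Rightarrow> 'a \<Rightarrow> 'b topology \<Rightarrow> 'b \<Rightarrow> ('a \<Rightarrow> 'b) \<Rightarrow> bool" where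
  "pointed_map X x0 Y y0 f \<longleftrightarrow> continuous_map X Y f \<and> f x0 = y0"

definition pointed_homotopic ::
    "'a topology \<Rightarrow> 'a \<Rightarrow> 'b topology \<Rightarrow> 'b \<Rightarrow> ('a \<Rightarrow> 'b) \<Rightarrow> ('a \<Rightarrow> 'b) \<Rightarrow> bool" where
  "pointed_homotopic X x0 Y y0 f g \<longleftrightarrow> homotopic_with (\<lambda>h. h x0 = y0) X Y f g"

definition pointed_class ::
    "'a topology \<Rightarrow> 'a \<Rightarrow> 'b topology \<Rightarrow> 'b \<Rightarrow> ('a \<Rightarrow> 'b) \<Rightarrow> ('a \<Rightarrow> 'b) set" where
  "pointed_class X x0 Y y0 f = {g. pointed_homotopic X x0 Y y0 f g}"

definition pointed_homotopy_equivalent ::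
    "'a topology \<Rightarrow> 'a \<Rightarrow> 'b topology \<Rightarrow> 'b \<Rightarrow> bool" where
  "pointed_homotopy_equivalent X x0 Y y0 \<longleftrightarrow>
     (\<exists>f g. pointed_map X x0 Y y0 f \<and> pointed_map Y y0 X x0 g \<and>
            pointed_homotopic X x0 X x0 (g \<circ> f) id \<and> pointed_homotopic Y y0 Y y0 (f \<circ> g) id)"

text \<open>Homotopy lifting property, for all compactly generated test spaces: the type
  \<open>'e \<times> (real \<Rightarrow> 'x)\<close> contains the universal one, the mapping path space \<open>E \<times>\<^sub>X X\<^sup>I\<close>. Between
  well-pointed spaces this gives lifts of pointed homotopies by pointed homotopies on well-pointed
  test spaces (Strom).\<close>

definition pointed_fibration :: "'e topology \<Rightarrow> 'e \<Rightarrow> 'x topology \<Rightarrow> 'x \<Rightarrow> ('e \<Rightarrow> 'x) \<Rightarrow> bool" where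
  "pointed_fibration E e0 X x0 p \<longleftrightarrow> pointed_map E e0 X x0 p \<and>
     (\<forall>(Z :: ('e \<times> (real \<Rightarrow> 'x)) topology) f h.
        compactly_generated Z \<and> continuous_map Z E f \<and>
        continuous_map (prod_topology unit_interval Z) X h \<and> (\<forall>z\<in>topspace Z. h (0, z) = p (f z))
        \<longrightarrow> (\<exists>g. continuous_map (prod_topology unit_interval Z) E g \<and>
                 (\<forall>z\<in>topspace Z. g (0, z) = f z) \<and>
                 (\<forall>t\<in>{0..1}. \<forall>z\<in>topspace Z. p (g (t, z)) = h (t, z))))"

definition fibre :: "'e topology \<Rightarrow> ('e \<Rightarrow> 'x) \<Rightarrow> 'x \<Rightarrow> 'e topology" where
  "fibre E p x0 = subtopology E {e. p e = x0}"


section \<open>Quotients, unions, cones\<close>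

definition qclass :: "'a topology \<Rightarrow> ('a \<Rightarrow> 'a \<Rightarrow> bool) \<Rightarrow> 'a \<Rightarrow> 'a set" where
  "qclass X R x = {y \<in> topspace X. R x y}"

definition quotient_topology :: "'a topology \<Rightarrow> ('a \<Rightarrow> 'a \<Rightarrow> bool) \<Rightarrow> 'a set topology" where
  "quotient_topology X R =
     topology (\<lambda>U. U \<subseteq> qclass X R ` topspace X \<and> openin X {x \<in> topspace X. qclass X R x \<in> U})"

definition rep :: "'a set \<Rightarrow> 'a" where
  "rep c = (SOME z. z \<in> c)"

lemma openin_quotient_topology:
  "openin (quotient_topology X R) U \<longleftrightarrow>
     U \<subseteq> qclass X R ` topspace X \<and> openin X {x \<in> topspace X. qclass X R x \<in> U}"
proof -
  have "istopology (\<lambda>U. U \<subseteq> qclass X R ` topspace X \<and> openin X {x \<in> topspace X. qclass X R x \<in> U})"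
    unfolding istopology_def
  proof (intro conjI allI impI, goal_cases)
    case (2 U V)
    have "{x \<in> topspace X. qclass X R x \<in> U \<inter> V} =
          {x \<in> topspace X. qclass X R x \<in> U} \<inter> {x \<in> topspace X. qclass X R x \<in> V}" by auto
    with 2 show ?case by auto
  next
    case (4 \<K>)
    have "{x \<in> topspace X. qclass X R x \<in> \<Union>\<K>} =
          \<Union>((\<lambda>U. {x \<in> topspace X. qclass X R x \<in> U}) ` \<K>)" by auto
    with 4 show ?case by auto
  qed auto
  then show ?thesis
    by (simp add: quotient_topology_def topology_inverse')
qed

lemma topspace_quotient_topology:
  "topspace (quotient_topology X R) = qclass X R ` topspace X"
proof
  show "topspace (quotient_topology X R) \<subseteq> qclass X R ` topspace X"
    using openin_quotient_topology openin_topspace by metis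
  have "{x \<in> topspace X. qclass X R x \<in> qclass X R ` topspace X} = topspace X" by auto
  then show "qclass X R ` topspace X \<subseteq> topspace (quotient_topology X R)"
    by (intro openin_subset) (auto simp: openin_quotient_topology)
qed

lemma quotient_map_qclass: "quotient_map X (quotient_topology X R) (qclass X R)"
  unfolding quotient_map_def topspace_quotient_topology by (auto simp: openin_quotient_topology)

text \<open>Push-out of the inclusions of \<open>P \<inter> Q\<close> in \<open>P\<close> and \<open>Q\<close>, realised on the union.\<close>

definition union_topology :: "'a topology \<Rightarrow> 'a topology \<Rightarrow> 'a topology" where
  "union_topology P Q =
     topology (\<lambda>U. U \<subseteq> topspace P \<union> topspace Q \<and>
                   openin P (U \<inter> topspace P) \<and> openin Q (U \<inter> topspace Q))"

lemma openin_union_topology: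
  "openin (union_topology P Q) U \<longleftrightarrow>
     U \<subseteq> topspace P \<union> topspace Q \<and> openin P (U \<inter> topspace P) \<and> openin Q (U \<inter> topspace Q)"
proof -
  have "istopology (\<lambda>U. U \<subseteq> topspace P \<union> topspace Q \<and>
                   openin P (U \<inter> topspace P) \<and> openin Q (U \<inter> topspace Q))"
    unfolding istopology_def
  proof (intro conjI allI impI, goal_cases)
    case (2 U V)
    then have "openin P ((U \<inter> topspace P) \<inter> (V \<inter> topspace P))" by blast
    moreover have "(U \<inter> topspace P) \<inter> (V \<inter> topspace P) = U \<inter> V \<inter> topspace P" by auto
    ultimately show ?case by simp
  next
    case (3 U V)
    then have "openin Q ((U \<inter> topspace Q) \<inter> (V \<inter> topspace Q))" by blast
    moreover have "(U \<inter> topspace Q) \<inter> (V \<inter> topspace Q) = U \<inter> V \<inter> topspace Q" by auto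
    ultimately show ?case by simp
  next
    case (5 \<K>)
    have "\<Union>\<K> \<inter> topspace P = \<Union>((\<lambda>U. U \<inter> topspace P) ` \<K>)" by auto
    moreover have "openin P (\<Union>((\<lambda>U. U \<inter> topspace P) ` \<K>))"
      using 5 by (intro openin_Union) auto
    ultimately show ?case by simp
  next
    case (6 \<K>)
    have "\<Union>\<K> \<inter> topspace Q = \<Union>((\<lambda>U. U \<inter> topspace Q) ` \<K>)" by auto
    moreover have "openin Q (\<Union>((\<lambda>U. U \<inter> topspace Q) ` \<K>))"
      using 6 by (intro openin_Union) auto
    ultimately show ?case by simp
  qed auto
  then show ?thesis
    by (simp add: union_topology_def topology_inverse')
qed

definition collapse_rel :: "'a set \<Rightarrow> 'a \<Rightarrow> 'a \<Rightarrow> bool" where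
  "collapse_rel A x y \<longleftrightarrow> x = y \<or> (x \<in> A \<and> y \<in> A)"

definition suspension_pt :: "'a topology \<Rightarrow> 'a \<Rightarrow> 'a \<Rightarrow> real \<Rightarrow> ('a \<times> real) set" where
  "suspension_pt Z z0 z t =
     qclass (kprod Z unit_interval) (collapse_rel (topspace Z \<times> {0, 1} \<union> {z0} \<times> {0..1})) (z, t)"

definition reduced_suspension :: "'a topology \<Rightarrow> 'a \<Rightarrow> ('a \<times> real) set topology" where
  "reduced_suspension Z z0 =
     quotient_topology (kprod Z unit_interval)
       (collapse_rel (topspace Z \<times> {0, 1} \<union> {z0} \<times> {0..1}))"

definition cone_pt :: "'a topology \<Rightarrow> 'a \<Rightarrow> real \<Rightarrow> ('a \<times> real) set" where
  "cone_pt A a t = qclass (kprod A unit_interval) (collapse_rel (topspace A \<times> {1})) (a, t)"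

definition cone :: "'a topology \<Rightarrow> ('a \<times> real) set topology" where
  "cone A = quotient_topology (kprod A unit_interval) (collapse_rel (topspace A \<times> {1}))"

definition cone_base :: "'a topology \<Rightarrow> ('a \<times> real) set topology" where
  "cone_base A = subtopology (cone A) ((\<lambda>a. cone_pt A a 0) ` topspace A)"

definition cone_map :: "'b topology \<Rightarrow> ('a \<Rightarrow> 'b) \<Rightarrow> ('a \<times> real) set \<Rightarrow> ('b \<times> real) set" where
  "cone_map B f c = (case rep c of (a, t) \<Rightarrow> cone_pt B (f a) t)"

text \<open>\<open>X\<close> is the cofibre \<open>K \<union>\<^sub>\<alpha> CS\<close>, i.e. the push-out of \<open>K \<leftarrow> S \<rightarrow> CS\<close>, with canonical map
  \<open>\<alpha>' : CS \<rightarrow> X\<close>; \<open>K\<close> is identified with its image in \<open>X\<close>.\<close>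

definition mapping_cone ::
    "'x topology \<Rightarrow> 'x topology \<Rightarrow> 's topology \<Rightarrow> ('s \<Rightarrow> 'x) \<Rightarrow> (('s \<times> real) set \<Rightarrow> 'x) \<Rightarrow> bool" where
  "mapping_cone X K S \<alpha> \<alpha>' \<longleftrightarrow>
     continuous_map S K \<alpha> \<and>
     topspace X = topspace K \<union> \<alpha>' ` topspace (cone S) \<and>
     (\<forall>s\<in>topspace S. \<alpha>' (cone_pt S s 0) = \<alpha> s) \<and>
     inj_on \<alpha>' (topspace (cone S) - topspace (cone_base S)) \<and>
     \<alpha>' ` (topspace (cone S) - topspace (cone_base S)) \<inter> topspace K = {} \<and>
     (\<forall>U \<subseteq> topspace X. openin X U \<longleftrightarrow>
        openin K (U \<inter> topspace K) \<and> openin (cone S) {c \<in> topspace (cone S). \<alpha>' c \<in> U})"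

text \<open>\<open>A \<circledast> B = CA \<times> B \<union> A \<times> CB\<close> is realised inside \<open>CA \<times> CB\<close>, with \<open>A\<close> and \<open>B\<close> identified with the
  bases of their cones. Hence \<open>Cf \<times> Cg\<close> restricts to \<open>f \<circledast> g\<close>, and since \<open>\<alpha>'\<close> and \<open>\<beta>'\<close> restrict to
  \<open>\<alpha>\<close> and \<open>\<beta>\<close> on the bases, \<open>\<alpha>' \<times> \<beta>'\<close> restricts to \<open>W\<close>.\<close>

definition cjoin :: "'a topology \<Rightarrow> 'b topology \<Rightarrow> (('a \<times> real) set \<times> ('b \<times> real) set) topology" where
  "cjoin A B = union_topology (kprod (cone A) (cone_base B)) (kprod (cone_base A) (cone B))"

definition cjoin_basept :: "'a topology \<Rightarrow> 'a \<Rightarrow> 'b topology \<Rightarrow> 'b \<Rightarrow> ('a \<times> real) set \<times> ('b \<times> real) set" where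
  "cjoin_basept A a0 B b0 = (cone_pt A a0 0, cone_pt B b0 0)"

definition cjoin_map ::
    "'c topology \<Rightarrow> 'd topology \<Rightarrow> ('a \<Rightarrow> 'c) \<Rightarrow> ('b \<Rightarrow> 'd) \<Rightarrow>
     ('a \<times> real) set \<times> ('b \<times> real) set \<Rightarrow> ('c \<times> real) set \<times> ('d \<times> real) set" where
  "cjoin_map C D f g = map_prod (cone_map C f) (cone_map D g)"

definition W_map ::
    "(('s \<times> real) set \<Rightarrow> 'x) \<Rightarrow> (('t \<times> real) set \<Rightarrow> 'y) \<Rightarrow>
     ('s \<times> real) set \<times> ('t \<times> real) set \<Rightarrow> 'x \<times> 'y" where
  "W_map \<alpha>' \<beta>' = map_prod \<alpha>' \<beta>'"

definition fat_product ::
    "'x topology \<Rightarrow> 'x topology \<Rightarrow> 'y topology \<Rightarrow> 'y topology \<Rightarrow> ('x \<times> 'y) topology" where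
  "fat_product X K Y L = union_topology (kprod X L) (kprod K Y)"


section \<open>Sectional category\<close>

definition secat :: "'e topology \<Rightarrow> 'x topology \<Rightarrow> ('e \<Rightarrow> 'x) \<Rightarrow> enat" where
  "secat E X p = Inf {enat n | n. \<exists>U :: nat \<Rightarrow> 'x set.
     (\<forall>i\<le>n. openin X (U i) \<and>
        (\<exists>s. continuous_map (subtopology X (U i)) E s \<and> (\<forall>x\<in>U i. p (s x) = x))) \<and>
     topspace X = (\<Union>i\<le>n. U i)}"

definition pullback :: "'k topology \<Rightarrow> ('k \<Rightarrow> 'x) \<Rightarrow> 'e topology \<Rightarrow> ('e \<Rightarrow> 'x) \<Rightarrow> ('k \<times> 'e) topology" where
  "pullback K f E p = kification (subtopology (prod_topology K E) {(k, e). f k = p e})"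

definition secat_along :: "'k topology \<Rightarrow> ('k \<Rightarrow> 'x) \<Rightarrow> 'e topology \<Rightarrow> ('e \<Rightarrow> 'x) \<Rightarrow> enat" where
  "secat_along K f E p = secat (pullback K f E p) K fst"


section \<open>Fibred joins and Hopf invariants\<close>

definition simplex_top :: "nat \<Rightarrow> (nat \<Rightarrow> real) topology" where
  "simplex_top n = subtopology (powertop_real UNIV) (standard_simplex n)"

text \<open>The \<open>(n+1)\<close>-fold fibred product, as extensional functions on \<open>{..n}\<close>.\<close>

definition fibred_product :: "nat \<Rightarrow> 'e topology \<Rightarrow> ('e \<Rightarrow> 'x) \<Rightarrow> (nat \<Rightarrow> 'e) topology" where
  "fibred_product n E p =
     kification (subtopology (product_topology (\<lambda>_. E) {..n}) {a. \<forall>i\<le>n. \<forall>j\<le>n. p (a i) = p (a j)})"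

definition fjoin_rel :: "(nat \<Rightarrow> 'e) \<times> (nat \<Rightarrow> real) \<Rightarrow> (nat \<Rightarrow> 'e) \<times> (nat \<Rightarrow> real) \<Rightarrow> bool" where
  "fjoin_rel = (\<lambda>(a, t) (a', t'). t = t' \<and> (\<forall>i. t i \<noteq> 0 \<longrightarrow> a i = a' i))"

type_synonym 'e fjoin_point = "((nat \<Rightarrow> 'e) \<times> (nat \<Rightarrow> real)) set"

definition fjoin :: "nat \<Rightarrow> 'e topology \<Rightarrow> ('e \<Rightarrow> 'x) \<Rightarrow> 'e fjoin_point topology" where
  "fjoin n E p = quotient_topology (kprod (fibred_product n E p) (simplex_top n)) fjoin_rel"

definition fjoin_pt ::
    "nat \<Rightarrow> 'e topology \<Rightarrow> ('e \<Rightarrow> 'x) \<Rightarrow> (nat \<Rightarrow> 'e) \<times> (nat \<Rightarrow> real) \<Rightarrow> 'e fjoin_point" where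
  "fjoin_pt n E p = qclass (kprod (fibred_product n E p) (simplex_top n)) fjoin_rel"

definition fjoin_basept :: "nat \<Rightarrow> 'e topology \<Rightarrow> ('e \<Rightarrow> 'x) \<Rightarrow> 'e \<Rightarrow> 'e fjoin_point" where
  "fjoin_basept n E p e0 = fjoin_pt n E p (\<lambda>i\<in>{..n}. e0, \<lambda>i. if i = 0 then 1 else 0)"

text \<open>All coordinates of a representative lie over the same point of the base.\<close>

definition fjoin_proj :: "('e \<Rightarrow> 'x) \<Rightarrow> 'e fjoin_point \<Rightarrow> 'x" where
  "fjoin_proj p c = p (fst (rep c) 0)"

text \<open>\<open>J\<^sup>n(A)\<close> is the fibred join over a point.\<close>

abbreviation to_point :: "'a \<Rightarrow> unit" where
  "to_point \<equiv> \<lambda>_. ()"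

abbreviation njoin :: "nat \<Rightarrow> 'a topology \<Rightarrow> 'a fjoin_point topology" where
  "njoin n A \<equiv> fjoin n A to_point"

abbreviation njoin_pt :: "nat \<Rightarrow> 'a topology \<Rightarrow> (nat \<Rightarrow> 'a) \<times> (nat \<Rightarrow> real) \<Rightarrow> 'a fjoin_point" where
  "njoin_pt n A \<equiv> fjoin_pt n A to_point"

abbreviation njoin_basept :: "nat \<Rightarrow> 'a topology \<Rightarrow> 'a \<Rightarrow> 'a fjoin_point" where
  "njoin_basept n A a0 \<equiv> fjoin_basept n A to_point a0"

definition fjoin_incl :: "nat \<Rightarrow> 'e topology \<Rightarrow> ('e \<Rightarrow> 'x) \<Rightarrow> 'e fjoin_point \<Rightarrow> 'e fjoin_point" where
  "fjoin_incl n E p c = fjoin_pt n E p (rep c)"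

definition homotopy_lifting ::
    "nat \<Rightarrow> 'e topology \<Rightarrow> 'e \<Rightarrow> 'x topology \<Rightarrow> 'x \<Rightarrow> ('e \<Rightarrow> 'x) \<Rightarrow> 'x topology
     \<Rightarrow> ('x \<Rightarrow> 'e fjoin_point) \<Rightarrow> bool" where
  "homotopy_lifting n E e0 X x0 p K \<phi> \<longleftrightarrow>
     pointed_map K x0 (fjoin n E p) (fjoin_basept n E p e0) \<phi> \<and>
     pointed_homotopic K x0 X x0 (fjoin_proj p \<circ> \<phi>) id"

text \<open>The map \<open>H\<close> represents the Hopf invariant associated to \<open>(p, n, \<phi>, \<alpha>)\<close>. Only \<open>\<alpha> : S \<rightarrow> K\<close> and
  the inclusion \<open>K \<subseteq> X\<close> enter; that \<open>X\<close> is the cofibre of \<open>\<alpha>\<close>, \<open>n \<ge> 1\<close> and \<open>S\<close> is a suspension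
  guarantee that such an \<open>H\<close> exists and is unique up to pointed homotopy.\<close>

definition is_Hopf_invariant ::
    "nat \<Rightarrow> 'e topology \<Rightarrow> 'e \<Rightarrow> 'x topology \<Rightarrow> 'x \<Rightarrow> ('e \<Rightarrow> 'x) \<Rightarrow> 'x topology
     \<Rightarrow> 's topology \<Rightarrow> 's \<Rightarrow> ('s \<Rightarrow> 'x) \<Rightarrow> ('x \<Rightarrow> 'e fjoin_point) \<Rightarrow> ('s \<Rightarrow> 'e fjoin_point) \<Rightarrow> bool" where
  "is_Hopf_invariant n E e0 X x0 p K S s0 \<alpha> \<phi> H \<longleftrightarrow>
     homotopy_lifting n E e0 X x0 p K \<phi> \<and>
     pointed_map S s0 (njoin n (fibre E p x0)) (njoin_basept n (fibre E p x0) e0) H \<and>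
     pointed_homotopic S s0 (fjoin n E p) (fjoin_basept n E p e0) (fjoin_incl n E p \<circ> H) (\<phi> \<circ> \<alpha>)"

definition Hopf_set ::
    "nat \<Rightarrow> 'e topology \<Rightarrow> 'e \<Rightarrow> 'x topology \<Rightarrow> 'x \<Rightarrow> ('e \<Rightarrow> 'x) \<Rightarrow> 'x topology
     \<Rightarrow> 's topology \<Rightarrow> 's \<Rightarrow> ('s \<Rightarrow> 'x) \<Rightarrow> ('s \<Rightarrow> 'e fjoin_point) set set" where
  "Hopf_set n E e0 X x0 p K S s0 \<alpha> =
     {pointed_class S s0 (njoin n (fibre E p x0)) (njoin_basept n (fibre E p x0) e0) H | \<phi> H.
        is_Hopf_invariant n E e0 X x0 p K S s0 \<alpha> \<phi> H}"


section \<open>The topological shuffle map\<close>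

definition shuffles_perm :: "nat \<Rightarrow> nat \<Rightarrow> (nat \<Rightarrow> nat) set" where
  "shuffles_perm n m = {\<theta>. \<theta> permutes {1..n + m} \<and>
     strict_mono_on {1..n} \<theta> \<and> strict_mono_on {n + 1..n + m} \<theta>}"

text \<open>The vertex of the edge path of \<open>\<theta>\<close> reached after \<open>k\<close> edges, \<open>0 \<le> k \<le> n + m\<close>.\<close>

definition path_i :: "nat \<Rightarrow> (nat \<Rightarrow> nat) \<Rightarrow> nat \<Rightarrow> nat" where
  "path_i n \<theta> k = card {l \<in> {1..k}. inv_into UNIV \<theta> l \<le> n}"

definition path_j :: "nat \<Rightarrow> (nat \<Rightarrow> nat) \<Rightarrow> nat \<Rightarrow> nat" where
  "path_j n \<theta> k = card {l \<in> {1..k}. \<not> inv_into UNIV \<theta> l \<le> n}"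

text \<open>The affine parametrisation \<open>r \<mapsto> (\<Sum>\<^sub>k r\<^sub>k e\<^bsub>i(k)\<^esub>, \<Sum>\<^sub>k r\<^sub>k e'\<^bsub>j(k)\<^esub>)\<close> of \<open>\<Delta>\<^sub>\<theta>\<close> by its ordered
  vertices; \<open>\<psi>\<^sub>\<theta>\<close> is its inverse.\<close>

definition shuffle_param ::
    "nat \<Rightarrow> nat \<Rightarrow> (nat \<Rightarrow> nat) \<Rightarrow> (nat \<Rightarrow> real) \<Rightarrow> (nat \<Rightarrow> real) \<times> (nat \<Rightarrow> real)" where
  "shuffle_param n m \<theta> r =
     (\<lambda>i. \<Sum>k | k \<le> n + m \<and> path_i n \<theta> k = i. r k, \<lambda>j. \<Sum>k | k \<le> n + m \<and> path_j n \<theta> k = j. r k)"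

definition shuffle_simplex :: "nat \<Rightarrow> nat \<Rightarrow> (nat \<Rightarrow> nat) \<Rightarrow> ((nat \<Rightarrow> real) \<times> (nat \<Rightarrow> real)) set" where
  "shuffle_simplex n m \<theta> = shuffle_param n m \<theta> ` standard_simplex (n + m)"

definition psi_simplex ::
    "nat \<Rightarrow> nat \<Rightarrow> (nat \<Rightarrow> nat) \<Rightarrow> (nat \<Rightarrow> real) \<times> (nat \<Rightarrow> real) \<Rightarrow> (nat \<Rightarrow> real)" where
  "psi_simplex n m \<theta> = inv_into (standard_simplex (n + m)) (shuffle_param n m \<theta>)"

definition delta_shuffle ::
    "nat \<Rightarrow> nat \<Rightarrow> (nat \<Rightarrow> nat) \<Rightarrow> (nat \<Rightarrow> 'a) \<Rightarrow> (nat \<Rightarrow> 'b) \<Rightarrow> (nat \<Rightarrow> 'a \<times> 'b)" where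
  "delta_shuffle n m \<theta> a b = (\<lambda>k\<in>{..n + m}. (a (path_i n \<theta> k), b (path_j n \<theta> k)))"

definition psi_map ::
    "nat \<Rightarrow> nat \<Rightarrow> 'a topology \<Rightarrow> 'b topology \<Rightarrow> 'a fjoin_point \<Rightarrow> 'b fjoin_point
     \<Rightarrow> ('a \<times> 'b) fjoin_point" where
  "psi_map n m A B c d =
     (case (rep c, rep d) of ((a, t), (b, s)) \<Rightarrow>
        let \<theta> = (SOME \<theta>. \<theta> \<in> shuffles_perm n m \<and> (t, s) \<in> shuffle_simplex n m \<theta>)
        in njoin_pt (n + m) (kprod A B) (delta_shuffle n m \<theta> a b, psi_simplex n m \<theta> (t, s)))"

text \<open>The map \<open>(\<langle>a | t\<rangle>, u) \<mapsto> \<langle>a, * | (1 - u) t, u\<rangle>\<close> from \<open>J\<^sup>n(A) \<times> I\<close> to \<open>J\<^sup>n\<^sup>+\<^sup>1(A)\<close>.\<close>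

definition join_extend :: "nat \<Rightarrow> 'a topology \<Rightarrow> 'a \<Rightarrow> 'a fjoin_point \<Rightarrow> real \<Rightarrow> 'a fjoin_point" where
  "join_extend n A a0 c u =
     (case rep c of (a, t) \<Rightarrow>
        njoin_pt (n + 1) A (a(n + 1 := a0), \<lambda>i. if i = n + 1 then u else (1 - u) * t i))"

text \<open>A point of \<open>J\<^sup>n(A) \<circledast> J\<^sup>m(B)\<close> is a pair \<open>([x, u], [y, v])\<close> with \<open>u = 0\<close> or \<open>v = 0\<close>; the two cases
  agree when both vanish.\<close>

definition Phi_map ::
    "nat \<Rightarrow> nat \<Rightarrow> 'a topology \<Rightarrow> 'a \<Rightarrow> 'b topology \<Rightarrow> 'b
     \<Rightarrow> ('a fjoin_point \<times> real) set \<times> ('b fjoin_point \<times> real) set \<Rightarrow> ('a \<times> 'b) fjoin_point" where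
  "Phi_map n m A a0 B b0 =
     (\<lambda>(c, d). case (rep c, rep d) of ((x, u), (y, v)) \<Rightarrow>
        if u = 0 then psi_map n (m + 1) A B x (join_extend m B b0 y v)
        else psi_map (n + 1) m A B (join_extend n A a0 x u) y)"

end

theory Submission
  imports Defs
begin

text \<open>
  The Hopf invariant \<open>H\<close> of \<open>\<phi>\<close> extends \<open>\<phi>\<close> to a map \<open>\<phi>' : X \<rightarrow> J\<^sup>n\<^sup>+\<^sup>1\<^sub>X(\<A>)\<close>: use the homotopy
  from \<open>\<phi> \<circ> \<alpha>\<close> to \<open>H\<close> on a collar of the cone \<open>CS\<close> and the cone on \<open>H\<close> in \<open>J\<^sup>n\<^sup>+\<^sup>1(A)\<close> on the rest. The map
  \<open>p\<^sub>n\<^sub>+\<^sub>1 \<circ> \<phi>'\<close> is homotopic to the identity as soon as a certain family of loops of \<open>X\<close> parametrised by \<open>S\<close>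
  vanishes; because \<open>n \<ge> 1\<close> and \<open>S\<close> is a suspension, that family lifts to a self homotopy of \<open>H\<close> in the
  fibred join, with which the chosen homotopy is corrected.

  With \<open>\<psi>' : Y \<rightarrow> J\<^sup>m\<^sup>+\<^sup>1\<^sub>Y(\<B>)\<close> obtained in the same way, the fibrewise shuffle map applied to \<open>\<phi>' \<times> \<psi>'\<close> takes
  values in \<open>J\<^sup>n\<^sup>+\<^sup>m\<^sup>+\<^sup>2\<close>. On \<open>X \<times> L \<union> K \<times> Y\<close> one of the two last weights vanishes, hence so does the last weight
  of the shuffle, which gives a lifting to \<open>J\<^sup>n\<^sup>+\<^sup>m\<^sup>+\<^sup>1\<close>. Deforming \<open>\<phi>'\<close> and \<open>\<psi>'\<close> on the two cones to the cones on
  the Hopf invariants turns its composite with \<open>W\<close> into the shuffle map \<open>\<Phi>\<close>.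
\<close>

section \<open>Products of k-spaces\<close>

text \<open>Over \<open>X \<times> L\<close> the first factor runs through all of X, so a lifting
  over K is not enough there. Extending it over the cone is easy; the difficulty lies in its
  projection. Each s in S gives a path from x0 to the cone point: the projected homotopy from H to
  \<open>\<phi> \<circ> \<alpha>\<close>, then the given homotopy on K, then the cone line of s. The
  homotopy to the identity is closed at the cone point by deforming all these paths, rel end points,
  to one path that does not depend on s. Comparing each path with the one of the base point produces
  the loops. A second difficulty: the shuffle map is defined through chosen representatives and a
  chosen shuffle. Both choices disappear in a closed formula. The weights t and s cut [0,1] into
  intervals, and the length of the overlap of the i-th interval of t with the j-th interval of s is
  the weight of the vertex (i,j) in every shuffle simplex containing (t,s). Its continuity on joins
  rests on k-products, which preserve quotient maps between the spaces in question.\<close>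

lemma continuous_map_comp_pair:
  assumes "continuous_map (prod_topology A B) Z F" "continuous_map Q A a" "continuous_map Q B b"
  shows "continuous_map Q Z (\<lambda>x. F (a x, b x))"
  using continuous_map_compose [OF continuous_map_pairedI [OF assms(2,3)] assms(1)] by (simp add: o_def)

lemma continuous_map_comp:
  assumes "continuous_map A Z F" "continuous_map Q A a"
  shows "continuous_map Q Z (\<lambda>x. F (a x))"
  using continuous_map_compose [OF assms(2,1)] by (simp add: o_def)

lemma continuous_map_if_le:
  assumes "continuous_map X euclideanreal p" "continuous_map X euclideanreal q"
    and "continuous_map X Y f" "continuous_map X Y g"
    and "\<And>x. \<lbrakk>x \<in> topspace X; p x = q x\<rbrakk> \<Longrightarrow> f x = g x"
  shows "continuous_map X Y (\<lambda>x. if p x \<le> q x then f x else g x)"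
  using assms by (intro continuous_map_cases_le continuous_map_from_subtopology) auto

text \<open>Clamping makes piecewise linear reparametrisations continuous into the interval without
  bounds to check; where the value matters it is the identity.\<close>

definition clamp01 :: "real \<Rightarrow> real" where
  "clamp01 x = min 1 (max 0 x)"

lemma clamp01_simps [simp]:
  "0 \<le> x \<Longrightarrow> x \<le> 1 \<Longrightarrow> clamp01 x = x" "x \<le> 0 \<Longrightarrow> clamp01 x = 0" "1 \<le> x \<Longrightarrow> clamp01 x = 1"
  by (auto simp: clamp01_def)

lemma clamp01_mem [simp]: "0 \<le> clamp01 x" "clamp01 x \<le> 1"
  by (auto simp: clamp01_def)

lemma continuous_map_clamp01 [continuous_intros]:
  "continuous_map X euclideanreal f \<Longrightarrow> continuous_map X unit_interval (\<lambda>x. clamp01 (f x))"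
  unfolding clamp01_def continuous_map_in_subtopology by (auto intro!: continuous_intros)

lemma continuous_map_to_interval:
  "continuous_map X euclideanreal f \<Longrightarrow> (\<And>x. x \<in> topspace X \<Longrightarrow> 0 \<le> f x \<and> f x \<le> 1)
    \<Longrightarrow> continuous_map X unit_interval f"
  by (auto simp: continuous_map_in_subtopology)

lemma continuous_map_from_interval:
  "continuous_map X unit_interval f \<Longrightarrow> continuous_map X euclideanreal f"
  by (auto simp: continuous_map_in_subtopology)

lemma continuous_map_fst_interval [continuous_intros]:
  "continuous_map (prod_topology unit_interval X) euclideanreal fst"
  by (rule continuous_map_from_interval) (rule continuous_map_fst)

lemma continuous_map_snd_interval [continuous_intros]:
  "continuous_map (prod_topology X unit_interval) euclideanreal snd"
  by (rule continuous_map_from_interval) (rule continuous_map_snd)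

lemma compact_unit_interval: "compact_space unit_interval"
  by (simp add: compact_space_subtopology)

lemma Hausdorff_unit_interval: "Hausdorff_space unit_interval"
  by (simp add: Hausdorff_space_subtopology)

lemma locally_compact_unit_interval: "locally_compact_space unit_interval"
  by (simp add: compact_imp_locally_compact_space compact_unit_interval)

lemma k_space_interval_prod: "k_space X \<Longrightarrow> k_space (prod_topology unit_interval X)"
  using k_space_prod_topology_left locally_compact_unit_interval Hausdorff_unit_interval by blast

lemma quotient_map_interval_prod:
  "quotient_map X Y f \<Longrightarrow>
   quotient_map (prod_topology unit_interval X) (prod_topology unit_interval Y) (\<lambda>(t, x). (t, f x))"
  using quotient_map_prod_right locally_compact_unit_interval Hausdorff_unit_interval by blast

lemma topspace_kprod [simp]: "topspace (kprod X Y) = topspace X \<times> topspace Y"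
  by (simp add: kprod_def)

lemma k_space_kprod [simp]: "k_space (kprod X Y)"
  by (simp add: kprod_def)

lemma continuous_map_kprod_fst [continuous_intros]: "continuous_map (kprod X Y) X fst"
  unfolding kprod_def by (intro continuous_map_from_kification continuous_map_fst)

lemma continuous_map_kprod_snd [continuous_intros]: "continuous_map (kprod X Y) Y snd"
  unfolding kprod_def by (intro continuous_map_from_kification continuous_map_snd)

lemma continuous_map_into_kprod:
  assumes "k_space Z" "continuous_map Z X f" "continuous_map Z Y g"
  shows "continuous_map Z (kprod X Y) (\<lambda>z. (f z, g z))"
  unfolding kprod_def using assms by (simp add: continuous_map_into_kification continuous_map_pairedI)

lemma Hausdorff_space_kification: "Hausdorff_space X \<Longrightarrow> Hausdorff_space (kification X)"
  unfolding Hausdorff_space_def by (metis openin_kification_finer topspace_kification)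

lemma Hausdorff_space_kprod:
  "Hausdorff_space X \<Longrightarrow> Hausdorff_space Y \<Longrightarrow> Hausdorff_space (kprod X Y)"
  unfolding kprod_def by (intro Hausdorff_space_kification) (simp add: Hausdorff_space_prod_topology)

lemma kprod_eq_prod:
  assumes "k_space X" "compact_space Y" "Hausdorff_space Y"
  shows "kprod X Y = prod_topology X Y"
  unfolding kprod_def kification_eq_self
  using assms k_space_prod_topology_right compact_imp_locally_compact_space by blast

text \<open>A closed subspace of a k-space is a k-space, so the identity from
  \<open>subtopology (kification X) C\<close> factors through the k-ification of the subspace; the
  opposite comparison holds for every subset. Needed for fibres, which are closed.\<close>

lemma kification_closed_subtopology:
  assumes "closedin X C"
  shows "kification (subtopology X C) = subtopology (kification X) C"
proof -
  have k: "k_space (subtopology (kification X) C)"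
    using assms by (simp add: closedin_kification_finer k_space_closed_subtopology)
  have "continuous_map (subtopology (kification X) C) (subtopology X C) id"
    by (simp add: continuous_map_from_kification continuous_map_from_subtopology continuous_map_in_subtopology)
  then have "continuous_map (subtopology (kification X) C) (kification (subtopology X C)) id"
    using k continuous_map_into_kification by blast
  then have "openin (kification (subtopology X C)) U \<Longrightarrow> openin (subtopology (kification X) C) U" for U
    using openin_continuous_map_preimage [of _ _ id U] openin_subset [of _ U]
    by (force simp: Int_def conj_commute dest: openin_subset elim!: back_subst[of "openin _"])
  moreover have "openin (subtopology (kification X) C) U \<Longrightarrow> openin (kification (subtopology X C)) U" for U
    by (rule subtopology_kification_finer)
  ultimately show ?thesis
    unfolding topology_eq by blast
qed

lemma kprod_closed_subtopology:
  assumes "closedin X A" "closedin Y B"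
  shows "kprod (subtopology X A) (subtopology Y B) = subtopology (kprod X Y) (A \<times> B)"
  unfolding kprod_def
proof -
  have "subtopology (prod_topology X Y) (A \<times> B) = prod_topology (subtopology X A) (subtopology Y B)"
    by (rule subtopology_Times)
  moreover have "closedin (prod_topology X Y) (A \<times> B)"
    using assms by (simp add: closedin_prod_Times_iff)
  ultimately show "kification (prod_topology (subtopology X A) (subtopology Y B)) =
      subtopology (kification (prod_topology X Y)) (A \<times> B)"
    by (metis kification_closed_subtopology)
qed

text \<open>Openness in \<open>kprod X Z\<close> is tested on compact sets C. The projection D of C
  to Z is compact Hausdorff, and the ordinary product with such a D preserves quotient maps. So the
  test moves to \<open>X' \<times> D\<close>, which is already a k-space and therefore maps
  continuously to \<open>kprod X' Z\<close>.\<close>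

lemma quotient_map_kprod_left:
  assumes q: "quotient_map X' X q" and X': "k_space X'" and Z: "Hausdorff_space Z"
  shows "quotient_map (kprod X' Z) (kprod X Z) (\<lambda>(x, z). (q x, z))"
  unfolding quotient_map_def topspace_kprod
proof (intro conjI allI impI)
  have qim: "q ` topspace X' = topspace X"
    using q quotient_imp_surjective_map by blast
  show "(\<lambda>(x, z). (q x, z)) ` (topspace X' \<times> topspace Z) = topspace X \<times> topspace Z"
    by (auto simp flip: qim)
  fix U assume U: "U \<subseteq> topspace X \<times> topspace Z"
  let ?P = "{x \<in> topspace X' \<times> topspace Z. (case x of (x, z) \<Rightarrow> (q x, z)) \<in> U}"
  have cont: "continuous_map (kprod X' Z) (kprod X Z) (\<lambda>(x, z). (q x, z))"
    using continuous_map_into_kprod [OF k_space_kprod, of X' Z X "q \<circ> fst" Z snd]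
      continuous_map_compose [OF continuous_map_kprod_fst quotient_imp_continuous_map [OF q], of Z]
    by (simp add: continuous_map_kprod_snd case_prod_unfold o_def)
  show "openin (kprod X' Z) ?P = openin (kprod X Z) U"
  proof
    assume "openin (kprod X Z) U"
    then show "openin (kprod X' Z) ?P"
      using openin_continuous_map_preimage [OF cont] by (simp only: topspace_kprod)
  next
    assume P: "openin (kprod X' Z) ?P"
    show "openin (kprod X Z) U"
      unfolding kprod_def openin_kification
    proof (intro conjI allI impI)
      show "U \<subseteq> topspace (prod_topology X Z)" using U by simp
      fix C assume C: "compactin (prod_topology X Z) C"
      define D where "D = snd ` C"
      have D: "compactin Z D"
        unfolding D_def using C continuous_map_snd image_compactin by blast
      let ?D = "subtopology Z D"
      have cD: "compact_space ?D" "Hausdorff_space ?D"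
        using D Z by (auto simp: compact_space_subtopology Hausdorff_space_subtopology)
      then have lc: "locally_compact_space ?D"
        by (simp add: compact_imp_locally_compact_space)
      have quo: "quotient_map (prod_topology X' ?D) (prod_topology X ?D) (\<lambda>(x, z). (q x, z))"
        using quotient_map_prod_left [OF lc _ q] cD by blast
      have "k_space (prod_topology X' ?D)"
        using k_space_prod_topology_right X' lc cD by blast
      then have "continuous_map (prod_topology X' ?D) (kprod X' Z) (\<lambda>x. (fst x, snd x))"
        by (rule continuous_map_into_kprod [OF _ continuous_map_fst
            continuous_map_into_fulltopology [OF continuous_map_snd]])
      then have "openin (prod_topology X' ?D) {x \<in> topspace (prod_topology X' ?D). (fst x, snd x) \<in> ?P}"
        using P openin_continuous_map_preimage by blast
      also have "{x \<in> topspace (prod_topology X' ?D). (fst x, snd x) \<in> ?P} =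
          {x \<in> topspace (prod_topology X' ?D). (case x of (x, z) \<Rightarrow> (q x, z)) \<in> U \<inter> (topspace X \<times> D)}"
        using qim by auto
      finally have *: "openin (prod_topology X' ?D)
          {x \<in> topspace (prod_topology X' ?D). (case x of (x, z) \<Rightarrow> (q x, z)) \<in> U \<inter> (topspace X \<times> D)}" .
      have "U \<inter> (topspace X \<times> D) \<subseteq> topspace (prod_topology X ?D)"
        using U by auto
      with * have "openin (prod_topology X ?D) (U \<inter> (topspace X \<times> D))"
        using quo unfolding quotient_map_def by blast
      moreover have "prod_topology X ?D = subtopology (prod_topology X Z) (topspace X \<times> D)"
        by (simp add: prod_topology_subtopology)
      ultimately obtain V where V: "openin (prod_topology X Z) V" "U \<inter> (topspace X \<times> D) = V \<inter> (topspace X \<times> D)"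
        by (auto simp: openin_subtopology)
      have "C \<subseteq> topspace X \<times> D"
        using compactin_subset_topspace [OF C] by (force simp: D_def)
      then have "C \<inter> U = C \<inter> V" using V(2) by blast
      then show "openin (subtopology (prod_topology X Z) C) (C \<inter> U)"
        using V(1) by (simp add: openin_subtopology_Int2)
    qed
  qed
qed

lemma continuous_map_kprod_swap: "continuous_map (kprod X Y) (kprod Y X) prod.swap"
proof -
  have "prod.swap = (\<lambda>z :: 'a \<times> 'b. (snd z, fst z))" by auto
  then show ?thesis
    using continuous_map_into_kprod [OF k_space_kprod continuous_map_kprod_snd continuous_map_kprod_fst, of X Y]
    by (simp only:)
qed

lemma quotient_map_kprod_swap: "quotient_map (kprod X Y) (kprod Y X) prod.swap"
proof -
  have "homeomorphic_maps (kprod X Y) (kprod Y X) prod.swap prod.swap"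
    by (simp add: homeomorphic_maps_def continuous_map_kprod_swap)
  then show ?thesis
    using homeomorphic_map_def homeomorphic_maps_map by blast
qed

lemma quotient_map_kprod_right:
  assumes q: "quotient_map X' X q" and X': "k_space X'" and Z: "Hausdorff_space Z"
  shows "quotient_map (kprod Z X') (kprod Z X) (\<lambda>(z, x). (z, q x))"
proof -
  have "quotient_map (kprod Z X') (kprod Z X) (prod.swap \<circ> (\<lambda>(x, z). (q x, z)) \<circ> prod.swap)"
    by (rule quotient_map_compose [OF quotient_map_kprod_swap
          quotient_map_compose [OF quotient_map_kprod_left [OF assms] quotient_map_kprod_swap]])
  then show ?thesis
    by (rule back_subst [of "quotient_map _ _"]) auto
qed

text \<open>One factor at a time, through \<open>kprod X Y'\<close>; this is why Hausdorffness is
  asked of X and of Y'.\<close>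

lemma quotient_map_kprod:
  assumes "quotient_map X' X q" "k_space X'" "quotient_map Y' Y r" "k_space Y'"
    and "Hausdorff_space X" "Hausdorff_space Y'"
  shows "quotient_map (kprod X' Y') (kprod X Y) (\<lambda>(x, y). (q x, r y))"
proof -
  have "quotient_map (kprod X' Y') (kprod X Y) ((\<lambda>(z, x). (z, r x)) \<circ> (\<lambda>(x, z). (q x, z)))"
    by (rule quotient_map_compose [OF quotient_map_kprod_left quotient_map_kprod_right]) (use assms in auto)
  then show ?thesis
    by (rule back_subst [of "quotient_map _ _"]) auto
qed

section \<open>Push-outs realised on unions\<close>

lemma topspace_union_topology: "topspace (union_topology P Q) = topspace P \<union> topspace Q"
proof -
  have "openin (union_topology P Q) (topspace P \<union> topspace Q)"
    unfolding openin_union_topology by (simp add: Int_absorb1)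
  then show ?thesis
    using openin_subset openin_union_topology by (metis openin_topspace subset_antisym)
qed

lemma continuous_map_union_topology_left: "continuous_map P (union_topology P Q) id"
  unfolding continuous_map_def topspace_union_topology openin_union_topology
  by (auto simp: Int_def conj_commute)

lemma continuous_map_union_topology_right: "continuous_map Q (union_topology P Q) id"
  unfolding continuous_map_def topspace_union_topology openin_union_topology
  by (auto simp: Int_def conj_commute)

lemma continuous_map_from_union_topology:
  assumes "continuous_map P Z f" "continuous_map Q Z f"
  shows "continuous_map (union_topology P Q) Z f"
  unfolding continuous_map_def topspace_union_topology openin_union_topology
proof (intro conjI allI impI)
  show "f \<in> topspace P \<union> topspace Q \<rightarrow> topspace Z"
    using assms by (auto simp: continuous_map_def)
next
  fix U assume U: "openin Z U"
  show "{x \<in> topspace P \<union> topspace Q. f x \<in> U} \<subseteq> topspace P \<union> topspace Q" by auto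
  have "{x \<in> topspace P \<union> topspace Q. f x \<in> U} \<inter> topspace P = {x \<in> topspace P. f x \<in> U}" by auto
  then show "openin P ({x \<in> topspace P \<union> topspace Q. f x \<in> U} \<inter> topspace P)"
    using openin_continuous_map_preimage [OF assms(1) U] by simp
  have "{x \<in> topspace P \<union> topspace Q. f x \<in> U} \<inter> topspace Q = {x \<in> topspace Q. f x \<in> U}" by auto
  then show "openin Q ({x \<in> topspace P \<union> topspace Q. f x \<in> U} \<inter> topspace Q)"
    using openin_continuous_map_preimage [OF assms(2) U] by simp
qed

text \<open>Compact subsets of a piece stay compact in the union, so a set that is open on all
  compact sets of the union is open on those of each piece. Maps from the push-outs into k-products
  rely on this.\<close>

lemma k_space_union_topology:
  assumes "k_space P" "k_space Q"
  shows "k_space (union_topology P Q)"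
proof -
  let ?U = "union_topology P Q"
  have "openin R (S \<inter> topspace R)"
    if S: "\<forall>K. compactin ?U K \<longrightarrow> openin (subtopology ?U K) (K \<inter> S)"
      and R: "k_space R" "continuous_map R ?U id" for S R
  proof -
    have "openin (subtopology R K) (K \<inter> (S \<inter> topspace R))" if K: "compactin R K" for K
    proof -
      have "compactin ?U K" using image_compactin [OF K R(2)] by simp
      then have o: "openin (subtopology ?U K) (K \<inter> S)" using S by blast
      have "continuous_map (subtopology R K) (subtopology ?U K) id"
        using R(2) by (simp add: continuous_map_from_subtopology continuous_map_in_subtopology)
      from openin_continuous_map_preimage [OF this o]
      show ?thesis using compactin_subset_topspace [OF K]
        by (auto elim!: back_subst[of "openin _"])
    qed
    then show ?thesis using R(1) by (auto simp: k_space_open)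
  qed
  then show ?thesis
    using assms unfolding k_space_open
    by (auto simp: openin_union_topology topspace_union_topology continuous_map_union_topology_left
        continuous_map_union_topology_right simp flip: k_space_open)
qed

section \<open>Families of paths and the homotopy lifting property\<close>

lemma continuous_map_projections:
  "continuous_map (prod_topology A (prod_topology B C)) B (\<lambda>x. fst (snd x))"
  "continuous_map (prod_topology A (prod_topology B C)) C (\<lambda>x. snd (snd x))"
  "continuous_map (prod_topology (prod_topology A B) C) A (\<lambda>x. fst (fst x))"
  "continuous_map (prod_topology (prod_topology A B) C) B (\<lambda>x. snd (fst x))"
  by (rule continuous_map_comp [OF _ continuous_map_snd] continuous_map_comp [OF _ continuous_map_fst],
      rule continuous_map_fst continuous_map_snd)+

lemmas proj_cont = continuous_map_projections continuous_map_fst continuous_map_snd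

text \<open>The two conditions may overlap and need not be complementary: this is the gluing of maps
  along the axes of a wedge.\<close>

lemma continuous_map_if_closed:
  assumes "closedin X {x \<in> topspace X. P x}" "closedin X {x \<in> topspace X. R x}"
    and "\<And>x. x \<in> topspace X \<Longrightarrow> P x \<or> R x"
    and f: "continuous_map X Y f" and g: "continuous_map X Y g"
    and "\<And>x. \<lbrakk>x \<in> topspace X; P x; R x\<rbrakk> \<Longrightarrow> f x = g x"
  shows "continuous_map X Y (\<lambda>x. if P x then f x else g x)"
proof (rule pasting_lemma_closed [where I = "{True, False}"
      and T = "\<lambda>b. if b then {x \<in> topspace X. P x} else {x \<in> topspace X. R x}"
      and f = "\<lambda>b. if b then f else g"])
  fix i
  show "continuous_map (subtopology X (if i then {x \<in> topspace X. P x} else {x \<in> topspace X. R x})) Y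
      (if i then f else g)"
    using f g by (simp add: continuous_map_from_subtopology)
qed (use assms in \<open>auto split: if_splits\<close>)

lemma closedin_eq_const:
  assumes "continuous_map X Y f" "Hausdorff_space Y"
  shows "closedin X {x \<in> topspace X. f x = c}"
proof (cases "c \<in> topspace Y")
  case True
  then have "closedin Y {c}" using assms(2) by (simp add: closedin_Hausdorff_sing_eq)
  from closedin_continuous_map_preimage [OF assms(1) this] show ?thesis by simp
next
  case False
  then have "{x \<in> topspace X. f x = c} = {}"
    using assms(1) by (auto simp: continuous_map_def)
  then show ?thesis by (simp only: closedin_empty)
qed

section \<open>The homotopy lifting property for arbitrary k-spaces\<close>

text \<open>The quotient topology with the values of e as points instead of classes. It lives on the
  target type of e, which can therefore be chosen to be the type over which
  \<open>pointed_fibration\<close> quantifies.\<close>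

definition image_topology :: "('a \<Rightarrow> 'b) \<Rightarrow> 'a topology \<Rightarrow> 'b topology" where
  "image_topology e Z = topology (\<lambda>U. U \<subseteq> e ` topspace Z \<and> openin Z {z \<in> topspace Z. e z \<in> U})"

lemma openin_image_topology:
  "openin (image_topology e Z) U \<longleftrightarrow> U \<subseteq> e ` topspace Z \<and> openin Z {z \<in> topspace Z. e z \<in> U}"
proof -
  have "istopology (\<lambda>U. U \<subseteq> e ` topspace Z \<and> openin Z {z \<in> topspace Z. e z \<in> U})"
    unfolding istopology_def
  proof (intro conjI allI impI, goal_cases)
    case (2 U V)
    have "{z \<in> topspace Z. e z \<in> U \<inter> V} = {z \<in> topspace Z. e z \<in> U} \<inter> {z \<in> topspace Z. e z \<in> V}"
      by auto
    with 2 show ?case by auto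
  next
    case (4 \<K>)
    have "{z \<in> topspace Z. e z \<in> \<Union>\<K>} = \<Union>((\<lambda>U. {z \<in> topspace Z. e z \<in> U}) ` \<K>)" by auto
    with 4 show ?case by auto
  qed auto
  then show ?thesis
    by (simp add: image_topology_def topology_inverse')
qed

lemma quotient_map_image_topology: "quotient_map Z (image_topology e Z) e"
proof -
  have "{z \<in> topspace Z. e z \<in> e ` topspace Z} = topspace Z" by auto
  then have "openin (image_topology e Z) (e ` topspace Z)"
    by (auto simp: openin_image_topology)
  from openin_subset [OF this] have "topspace (image_topology e Z) = e ` topspace Z"
    using openin_image_topology [of e Z "topspace (image_topology e Z)"] by blast
  then show ?thesis
    unfolding quotient_map_def by (auto simp: openin_image_topology)
qed

lemma separate_by_map:
  assumes "continuous_map Q H g" "Hausdorff_space H" "x \<in> topspace Q" "y \<in> topspace Q" "g x \<noteq> g y"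
  shows "\<exists>U V. openin Q U \<and> openin Q V \<and> x \<in> U \<and> y \<in> V \<and> disjnt U V"
proof -
  have "g x \<in> topspace H" "g y \<in> topspace H"
    using assms by (auto simp: continuous_map_def)
  then obtain U V where "openin H U" "openin H V" "g x \<in> U" "g y \<in> V" "disjnt U V"
    using assms(2,5) unfolding Hausdorff_space_def by metis
  then show ?thesis
    using assms
    by (intro exI[of _ "{x \<in> topspace Q. g x \<in> U}"] exI[of _ "{x \<in> topspace Q. g x \<in> V}"])
       (auto simp: disjnt_iff intro: openin_continuous_map_preimage)
qed

text \<open>The graph \<open>z \<mapsto> (f z, h(\<cdot>, z))\<close> pushes an arbitrary test space forward to the type over which
  the homotopy lifting property is stated; the image is automatically Hausdorff.\<close>

lemma pointed_fibration_lift: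
  assumes p: "pointed_fibration E e0 X x0 p" and "Hausdorff_space E" "Hausdorff_space X"
    and Z: "k_space Z" and f: "continuous_map Z E f"
    and h: "continuous_map (prod_topology unit_interval Z) X h"
    and hf: "\<And>z. z \<in> topspace Z \<Longrightarrow> h (0, z) = p (f z)"
  obtains g where "continuous_map (prod_topology unit_interval Z) E g"
    "\<And>z. z \<in> topspace Z \<Longrightarrow> g (0, z) = f z"
    "\<And>t z. \<lbrakk>t \<in> {0..1}; z \<in> topspace Z\<rbrakk> \<Longrightarrow> p (g (t, z)) = h (t, z)"
proof -
  \<comment> \<open>Because of the clamping, evaluation at every real t is continuous on Q. Two
    distinct points of Q differ in the first component or in some evaluation, and that map separates
    them.\<close>
  define e where "e z = (f z, \<lambda>t. h (clamp01 t, z))" for z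
  define Q where "Q = image_topology e Z"
  have q: "quotient_map Z Q e"
    unfolding Q_def by (rule quotient_map_image_topology)
  have tQ: "topspace Q = e ` topspace Z"
    using q quotient_imp_surjective_map by metis
  have cf: "continuous_map Q E fst"
    by (rule continuous_compose_quotient_map [OF q]) (use f in \<open>simp add: o_def e_def\<close>)
  have ch: "continuous_map Q X (\<lambda>v. snd v t)" for t
  proof (rule continuous_compose_quotient_map [OF q])
    have "continuous_map Z X (\<lambda>z. h (clamp01 t, z))"
      by (rule continuous_map_comp_pair [OF h]) auto
    then show "continuous_map Z X ((\<lambda>v. snd v t) \<circ> e)"
      by (simp add: o_def e_def)
  qed
  have "Hausdorff_space Q"
    unfolding Hausdorff_space_def
  proof (intro allI impI, elim conjE)
    fix x y assume xy: "x \<in> topspace Q" "y \<in> topspace Q" "x \<noteq> y"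
    show "\<exists>U V. openin Q U \<and> openin Q V \<and> x \<in> U \<and> y \<in> V \<and> disjnt U V"
    proof (cases "fst x = fst y")
      case True
      with xy obtain t where "snd x t \<noteq> snd y t" by (metis prod.collapse ext)
      then show ?thesis using separate_by_map [OF ch assms(3)] xy by blast
    next
      case False
      then show ?thesis using separate_by_map [OF cf assms(2)] xy by blast
    qed
  qed
  moreover have "k_space Q"
    using k_space_quotient_map_image q Z by blast
  moreover have "continuous_map (prod_topology unit_interval Q) X (\<lambda>(t, v). snd v t)"
  proof (rule continuous_compose_quotient_map [OF quotient_map_interval_prod [OF q]])
    show "continuous_map (prod_topology unit_interval Z) X ((\<lambda>(t, v). snd v t) \<circ> (\<lambda>(t, z). (t, e z)))"
      by (rule continuous_map_eq [OF h]) (auto simp: e_def)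
  qed
  moreover have "\<forall>v\<in>topspace Q. (case (0, v) of (t, v) \<Rightarrow> snd v t) = p (fst v)"
    using hf by (auto simp: tQ e_def)
  ultimately have "compactly_generated Q \<and> continuous_map Q E fst \<and>
      continuous_map (prod_topology unit_interval Q) X (\<lambda>(t, v). snd v t) \<and>
      (\<forall>v\<in>topspace Q. (case (0, v) of (t, v) \<Rightarrow> snd v t) = p (fst v))"
    using cf by (simp only: compactly_generated_def simp_thms)
  from conjunct2 [OF p [unfolded pointed_fibration_def], THEN spec, THEN spec, THEN spec, THEN mp, OF this]
  obtain g where g: "continuous_map (prod_topology unit_interval Q) E g"
      "\<forall>v\<in>topspace Q. g (0, v) = fst v"
      "\<forall>t\<in>{0..1}. \<forall>v\<in>topspace Q. p (g (t, v)) = (case (t, v) of (t, v) \<Rightarrow> snd v t)"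
    by blast
  show ?thesis
  proof
    show "continuous_map (prod_topology unit_interval Z) E (\<lambda>x. g (fst x, e (snd x)))"
      by (intro continuous_map_comp_pair [OF g(1)] continuous_map_fst
          continuous_map_comp [OF quotient_imp_continuous_map [OF q]] continuous_map_snd)
    show "g (fst (0, z), e (snd (0, z))) = f z" if "z \<in> topspace Z" for z
      using g(2) that by (simp add: tQ e_def)
    show "p (g (fst (t, z), e (snd (t, z)))) = h (t, z)" if "t \<in> {0..1}" "z \<in> topspace Z" for t z
      using g(3) that by (simp add: tQ e_def)
  qed
qed

section \<open>The groupoid calculus of families of paths\<close>

definition path_family :: "'s topology \<Rightarrow> 'x topology \<Rightarrow> (real \<times> 's \<Rightarrow> 'x) \<Rightarrow> bool" where
  "path_family S X f \<longleftrightarrow> continuous_map (prod_topology unit_interval S) X f"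

text \<open>Path homotopy rel end points with a parameter s. The end points may vary with s, so they
  are compared with those of f and not with constants.\<close>

definition fam_homotopic ::
    "'s topology \<Rightarrow> 'x topology \<Rightarrow> (real \<times> 's \<Rightarrow> 'x) \<Rightarrow> (real \<times> 's \<Rightarrow> 'x) \<Rightarrow> bool" where
  "fam_homotopic S X f g \<longleftrightarrow>
     homotopic_with (\<lambda>h. \<forall>s\<in>topspace S. h (0, s) = f (0, s) \<and> h (1, s) = f (1, s))
       (prod_topology unit_interval S) X f g"

lemma fam_homotopic_iff:
  "fam_homotopic S X f g \<longleftrightarrow>
    (\<exists>V. continuous_map (prod_topology unit_interval (prod_topology unit_interval S)) X V \<and>
      (\<forall>u\<in>{0..1}. \<forall>s\<in>topspace S. V (0, (u, s)) = f (u, s) \<and> V (1, (u, s)) = g (u, s)) \<and>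
      (\<forall>v\<in>{0..1}. \<forall>s\<in>topspace S. V (v, (0, s)) = f (0, s) \<and> V (v, (1, s)) = f (1, s)))"
proof -
  have "(\<And>x. x \<in> topspace (prod_topology unit_interval S) \<Longrightarrow> h x = k x) \<Longrightarrow>
      (\<forall>s\<in>topspace S. h (0, s) = f (0, s) \<and> h (1, s) = f (1, s)) =
      (\<forall>s\<in>topspace S. k (0, s) = f (0, s) \<and> k (1, s) = f (1, s))" for h k :: "real \<times> 'a \<Rightarrow> 'b"
    by simp
  then show ?thesis
    unfolding fam_homotopic_def by (subst homotopic_with) (simp_all, blast)
qed

lemma fam_homotopicE:
  assumes "fam_homotopic S X f g"
  obtains V where "continuous_map (prod_topology unit_interval (prod_topology unit_interval S)) X V"
    "\<And>u s. 0 \<le> u \<Longrightarrow> u \<le> 1 \<Longrightarrow> s \<in> topspace S \<Longrightarrow> V (0, (u, s)) = f (u, s)"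
    "\<And>u s. 0 \<le> u \<Longrightarrow> u \<le> 1 \<Longrightarrow> s \<in> topspace S \<Longrightarrow> V (1, (u, s)) = g (u, s)"
    "\<And>v s. 0 \<le> v \<Longrightarrow> v \<le> 1 \<Longrightarrow> s \<in> topspace S \<Longrightarrow> V (v, (0, s)) = f (0, s)"
    "\<And>v s. 0 \<le> v \<Longrightarrow> v \<le> 1 \<Longrightarrow> s \<in> topspace S \<Longrightarrow> V (v, (1, s)) = f (1, s)"
  using assms unfolding fam_homotopic_iff by auto

lemma fam_homotopicI:
  assumes "continuous_map (prod_topology unit_interval (prod_topology unit_interval S)) X V"
    "\<And>u s. 0 \<le> u \<Longrightarrow> u \<le> 1 \<Longrightarrow> s \<in> topspace S \<Longrightarrow> V (0, (u, s)) = f (u, s)"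
    "\<And>u s. 0 \<le> u \<Longrightarrow> u \<le> 1 \<Longrightarrow> s \<in> topspace S \<Longrightarrow> V (1, (u, s)) = g (u, s)"
    "\<And>v s. 0 \<le> v \<Longrightarrow> v \<le> 1 \<Longrightarrow> s \<in> topspace S \<Longrightarrow> V (v, (0, s)) = f (0, s)"
    "\<And>v s. 0 \<le> v \<Longrightarrow> v \<le> 1 \<Longrightarrow> s \<in> topspace S \<Longrightarrow> V (v, (1, s)) = f (1, s)"
  shows "fam_homotopic S X f g"
  unfolding fam_homotopic_iff using assms by (intro exI[of _ V]) auto

lemma fam_homotopic_ends:
  assumes "fam_homotopic S X f g" "s \<in> topspace S"
  shows "g (0, s) = f (0, s)" "g (1, s) = f (1, s)"
  using assms by (auto elim!: fam_homotopicE) (metis order.refl zero_le_one)+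

lemma fam_homotopic_imp_path_family:
  "fam_homotopic S X f g \<Longrightarrow> path_family S X f \<and> path_family S X g"
  unfolding fam_homotopic_def path_family_def by (rule homotopic_with_imp_continuous_maps)

lemma fam_homotopic_eq:
  assumes "path_family S X f" "\<And>u s. \<lbrakk>0 \<le> u; u \<le> 1; s \<in> topspace S\<rbrakk> \<Longrightarrow> f (u, s) = g (u, s)"
  shows "fam_homotopic S X f g"
  using assms unfolding fam_homotopic_def path_family_def
  by (intro homotopic_with_equal) auto

lemma fam_homotopic_refl: "path_family S X f \<Longrightarrow> fam_homotopic S X f f"
  by (rule fam_homotopic_eq) auto

lemma fam_homotopic_sym:
  assumes "fam_homotopic S X f g"
  shows "fam_homotopic S X g f"
proof -
  have "homotopic_with (\<lambda>h. \<forall>s\<in>topspace S. h (0, s) = g (0, s) \<and> h (1, s) = g (1, s))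
       (prod_topology unit_interval S) X f g"
    using assms unfolding fam_homotopic_def
    by (rule homotopic_with_mono) (use fam_homotopic_ends [OF assms] in auto)
  then show ?thesis
    unfolding fam_homotopic_def by (rule homotopic_with_symD)
qed

lemma fam_homotopic_trans [trans]:
  assumes "fam_homotopic S X f g" "fam_homotopic S X g h"
  shows "fam_homotopic S X f h"
proof -
  have "homotopic_with (\<lambda>h. \<forall>s\<in>topspace S. h (0, s) = f (0, s) \<and> h (1, s) = f (1, s))
       (prod_topology unit_interval S) X g h"
    using assms(2) unfolding fam_homotopic_def
    by (rule homotopic_with_mono) (use fam_homotopic_ends [OF assms(1)] in auto)
  then show ?thesis
    using assms(1) unfolding fam_homotopic_def by (rule homotopic_with_trans [rotated])
qed

lemma fam_homotopic_map:
  assumes "fam_homotopic S X f g" "continuous_map X Y k"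
  shows "fam_homotopic S Y (\<lambda>x. k (f x)) (\<lambda>x. k (g x))"
proof -
  from assms(1) obtain V where
    V: "continuous_map (prod_topology unit_interval (prod_topology unit_interval S)) X V"
    "\<And>u s. 0 \<le> u \<Longrightarrow> u \<le> 1 \<Longrightarrow> s \<in> topspace S \<Longrightarrow> V (0, (u, s)) = f (u, s)"
    "\<And>u s. 0 \<le> u \<Longrightarrow> u \<le> 1 \<Longrightarrow> s \<in> topspace S \<Longrightarrow> V (1, (u, s)) = g (u, s)"
    "\<And>v s. 0 \<le> v \<Longrightarrow> v \<le> 1 \<Longrightarrow> s \<in> topspace S \<Longrightarrow> V (v, (0, s)) = f (0, s)"
    "\<And>v s. 0 \<le> v \<Longrightarrow> v \<le> 1 \<Longrightarrow> s \<in> topspace S \<Longrightarrow> V (v, (1, s)) = f (1, s)"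
    by (rule fam_homotopicE) blast
  show ?thesis
    by (rule fam_homotopicI [of S Y "\<lambda>x. k (V x)"])
       (simp_all add: V continuous_map_comp [OF assms(2) V(1)])
qed

text \<open>The straight line from \<sigma> to \<tau> stays in the interval by convexity, and it is
  constant where they agree, in particular at both ends.\<close>

lemma fam_homotopic_reparam:
  assumes "path_family S X f"
    and \<sigma>: "continuous_map unit_interval unit_interval \<sigma>"
    and \<tau>: "continuous_map unit_interval unit_interval \<tau>"
    and ends: "\<sigma> 0 = \<tau> 0" "\<sigma> 1 = \<tau> 1"
  shows "fam_homotopic S X (\<lambda>(u, s). f (\<sigma> u, s)) (\<lambda>(u, s). f (\<tau> u, s))"
proof -
  have f: "continuous_map (prod_topology unit_interval S) X f"
    using assms(1) by (simp add: path_family_def)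
  let ?r = "\<lambda>x::real \<times> real \<times> 's. (1 - fst x) * \<sigma> (fst (snd x)) + fst x * \<tau> (fst (snd x))"
  let ?Q = "prod_topology unit_interval (prod_topology unit_interval S)"
  have u: "continuous_map ?Q unit_interval (\<lambda>x. fst (snd x))"
    by (rule proj_cont)
  have s: "continuous_map ?Q S (\<lambda>x. snd (snd x))"
    by (rule proj_cont)
  have "continuous_map ?Q unit_interval ?r"
  proof (rule continuous_map_to_interval)
    show "continuous_map ?Q euclideanreal ?r"
      by (intro continuous_intros continuous_map_from_interval [OF continuous_map_comp [OF \<sigma> u]]
          continuous_map_from_interval [OF continuous_map_comp [OF \<tau> u]])
    fix x assume x: "x \<in> topspace ?Q"
    then have "\<sigma> (fst (snd x)) \<in> {0..1}" "\<tau> (fst (snd x)) \<in> {0..1}" "fst x \<in> {0..1}"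
      using \<sigma> \<tau> by (auto simp: continuous_map_def)
    then show "0 \<le> ?r x \<and> ?r x \<le> 1"
      by (auto intro: convex_bound_le)
  qed
  then have "continuous_map ?Q X (\<lambda>x. f (?r x, snd (snd x)))"
    by (intro continuous_map_comp_pair [OF f] s)
  then show ?thesis
    by (rule fam_homotopicI) (auto simp: ends algebra_simps)
qed

text \<open>Each groupoid law below follows from this: both sides run through the same family at
  different speeds.\<close>

lemma fam_homotopic_reparamI:
  assumes f: "path_family S X f"
    and "continuous_map unit_interval unit_interval \<sigma>" "continuous_map unit_interval unit_interval \<tau>"
    and "\<sigma> 0 = \<tau> 0" "\<sigma> 1 = \<tau> 1"
    and g: "\<And>u s. \<lbrakk>0 \<le> u; u \<le> 1; s \<in> topspace S\<rbrakk> \<Longrightarrow> g (u, s) = f (\<sigma> u, s)"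
    and h: "\<And>u s. \<lbrakk>0 \<le> u; u \<le> 1; s \<in> topspace S\<rbrakk> \<Longrightarrow> h (u, s) = f (\<tau> u, s)"
  shows "fam_homotopic S X g h"
proof -
  have r: "fam_homotopic S X (\<lambda>(u, s). f (\<sigma> u, s)) (\<lambda>(u, s). f (\<tau> u, s))"
    by (rule fam_homotopic_reparam) fact+
  note pf = fam_homotopic_imp_path_family [OF r]
  have "fam_homotopic S X g (\<lambda>(u, s). f (\<sigma> u, s))"
    by (rule fam_homotopic_sym, rule fam_homotopic_eq [OF conjunct1 [OF pf]]) (simp add: g)
  also note r
  also have "fam_homotopic S X (\<lambda>(u, s). f (\<tau> u, s)) h"
    by (rule fam_homotopic_eq [OF conjunct2 [OF pf]]) (simp add: h)
  finally show ?thesis .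
qed

definition famcat :: "(real \<times> 's \<Rightarrow> 'x) \<Rightarrow> (real \<times> 's \<Rightarrow> 'x) \<Rightarrow> real \<times> 's \<Rightarrow> 'x" where
  "famcat f g = (\<lambda>(u, s). if u \<le> 1/2 then f (clamp01 (2 * u), s) else g (clamp01 (2 * u - 1), s))"

definition famrev :: "(real \<times> 's \<Rightarrow> 'x) \<Rightarrow> real \<times> 's \<Rightarrow> 'x" where
  "famrev f = (\<lambda>(u, s). f (1 - u, s))"

lemma famcat_ends [simp]: "famcat f g (0, s) = f (0, s)" "famcat f g (1, s) = g (1, s)"
  by (auto simp: famcat_def)

lemma famrev_ends [simp]: "famrev f (0, s) = f (1, s)" "famrev f (1, s) = f (0, s)"
  by (auto simp: famrev_def)

lemma path_family_cat:
  assumes "path_family S X f" "path_family S X g" "\<And>s. s \<in> topspace S \<Longrightarrow> f (1, s) = g (0, s)"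
  shows "path_family S X (famcat f g)"
proof -
  have "continuous_map (prod_topology unit_interval S) X
     (\<lambda>x. if fst x \<le> 1/2 then f (clamp01 (2 * fst x), snd x) else g (clamp01 (2 * fst x - 1), snd x))"
  proof (rule continuous_map_if_le)
    show "continuous_map (prod_topology unit_interval S) X (\<lambda>x. f (clamp01 (2 * fst x), snd x))"
      using assms(1) unfolding path_family_def
      by (rule continuous_map_comp_pair) (intro continuous_intros)+
    show "continuous_map (prod_topology unit_interval S) X (\<lambda>x. g (clamp01 (2 * fst x - 1), snd x))"
      using assms(2) unfolding path_family_def
      by (rule continuous_map_comp_pair) (intro continuous_intros)+
    fix x assume x: "x \<in> topspace (prod_topology unit_interval S)" and h: "fst x = 1/2"
    show "f (clamp01 (2 * fst x), snd x) = g (clamp01 (2 * fst x - 1), snd x)"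
      unfolding h using x assms(3) by auto
  qed (auto intro: continuous_intros)
  then show ?thesis
    unfolding path_family_def famcat_def by (simp add: case_prod_unfold)
qed

lemma path_family_rev:
  assumes "path_family S X f"
  shows "path_family S X (famrev f)"
proof -
  have "continuous_map (prod_topology unit_interval S) unit_interval (\<lambda>x. 1 - fst x)"
    by (rule continuous_map_to_interval) (auto intro!: continuous_intros)
  from continuous_map_comp_pair [OF assms [unfolded path_family_def] this continuous_map_snd]
  show ?thesis
    unfolding path_family_def famrev_def by (simp add: case_prod_unfold)
qed

lemma famcat_cong:
  assumes f: "fam_homotopic S X f f'" and g: "fam_homotopic S X g g'"
    and fg: "\<And>s. s \<in> topspace S \<Longrightarrow> f (1, s) = g (0, s)"
  shows "fam_homotopic S X (famcat f g) (famcat f' g')"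
proof -
  from f obtain V where V: "continuous_map (prod_topology unit_interval (prod_topology unit_interval S)) X V"
    "\<And>u s. 0 \<le> u \<Longrightarrow> u \<le> 1 \<Longrightarrow> s \<in> topspace S \<Longrightarrow> V (0, (u, s)) = f (u, s)"
    "\<And>u s. 0 \<le> u \<Longrightarrow> u \<le> 1 \<Longrightarrow> s \<in> topspace S \<Longrightarrow> V (1, (u, s)) = f' (u, s)"
    "\<And>v s. 0 \<le> v \<Longrightarrow> v \<le> 1 \<Longrightarrow> s \<in> topspace S \<Longrightarrow> V (v, (0, s)) = f (0, s)"
    "\<And>v s. 0 \<le> v \<Longrightarrow> v \<le> 1 \<Longrightarrow> s \<in> topspace S \<Longrightarrow> V (v, (1, s)) = f (1, s)"
    by (rule fam_homotopicE) blast
  from g obtain W where W: "continuous_map (prod_topology unit_interval (prod_topology unit_interval S)) X W"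
    "\<And>u s. 0 \<le> u \<Longrightarrow> u \<le> 1 \<Longrightarrow> s \<in> topspace S \<Longrightarrow> W (0, (u, s)) = g (u, s)"
    "\<And>u s. 0 \<le> u \<Longrightarrow> u \<le> 1 \<Longrightarrow> s \<in> topspace S \<Longrightarrow> W (1, (u, s)) = g' (u, s)"
    "\<And>v s. 0 \<le> v \<Longrightarrow> v \<le> 1 \<Longrightarrow> s \<in> topspace S \<Longrightarrow> W (v, (0, s)) = g (0, s)"
    "\<And>v s. 0 \<le> v \<Longrightarrow> v \<le> 1 \<Longrightarrow> s \<in> topspace S \<Longrightarrow> W (v, (1, s)) = g (1, s)"
    by (rule fam_homotopicE) blast
  let ?Q = "prod_topology unit_interval (prod_topology unit_interval S)"
  let ?H = "\<lambda>x. if fst (snd x) \<le> 1/2 then V (fst x, (clamp01 (2 * fst (snd x)), snd (snd x)))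
      else W (fst x, (clamp01 (2 * fst (snd x) - 1), snd (snd x)))"
  have u: "continuous_map ?Q euclideanreal (\<lambda>x. fst (snd x))"
    by (intro continuous_map_from_interval proj_cont)
  have "continuous_map ?Q X ?H"
  proof (rule continuous_map_if_le)
    show "continuous_map ?Q X (\<lambda>x. V (fst x, (clamp01 (2 * fst (snd x)), snd (snd x))))"
      by (intro continuous_map_comp_pair [OF V(1)] continuous_map_pairedI continuous_map_clamp01
          continuous_map_real_mult_left u proj_cont)
    show "continuous_map ?Q X (\<lambda>x. W (fst x, (clamp01 (2 * fst (snd x) - 1), snd (snd x))))"
      by (intro continuous_map_comp_pair [OF W(1)] continuous_map_pairedI continuous_map_clamp01
          continuous_map_diff continuous_map_const [THEN iffD2] continuous_map_real_mult_left u proj_cont) auto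
    fix x assume x: "x \<in> topspace ?Q" and h: "fst (snd x) = 1/2"
    show "V (fst x, (clamp01 (2 * fst (snd x)), snd (snd x))) = W (fst x, (clamp01 (2 * fst (snd x) - 1), snd (snd x)))"
      unfolding h using x V W fg by auto
  qed (use u in auto)
  then show ?thesis
    by (rule fam_homotopicI) (auto simp: famcat_def V W)
qed

lemma famcat_assoc:
  assumes "path_family S X f" "path_family S X g" "path_family S X h"
    and "\<And>s. s \<in> topspace S \<Longrightarrow> f (1, s) = g (0, s)" "\<And>s. s \<in> topspace S \<Longrightarrow> g (1, s) = h (0, s)"
  shows "fam_homotopic S X (famcat (famcat f g) h) (famcat f (famcat g h))"
proof -
  \<comment> \<open>The concave function with slopes 2, 1, 1/2 that takes the break points 1/4, 1/2
    of the left bracketing to the break points 1/2, 3/4 of the right one.\<close>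
  define \<sigma> where "\<sigma> u = min (min (2 * u) (u + 1/4)) (u / 2 + 1/2)" for u :: real
  have F: "path_family S X (famcat f (famcat g h))"
    using assms by (intro path_family_cat) auto
  have \<sigma>: "continuous_map unit_interval unit_interval \<sigma>"
    by (rule continuous_map_to_interval) (auto simp: \<sigma>_def intro!: continuous_intros)
  show ?thesis
  proof (rule fam_homotopic_reparamI [OF F \<sigma>, where \<tau> = "\<lambda>u. u"])
    fix u :: real and s assume u: "0 \<le> u" "u \<le> 1" and s: "s \<in> topspace S"
    consider "u \<le> 1/4" | "1/4 < u" "u \<le> 1/2" | "1/2 < u" by linarith
    then show "famcat (famcat f g) h (u, s) = famcat f (famcat g h) (\<sigma> u, s)"
    proof cases
      case 1
      then have "\<sigma> u = 2 * u" using u by (auto simp: \<sigma>_def)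
      with 1 u show ?thesis by (simp add: famcat_def)
    next
      case 2
      then have "\<sigma> u = u + 1/4" using u by (auto simp: \<sigma>_def)
      with 2 u show ?thesis by (simp add: famcat_def field_simps)
    next
      case 3
      then have "\<sigma> u = u / 2 + 1/2" using u by (auto simp: \<sigma>_def)
      with 3 u show ?thesis by (simp add: famcat_def field_simps)
    qed
  qed (auto simp: \<sigma>_def)
qed

lemma famcat_const_right:
  assumes "path_family S X f"
  shows "fam_homotopic S X (famcat f (\<lambda>(u, s). f (1, s))) f"
proof (rule fam_homotopic_reparamI [OF assms, where \<sigma> = "\<lambda>u. min (2 * u) 1" and \<tau> = "\<lambda>u. u"])
  show "continuous_map unit_interval unit_interval (\<lambda>u. min (2 * u) 1)"
    by (rule continuous_map_to_interval) (auto intro!: continuous_intros)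
qed (auto simp: famcat_def min_def)

lemma famcat_const_left:
  assumes "path_family S X f"
  shows "fam_homotopic S X (famcat (\<lambda>(u, s). f (0, s)) f) f"
proof (rule fam_homotopic_reparamI [OF assms, where \<sigma> = "\<lambda>u. max (2 * u - 1) 0" and \<tau> = "\<lambda>u. u"])
  show "continuous_map unit_interval unit_interval (\<lambda>u. max (2 * u - 1) 0)"
    by (rule continuous_map_to_interval) (auto intro!: continuous_intros)
qed (auto simp: famcat_def max_def)

lemma famcat_rev_right:
  assumes "path_family S X f"
  shows "fam_homotopic S X (famcat f (famrev f)) (\<lambda>(u, s). f (0, s))"
\<comment> \<open>Going out and back follows f along a tent function, which vanishes at both ends
  like the constant 0.\<close>
proof (rule fam_homotopic_reparamI [OF assms, where \<sigma> = "\<lambda>u. min (2 * u) (2 - 2 * u)" and \<tau> = "\<lambda>u. 0"])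
  show "continuous_map unit_interval unit_interval (\<lambda>u. min (2 * u) (2 - 2 * u))"
    by (rule continuous_map_to_interval) (auto intro!: continuous_intros)
qed (auto simp: famcat_def famrev_def min_def)

lemma famrev_rev [simp]: "famrev (famrev f) = f"
  by (auto simp: famrev_def)

lemma famcat_rev_left:
  assumes "path_family S X f"
  shows "fam_homotopic S X (famcat (famrev f) f) (\<lambda>(u, s). f (1, s))"
  using famcat_rev_right [OF path_family_rev [OF assms]] by simp

section \<open>Correcting families of paths over the base point\<close>

text \<open>Apply the extension property to the mapping cylinder \<open>C\<close> of the base point
  and its two tautological maps: this gives a retraction of the cylinder on S onto \<open>C\<close>.
  Its coordinates are b in S and a in the interval, and a point of \<open>C\<close> has a = 0 or b =
  s0.\<close>

lemma well_pointed_retraction: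
  assumes wp: "well_pointed S s0" and cg: "compactly_generated S"
  obtains a b where "continuous_map (prod_topology unit_interval S) unit_interval a"
    "continuous_map (prod_topology unit_interval S) S b"
    "\<And>w s. \<lbrakk>0 \<le> w; w \<le> 1; s \<in> topspace S\<rbrakk> \<Longrightarrow> a (w, s) = 0 \<or> b (w, s) = s0"
    "\<And>s. s \<in> topspace S \<Longrightarrow> a (0, s) = 0 \<and> b (0, s) = s"
    "\<And>w. \<lbrakk>0 \<le> w; w \<le> 1\<rbrakk> \<Longrightarrow> a (w, s0) = w \<and> b (w, s0) = s0"
proof -
  have S: "k_space S" "Hausdorff_space S" and s0: "s0 \<in> topspace S"
    using assms by (auto simp: compactly_generated_def well_pointed_def)
  let ?P = "prod_topology S unit_interval"
  define C where "C = {x \<in> topspace ?P. snd x = 0} \<union> {x \<in> topspace ?P. fst x = s0}"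
  have "closedin ?P C"
    unfolding C_def
    by (intro closedin_Un closedin_eq_const [OF continuous_map_snd Hausdorff_unit_interval]
        closedin_eq_const [OF continuous_map_fst S(2)])
  moreover have "k_space ?P"
    using k_space_prod_topology_right S(1) locally_compact_unit_interval Hausdorff_unit_interval by blast
  moreover have "Hausdorff_space ?P"
    by (simp add: Hausdorff_space_prod_topology S(2) Hausdorff_unit_interval)
  ultimately have Z: "compactly_generated (subtopology ?P C)"
    by (simp add: compactly_generated_def k_space_closed_subtopology Hausdorff_space_subtopology)
  have f: "continuous_map S (subtopology ?P C) (\<lambda>s. (s, 0))"
    by (auto simp: continuous_map_in_subtopology C_def intro!: continuous_map_pairedI)
  have g: "continuous_map unit_interval (subtopology ?P C) (\<lambda>t. (s0, t))"
    using s0 by (auto simp: continuous_map_in_subtopology C_def intro!: continuous_map_pairedI)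
  have "compactly_generated (subtopology ?P C) \<and> continuous_map S (subtopology ?P C) (\<lambda>s. (s, 0)) \<and>
      continuous_map unit_interval (subtopology ?P C) (\<lambda>t. (s0, t)) \<and> (s0, 0) = (s0, 0)"
    using Z f g by blast
  from wp [unfolded well_pointed_def, THEN conjunct2, THEN spec, THEN spec, THEN spec, THEN mp, OF this]
  obtain h where h: "continuous_map (prod_topology unit_interval S) (subtopology ?P C) h"
      "\<forall>x\<in>topspace S. h (0, x) = (x, 0)" "\<forall>t\<in>{0..1}. h (t, s0) = (s0, t)"
    by blast
  have h': "continuous_map (prod_topology unit_interval S) ?P h" "h \<in> topspace (prod_topology unit_interval S) \<rightarrow> C"
    using h(1) by (auto simp: continuous_map_in_subtopology)
  show ?thesis
  proof
    show "continuous_map (prod_topology unit_interval S) unit_interval (\<lambda>x. snd (h x))"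
      by (rule continuous_map_comp [OF continuous_map_snd h'(1)])
    show "continuous_map (prod_topology unit_interval S) S (\<lambda>x. fst (h x))"
      by (rule continuous_map_comp [OF continuous_map_fst h'(1)])
    show "snd (h (w, s)) = 0 \<or> fst (h (w, s)) = s0" if "0 \<le> w" "w \<le> 1" "s \<in> topspace S" for w s
      using h'(2) that by (force simp: C_def Pi_iff)
  qed (use h in auto)
qed

text \<open>The null homotopy over s0 extends over S by the retraction, but the extension may move
  the end points of the other paths. Hence it is switched on only in the interior of each
  path.\<close>

lemma fam_pointed_correction:
  assumes wp: "well_pointed S s0" and cg: "compactly_generated S"
    and f: "path_family S Z f"
    and tr: "fam_homotopic (subtopology S {s0}) Z f (\<lambda>_. z0)"
  obtains f' where "fam_homotopic S Z f f'" "\<And>q. \<lbrakk>0 \<le> q; q \<le> 1\<rbrakk> \<Longrightarrow> f' (q, s0) = z0"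
proof -
  have S: "Hausdorff_space S" and s0: "s0 \<in> topspace S"
    using assms by (auto simp: compactly_generated_def well_pointed_def)
  obtain a b where a: "continuous_map (prod_topology unit_interval S) unit_interval a"
    and b: "continuous_map (prod_topology unit_interval S) S b"
    and ab: "\<And>w s. \<lbrakk>0 \<le> w; w \<le> 1; s \<in> topspace S\<rbrakk> \<Longrightarrow> a (w, s) = 0 \<or> b (w, s) = s0"
      "\<And>s. s \<in> topspace S \<Longrightarrow> a (0, s) = 0 \<and> b (0, s) = s"
      "\<And>w. \<lbrakk>0 \<le> w; w \<le> 1\<rbrakk> \<Longrightarrow> a (w, s0) = w \<and> b (w, s0) = s0"
    using well_pointed_retraction [OF wp cg] by metis
  from tr obtain V where
    V: "continuous_map (prod_topology unit_interval (prod_topology unit_interval (subtopology S {s0}))) Z V"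
    "\<And>u s. 0 \<le> u \<Longrightarrow> u \<le> 1 \<Longrightarrow> s \<in> topspace (subtopology S {s0}) \<Longrightarrow> V (0, (u, s)) = f (u, s)"
    "\<And>u s. 0 \<le> u \<Longrightarrow> u \<le> 1 \<Longrightarrow> s \<in> topspace (subtopology S {s0}) \<Longrightarrow> V (1, (u, s)) = z0"
    "\<And>v s. 0 \<le> v \<Longrightarrow> v \<le> 1 \<Longrightarrow> s \<in> topspace (subtopology S {s0}) \<Longrightarrow> V (v, (0, s)) = f (0, s)"
    "\<And>v s. 0 \<le> v \<Longrightarrow> v \<le> 1 \<Longrightarrow> s \<in> topspace (subtopology S {s0}) \<Longrightarrow> V (v, (1, s)) = f (1, s)"
    by (rule fam_homotopicE) blast
  have fends: "f (0, s0) = z0" "f (1, s0) = z0"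
    using V(3) [of 0 s0] V(3) [of 1 s0] V(4) [of 1 s0] V(5) [of 1 s0] s0 by auto
  \<comment> \<open>The homotopy extension: compose the retraction with f on \<open>a = 0\<close>
    and with V on \<open>b = s0\<close>; the two agree on the intersection because V starts at
    f.\<close>
  define M where "M w q s = (if b (w, s) = s0 then V (a (w, s), (q, s0)) else f (q, b (w, s)))" for w q s
  have M: "continuous_map Q Z (\<lambda>x. M (w x) (q x) (s x))"
    if w: "continuous_map Q unit_interval w" and q: "continuous_map Q unit_interval q"
      and s: "continuous_map Q S s" for w q :: "'c \<Rightarrow> real" and s and Q :: "'c topology"
    unfolding M_def
  proof (rule continuous_map_if_closed)
    have a': "continuous_map Q unit_interval (\<lambda>x. a (w x, s x))"
      by (rule continuous_map_comp_pair [OF a w s])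
    have b': "continuous_map Q S (\<lambda>x. b (w x, s x))"
      by (rule continuous_map_comp_pair [OF b w s])
    have ws: "0 \<le> w x" "w x \<le> 1" "s x \<in> topspace S" "0 \<le> q x" "q x \<le> 1" if "x \<in> topspace Q" for x
      using that w s q by (auto simp: continuous_map_def)
    show "closedin Q {x \<in> topspace Q. b (w x, s x) = s0}"
      by (rule closedin_eq_const [OF b' S])
    show "closedin Q {x \<in> topspace Q. a (w x, s x) = 0}"
      by (rule closedin_eq_const [OF a' Hausdorff_unit_interval])
    show "b (w x, s x) = s0 \<or> a (w x, s x) = 0" if "x \<in> topspace Q" for x
      using ab(1) ws that by blast
    have "continuous_map Q (subtopology S {s0}) (\<lambda>_. s0)"
      using s0 by (simp add: continuous_map_in_subtopology)
    then show "continuous_map Q Z (\<lambda>x. V (a (w x, s x), (q x, s0)))"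
      by (intro continuous_map_comp_pair [OF V(1) a'] continuous_map_pairedI q)
    show "continuous_map Q Z (\<lambda>x. f (q x, b (w x, s x)))"
      by (rule continuous_map_comp_pair [OF f [unfolded path_family_def] q b'])
    show "V (a (w x, s x), (q x, s0)) = f (q x, b (w x, s x))"
      if "x \<in> topspace Q" "b (w x, s x) = s0" "a (w x, s x) = 0" for x
      using that V(2) ws s0 by simp
  qed
  have M0: "M 0 q s = f (q, s)" if "0 \<le> q" "q \<le> 1" "s \<in> topspace S" for q s
    using that ab(2) V(2) s0 by (auto simp: M_def)
  have Ms0: "M w q s0 = V (w, (q, s0))" if "0 \<le> w" "w \<le> 1" for w q
    using ab(3) that by (simp add: M_def)
  \<comment> \<open>The deformation time W is 0 at the two ends and 1 on the middle third, while G
    runs through the whole path on the middle third and rests on the outer ones. So over s0 either V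
    is finished (W = 1) or an end point is seen (G is 0 or 1), and both give z0.\<close>
  define W where "W q = min 1 (3 * min q (1 - q))" for q :: real
  define G where "G q = clamp01 (3 * q - 1)" for q :: real
  define f' where "f' = (\<lambda>(q, s). M (W q) (G q) s)"
  let ?Q = "prod_topology unit_interval (prod_topology unit_interval S)"
  have u: "continuous_map ?Q euclideanreal (\<lambda>x. fst (snd x))" and v: "continuous_map ?Q euclideanreal fst"
    by (intro continuous_map_from_interval proj_cont)+
  \<comment> \<open>Interpolate from (0, q) to (W q, G q) in the first two arguments of M. For q = 0
    and q = 1 nothing moves.\<close>
  have "continuous_map ?Q Z (\<lambda>x. M (fst x * W (fst (snd x)))
      ((1 - fst x) * fst (snd x) + fst x * G (fst (snd x))) (snd (snd x)))"
  proof (rule M)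
    show "continuous_map ?Q unit_interval (\<lambda>x. fst x * W (fst (snd x)))"
      unfolding W_def
    proof (rule continuous_map_to_interval)
      show "continuous_map ?Q euclideanreal (\<lambda>x. fst x * min 1 (3 * min (fst (snd x)) (1 - fst (snd x))))"
        using u v by (intro continuous_intros) auto
    qed (auto simp: mult_le_one)
    show "continuous_map ?Q unit_interval (\<lambda>x. (1 - fst x) * fst (snd x) + fst x * G (fst (snd x)))"
    proof (rule continuous_map_to_interval)
      show "continuous_map ?Q euclideanreal (\<lambda>x. (1 - fst x) * fst (snd x) + fst x * G (fst (snd x)))"
        unfolding G_def using u v by (intro continuous_intros continuous_map_from_interval [OF continuous_map_clamp01]) auto
      show "0 \<le> (1 - fst x) * fst (snd x) + fst x * G (fst (snd x)) \<and>
          (1 - fst x) * fst (snd x) + fst x * G (fst (snd x)) \<le> 1" if "x \<in> topspace ?Q" for x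
        using that by (auto simp: G_def intro!: convex_bound_le)
    qed
  qed (rule proj_cont)
  then have "fam_homotopic S Z f f'"
    by (rule fam_homotopicI) (auto simp: f'_def M0 W_def G_def)
  moreover have "f' (q, s0) = z0" if q: "0 \<le> q" "q \<le> 1" for q
  proof -
    have "f' (q, s0) = V (W q, (G q, s0))"
      using q by (simp add: f'_def Ms0 W_def)
    moreover have "W q = 1 \<or> G q = 0 \<or> G q = 1"
      using q by (auto simp: W_def G_def clamp01_def min_def)
    moreover have "0 \<le> W q" "W q \<le> 1" "0 \<le> G q" "G q \<le> 1"
      using q by (auto simp: W_def G_def)
    ultimately show ?thesis
      using V(3-5) fends s0 by auto
  qed
  ultimately show ?thesis using that by blast
qed

section \<open>The pinch map of a suspension\<close>

lemma qclass_collapse_eq: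
  assumes "x \<in> topspace X" "y \<in> topspace X"
  shows "qclass X (collapse_rel A) x = qclass X (collapse_rel A) y \<longleftrightarrow> x = y \<or> (x \<in> A \<and> y \<in> A)"
proof
  assume "qclass X (collapse_rel A) x = qclass X (collapse_rel A) y"
  moreover have "y \<in> qclass X (collapse_rel A) y"
    using assms by (simp add: qclass_def collapse_rel_def)
  ultimately have "y \<in> qclass X (collapse_rel A) x" by simp
  then show "x = y \<or> (x \<in> A \<and> y \<in> A)"
    by (simp add: qclass_def collapse_rel_def)
qed (auto simp: qclass_def collapse_rel_def)

text \<open>A reparametrisation of the suspension coordinate that fixes 0 and 1 respects the
  collapsed set, and the product with the interval keeps the projection a quotient map, so the whole
  homotopy descends.\<close>

lemma suspension_squeeze:
  assumes k: "k_space Z" and z0: "z0 \<in> topspace Z"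
    and \<mu>: "continuous_map (prod_topology unit_interval unit_interval) unit_interval (\<lambda>(r, t). \<mu> r t)"
    and \<mu>01: "\<And>r. \<lbrakk>0 \<le> r; r \<le> 1\<rbrakk> \<Longrightarrow> \<mu> r 0 = 0" "\<And>r. \<lbrakk>0 \<le> r; r \<le> 1\<rbrakk> \<Longrightarrow> \<mu> r 1 = 1"
  obtains P where
    "continuous_map (prod_topology unit_interval (reduced_suspension Z z0)) (reduced_suspension Z z0) P"
    "\<And>r z t. \<lbrakk>0 \<le> r; r \<le> 1; z \<in> topspace Z; 0 \<le> t; t \<le> 1\<rbrakk>
        \<Longrightarrow> P (r, suspension_pt Z z0 z t) = suspension_pt Z z0 z (\<mu> r t)"
proof -
  let ?A = "topspace Z \<times> {0, 1} \<union> {z0} \<times> {0..1::real}"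
  have kp: "kprod Z unit_interval = prod_topology Z unit_interval"
    by (simp add: kprod_eq_prod k compact_unit_interval Hausdorff_unit_interval)
  let ?q = "\<lambda>x. suspension_pt Z z0 (fst x) (snd x)"
  have q: "quotient_map (prod_topology Z unit_interval) (reduced_suspension Z z0) ?q"
    using quotient_map_qclass [of "kprod Z unit_interval" "collapse_rel ?A"]
    unfolding reduced_suspension_def suspension_pt_def kp by simp
  have eq: "suspension_pt Z z0 z t = suspension_pt Z z0 z' t' \<longleftrightarrow>
      (z, t) = (z', t') \<or> ((z, t) \<in> ?A \<and> (z', t') \<in> ?A)"
    if "z \<in> topspace Z" "z' \<in> topspace Z" "0 \<le> t" "t \<le> 1" "0 \<le> t'" "t' \<le> 1" for z z' t t'
    unfolding suspension_pt_def using that by (subst qclass_collapse_eq) auto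
  have \<mu>': "0 \<le> \<mu> r t" "\<mu> r t \<le> 1" if "0 \<le> r" "r \<le> 1" "0 \<le> t" "t \<le> 1" for r t
    using Pi_mem [OF continuous_map_funspace [OF \<mu>], of "(r, t)"] that by auto
  let ?Q = "prod_topology unit_interval (prod_topology Z unit_interval)"
  have "continuous_map ?Q unit_interval (\<lambda>x. \<mu> (fst x) (snd (snd x)))"
    using continuous_map_comp_pair [OF \<mu>, of ?Q fst "\<lambda>x. snd (snd x)"]
    by (simp add: continuous_map_projections continuous_map_fst)
  then have "continuous_map ?Q (reduced_suspension Z z0) (\<lambda>x. ?q (fst (snd x), \<mu> (fst x) (snd (snd x))))"
    by (intro continuous_map_comp [OF quotient_imp_continuous_map [OF q]] continuous_map_pairedI proj_cont)
  then have c: "continuous_map ?Q (reduced_suspension Z z0)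
      (\<lambda>x. suspension_pt Z z0 (fst (snd x)) (\<mu> (fst x) (snd (snd x))))" by simp
  obtain P where P: "continuous_map (prod_topology unit_interval (reduced_suspension Z z0)) (reduced_suspension Z z0) P"
    "\<And>x. x \<in> topspace ?Q \<Longrightarrow> P (case x of (r, y) \<Rightarrow> (r, ?q y)) =
        suspension_pt Z z0 (fst (snd x)) (\<mu> (fst x) (snd (snd x)))"
  proof (rule quotient_map_lift_exists [OF quotient_map_interval_prod [OF q] c])
    fix x y assume "x \<in> topspace ?Q" "y \<in> topspace ?Q"
      "(case x of (r, y) \<Rightarrow> (r, ?q y)) = (case y of (r, y) \<Rightarrow> (r, ?q y))"
    then obtain r z t z' t' where xy: "x = (r, (z, t))" "y = (r, (z', t'))" "0 \<le> r" "r \<le> 1"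
        "z \<in> topspace Z" "z' \<in> topspace Z" "0 \<le> t" "t \<le> 1" "0 \<le> t'" "t' \<le> 1"
        "suspension_pt Z z0 z t = suspension_pt Z z0 z' t'"
      by (cases x; cases y) auto
    have "(z, t) = (z', t') \<or> ((z, t) \<in> ?A \<and> (z', t') \<in> ?A)"
      by (rule iffD1 [OF eq]) (fact xy)+
    then have "(z, \<mu> r t) = (z', \<mu> r t') \<or> ((z, \<mu> r t) \<in> ?A \<and> (z', \<mu> r t') \<in> ?A)"
      using xy \<mu>' \<mu>01 by auto
    then have "suspension_pt Z z0 z (\<mu> r t) = suspension_pt Z z0 z' (\<mu> r t')"
      by (rule iffD2 [OF eq, rotated -1]) (fact | rule \<mu>' xy)+
    then show "suspension_pt Z z0 (fst (snd x)) (\<mu> (fst x) (snd (snd x))) =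
        suspension_pt Z z0 (fst (snd y)) (\<mu> (fst y) (snd (snd y)))"
      by (simp add: xy)
  qed blast
  show ?thesis
  proof
    show "P (r, suspension_pt Z z0 z t) = suspension_pt Z z0 z (\<mu> r t)"
      if "0 \<le> r" "r \<le> 1" "z \<in> topspace Z" "0 \<le> t" "t \<le> 1" for r z t
      using P(2) [of "(r, (z, t))"] that by simp
  qed (rule P(1))
qed

text \<open>The end maps of D1 and D2 are the components of a pinch map from S to the wedge of two
  copies of S, each component being deformed from the identity with the base point fixed. This is
  the only form in which the suspension structure of S enters.\<close>

lemma suspension_pinch:
  fixes Z :: "'z topology"
  assumes S: "pointed_homotopy_equivalent S s0 (reduced_suspension Z z0) (suspension_pt Z z0 z0 0)"
    and k: "k_space Z" and z0: "z0 \<in> topspace Z" and s0: "s0 \<in> topspace S"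
  obtains D1 D2 where "path_family S S D1" "path_family S S D2"
    "\<And>s. s \<in> topspace S \<Longrightarrow> D1 (0, s) = s \<and> D2 (0, s) = s"
    "\<And>t. \<lbrakk>0 \<le> t; t \<le> 1\<rbrakk> \<Longrightarrow> D1 (t, s0) = s0 \<and> D2 (t, s0) = s0"
    "\<And>s. s \<in> topspace S \<Longrightarrow> D1 (1, s) = s0 \<or> D2 (1, s) = s0"
proof -
  let ?A = "topspace Z \<times> {0, 1} \<union> {z0} \<times> {0..1::real}"
  let ?\<sigma> = "suspension_pt Z z0 z0 0"
  let ?R = "reduced_suspension Z z0"
  obtain f g where f: "continuous_map S ?R f" "f s0 = ?\<sigma>" and g: "continuous_map ?R S g" "g ?\<sigma> = s0"
    and gf: "pointed_homotopic S s0 S s0 (g \<circ> f) id"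
    using S by (auto simp: pointed_homotopy_equivalent_def pointed_map_def)
  obtain h where h: "path_family S S h" "\<And>s. h (0, s) = g (f s)" "\<And>s. h (1, s) = s"
    "\<And>t. \<lbrakk>0 \<le> t; t \<le> 1\<rbrakk> \<Longrightarrow> h (t, s0) = s0"
    using gf unfolding pointed_homotopic_def homotopic_with_def path_family_def by auto
  have pt: "\<exists>z\<in>topspace Z. \<exists>t. 0 \<le> t \<and> t \<le> 1 \<and> x = suspension_pt Z z0 z t" if "x \<in> topspace ?R" for x
    using that unfolding reduced_suspension_def suspension_pt_def topspace_quotient_topology
    by fastforce
  have base: "suspension_pt Z z0 z t = ?\<sigma>" if "z \<in> topspace Z" "t = 0 \<or> t = 1" for z t
    unfolding suspension_pt_def using that z0 by (subst qclass_collapse_eq) auto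
  \<comment> \<open>For r = 0 both are the identity. For r = 1, \<mu>1 stretches the lower half and
    sends the upper half to 1, and \<mu>2 sends the lower half to 0 and stretches the upper one; the
    levels 0 and 1 are the base point of the suspension.\<close>
  define \<mu>1 \<mu>2 where "\<mu>1 r t = clamp01 ((1 + r) * t)" and "\<mu>2 r t = clamp01 ((1 + r) * t - r)" for r t :: real
  have \<mu>: "continuous_map (prod_topology unit_interval unit_interval) unit_interval (\<lambda>(r, t). \<mu>1 r t)"
     "continuous_map (prod_topology unit_interval unit_interval) unit_interval (\<lambda>(r, t). \<mu>2 r t)"
    unfolding \<mu>1_def \<mu>2_def case_prod_unfold by (intro continuous_intros)+
  obtain P1 where P1: "continuous_map (prod_topology unit_interval ?R) ?R P1"
    "\<And>r z t. \<lbrakk>0 \<le> r; r \<le> 1; z \<in> topspace Z; 0 \<le> t; t \<le> 1\<rbrakk>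
        \<Longrightarrow> P1 (r, suspension_pt Z z0 z t) = suspension_pt Z z0 z (\<mu>1 r t)"
    by (rule suspension_squeeze [OF k z0 \<mu>(1)]) (auto simp: \<mu>1_def)
  obtain P2 where P2: "continuous_map (prod_topology unit_interval ?R) ?R P2"
    "\<And>r z t. \<lbrakk>0 \<le> r; r \<le> 1; z \<in> topspace Z; 0 \<le> t; t \<le> 1\<rbrakk>
        \<Longrightarrow> P2 (r, suspension_pt Z z0 z t) = suspension_pt Z z0 z (\<mu>2 r t)"
    by (rule suspension_squeeze [OF k z0 \<mu>(2)]) (auto simp: \<mu>2_def)
  \<comment> \<open>S is a suspension only up to homotopy: move s to g (f s) along the reversed
    homotopy h first, then deform inside the suspension.\<close>
  define C where "C P = (\<lambda>(u, s). g (P (u, f s)))" for P :: "real \<times> ('z \<times> real) set \<Rightarrow> ('z \<times> real) set"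
  have C: "path_family S S (C P)" if "continuous_map (prod_topology unit_interval ?R) ?R P" for P
    unfolding path_family_def C_def case_prod_unfold
    by (intro continuous_map_comp [OF g(1)] continuous_map_comp_pair [OF that] continuous_map_comp [OF f(1)] proj_cont)
  have P0: "P1 (0, x) = x" "P2 (0, x) = x" "P1 (1, x) = ?\<sigma> \<or> P2 (1, x) = ?\<sigma>" if "x \<in> topspace ?R" for x
  proof -
    obtain z t where zt: "z \<in> topspace Z" "0 \<le> t" "t \<le> 1" "x = suspension_pt Z z0 z t"
      using pt [OF \<open>x \<in> topspace ?R\<close>] by blast
    show "P1 (0, x) = x" "P2 (0, x) = x"
      using zt by (simp_all add: P1 P2 \<mu>1_def \<mu>2_def)
    show "P1 (1, x) = ?\<sigma> \<or> P2 (1, x) = ?\<sigma>"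
    proof (cases "t \<le> 1/2")
      case True
      then have "\<mu>2 1 t = 0" by (simp add: \<mu>2_def)
      then show ?thesis using zt by (simp add: P2 base)
    next
      case False
      then have "\<mu>1 1 t = 1" by (simp add: \<mu>1_def)
      then show ?thesis using zt by (simp add: P1 base)
    qed
  qed
  have Ps: "P1 (r, ?\<sigma>) = ?\<sigma>" "P2 (r, ?\<sigma>) = ?\<sigma>" if "0 \<le> r" "r \<le> 1" for r
    using that z0 by (simp_all add: P1(2) P2(2) \<mu>1_def \<mu>2_def)
  have fim: "f s \<in> topspace ?R" if "s \<in> topspace S" for s
    using f(1) that by (auto simp: continuous_map_def)
  show ?thesis
  proof
    show "path_family S S (famcat (famrev h) (C P1))" "path_family S S (famcat (famrev h) (C P2))"
      by (intro path_family_cat path_family_rev h(1) C P1(1) P2(1); simp add: h(2) C_def P0(1,2) fim)+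
    show "famcat (famrev h) (C P1) (0, s) = s \<and> famcat (famrev h) (C P2) (0, s) = s" if "s \<in> topspace S" for s
      by (simp add: h)
    show "famcat (famrev h) (C P1) (t, s0) = s0 \<and> famcat (famrev h) (C P2) (t, s0) = s0"
      if "0 \<le> t" "t \<le> 1" for t
      by (simp add: famcat_def famrev_def C_def f(2) Ps g(2) h(4))
    show "famcat (famrev h) (C P1) (1, s) = s0 \<or> famcat (famrev h) (C P2) (1, s) = s0" if "s \<in> topspace S" for s
      using P0(3) [OF fim [OF that]] g(2) by (auto simp: C_def)
  qed
qed

section \<open>Fibred joins\<close>

lemma topspace_simplex_top [simp]: "topspace (simplex_top n) = standard_simplex n"
  by (simp add: simplex_top_def topspace_standard_simplex)

lemma compact_simplex_top: "compact_space (simplex_top n)"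
  unfolding simplex_top_def by (simp add: compact_space_subtopology compactin_standard_simplex)

lemma Hausdorff_simplex_top: "Hausdorff_space (simplex_top n)"
  unfolding simplex_top_def
  by (simp add: Hausdorff_space_subtopology Hausdorff_space_product_topology)

lemma continuous_map_into_simplex_top:
  assumes "\<And>i. continuous_map Q euclideanreal (\<lambda>x. t x i)"
    and "\<And>x. x \<in> topspace Q \<Longrightarrow> t x \<in> standard_simplex n"
  shows "continuous_map Q (simplex_top n) t"
  unfolding simplex_top_def continuous_map_in_subtopology
  using assms by (auto simp: continuous_map_componentwise_UNIV)

lemma continuous_map_simplex_coord: "continuous_map (simplex_top n) euclideanreal (\<lambda>t. t i)"
  unfolding simplex_top_def
  by (intro continuous_map_from_subtopology continuous_map_product_projection) auto

lemma topspace_fibred_product: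
  "topspace (fibred_product n E p) =
     {a \<in> {..n} \<rightarrow>\<^sub>E topspace E. \<forall>i\<le>n. \<forall>j\<le>n. p (a i) = p (a j)}"
  by (auto simp: fibred_product_def)

lemma fibred_product_fibre:
  assumes "a \<in> topspace (fibred_product n E p)" "i \<le> n" "j \<le> n"
  shows "p (a i) = p (a j)"
  using assms unfolding topspace_fibred_product by blast

lemma k_space_fibred_product [simp]: "k_space (fibred_product n E p)"
  by (simp add: fibred_product_def)

lemma Hausdorff_fibred_product: "Hausdorff_space E \<Longrightarrow> Hausdorff_space (fibred_product n E p)"
  unfolding fibred_product_def
  by (intro Hausdorff_space_kification Hausdorff_space_subtopology)
     (simp add: Hausdorff_space_product_topology)

lemma continuous_map_fibred_coord:
  "i \<le> n \<Longrightarrow> continuous_map (fibred_product n E p) E (\<lambda>a. a i)"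
  unfolding fibred_product_def
  by (intro continuous_map_from_kification continuous_map_from_subtopology
      continuous_map_product_projection) auto

lemma continuous_map_into_fibred_product:
  assumes "k_space Q" "\<And>i. i \<le> n \<Longrightarrow> continuous_map Q E (\<lambda>x. a x i)"
    and "\<And>x. x \<in> topspace Q \<Longrightarrow> a x \<in> extensional {..n}"
    and "\<And>x i. \<lbrakk>x \<in> topspace Q; i \<le> n\<rbrakk> \<Longrightarrow> p (a x i) = p (a x 0)"
  shows "continuous_map Q (fibred_product n E p) a"
  unfolding fibred_product_def continuous_map_into_kification [OF assms(1)] continuous_map_in_subtopology
proof (intro conjI funcsetI)
  show "continuous_map Q (product_topology (\<lambda>_. E) {..n}) a"
    unfolding continuous_map_componentwise using assms(2,3) by auto
  show "a x \<in> {a. \<forall>i\<le>n. \<forall>j\<le>n. p (a i) = p (a j)}" if "x \<in> topspace Q" for x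
  proof (intro CollectI allI impI)
    fix i j assume "i \<le> n" "j \<le> n"
    then show "p (a x i) = p (a x j)"
      using assms(4) [OF that, of i] assms(4) [OF that, of j] by simp
  qed
qed

text \<open>The simplex is compact Hausdorff, so the k-product with it is the ordinary
  product.\<close>

lemma kprod_fjoin_eq:
  "kprod (fibred_product n E p) (simplex_top n) = prod_topology (fibred_product n E p) (simplex_top n)"
  by (simp add: kprod_eq_prod compact_simplex_top Hausdorff_simplex_top)

abbreviation prejoin :: "nat \<Rightarrow> 'e topology \<Rightarrow> ('e \<Rightarrow> 'x) \<Rightarrow> ((nat \<Rightarrow> 'e) \<times> (nat \<Rightarrow> real)) topology" where
  "prejoin n E p \<equiv> prod_topology (fibred_product n E p) (simplex_top n)"

lemma k_space_prejoin: "k_space (prejoin n E p)"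
  using k_space_kprod kprod_fjoin_eq by metis

lemma quotient_map_fjoin_pt: "quotient_map (prejoin n E p) (fjoin n E p) (fjoin_pt n E p)"
  unfolding fjoin_def fjoin_pt_def kprod_fjoin_eq by (rule quotient_map_qclass)

lemma continuous_map_fjoin_pt: "continuous_map (prejoin n E p) (fjoin n E p) (fjoin_pt n E p)"
  by (rule quotient_imp_continuous_map [OF quotient_map_fjoin_pt])

lemma topspace_fjoin: "topspace (fjoin n E p) = fjoin_pt n E p ` topspace (prejoin n E p)"
  using quotient_imp_surjective_map [OF quotient_map_fjoin_pt] by metis

lemma fjoin_cases:
  assumes "c \<in> topspace (fjoin n E p)"
  obtains a t where "a \<in> topspace (fibred_product n E p)" "t \<in> standard_simplex n" "c = fjoin_pt n E p (a, t)"
  using assms unfolding topspace_fjoin by auto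

lemma fjoin_pt_mem:
  "a \<in> topspace (fibred_product n E p) \<Longrightarrow> t \<in> standard_simplex n
    \<Longrightarrow> fjoin_pt n E p (a, t) \<in> topspace (fjoin n E p)"
  unfolding topspace_fjoin by auto

text \<open>Related points have equal weights, so the coordinates compared are the same ones
  throughout and \<open>fjoin_rel\<close> is itself an equivalence relation.\<close>

lemma fjoin_pt_eq_iff:
  assumes "a \<in> topspace (fibred_product n E p)" "t \<in> standard_simplex n"
    and "b \<in> topspace (fibred_product n E p)" "s \<in> standard_simplex n"
  shows "fjoin_pt n E p (a, t) = fjoin_pt n E p (b, s) \<longleftrightarrow> t = s \<and> (\<forall>i. t i \<noteq> 0 \<longrightarrow> a i = b i)"
proof
  assume "fjoin_pt n E p (a, t) = fjoin_pt n E p (b, s)"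
  moreover have "(b, s) \<in> fjoin_pt n E p (b, s)"
    using assms by (simp add: fjoin_pt_def qclass_def fjoin_rel_def)
  ultimately have "(b, s) \<in> fjoin_pt n E p (a, t)" by simp
  then show "t = s \<and> (\<forall>i. t i \<noteq> 0 \<longrightarrow> a i = b i)"
    by (simp add: fjoin_pt_def qclass_def fjoin_rel_def)
next
  assume "t = s \<and> (\<forall>i. t i \<noteq> 0 \<longrightarrow> a i = b i)"
  then show "fjoin_pt n E p (a, t) = fjoin_pt n E p (b, s)"
    unfolding fjoin_pt_def qclass_def fjoin_rel_def by auto
qed

lemma rep_fjoin_pt:
  assumes "a \<in> topspace (fibred_product n E p)" "t \<in> standard_simplex n"
  obtains a' where "rep (fjoin_pt n E p (a, t)) = (a', t)" "a' \<in> topspace (fibred_product n E p)"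
    "\<And>i. t i \<noteq> 0 \<Longrightarrow> a' i = a i"
proof -
  have "(a, t) \<in> fjoin_pt n E p (a, t)"
    using assms by (simp add: fjoin_pt_def qclass_def fjoin_rel_def)
  then have "rep (fjoin_pt n E p (a, t)) \<in> fjoin_pt n E p (a, t)"
    unfolding rep_def by (rule someI)
  then show ?thesis
    using that by (cases "rep (fjoin_pt n E p (a, t))") (auto simp: fjoin_pt_def qclass_def fjoin_rel_def kprod_fjoin_eq)
qed

lemma standard_simplex_nonzero:
  assumes "t \<in> standard_simplex n"
  obtains i where "i \<le> n" "0 < t i"
proof -
  have "\<exists>i\<le>n. t i \<noteq> 0"
  proof (rule ccontr)
    assume "\<not> (\<exists>i\<le>n. t i \<noteq> 0)"
    then have "(\<Sum>i\<le>n. t i) = 0" by (intro sum.neutral) auto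
    then show False using assms by (simp add: standard_simplex_def)
  qed
  then show ?thesis using that assms by (force simp: standard_simplex_def less_le)
qed

lemma standard_simplex_nonneg: "t \<in> standard_simplex n \<Longrightarrow> 0 \<le> t i"
  by (simp add: standard_simplex_def)

lemma continuous_map_from_fjoin:
  assumes "continuous_map (prejoin n E p) Z (\<lambda>x. f (fjoin_pt n E p x))"
  shows "continuous_map (fjoin n E p) Z f"
  by (rule continuous_compose_quotient_map [OF quotient_map_fjoin_pt]) (use assms in \<open>simp add: o_def\<close>)

lemma continuous_map_from_interval_fjoin:
  assumes "continuous_map (prod_topology unit_interval (prejoin n E p)) Z (\<lambda>x. f (fst x, fjoin_pt n E p (snd x)))"
  shows "continuous_map (prod_topology unit_interval (fjoin n E p)) Z f"
  by (rule continuous_compose_quotient_map [OF quotient_map_interval_prod [OF quotient_map_fjoin_pt]])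
     (use assms in \<open>simp add: o_def case_prod_unfold\<close>)

lemma continuous_map_into_fjoin:
  assumes "k_space Q" "\<And>i. i \<le> n \<Longrightarrow> continuous_map Q E (\<lambda>x. a x i)"
    and "\<And>x. x \<in> topspace Q \<Longrightarrow> a x \<in> extensional {..n}"
    and "\<And>x i. \<lbrakk>x \<in> topspace Q; i \<le> n\<rbrakk> \<Longrightarrow> p (a x i) = p (a x 0)"
    and "\<And>i. continuous_map Q euclideanreal (\<lambda>x. t x i)"
    and "\<And>x. x \<in> topspace Q \<Longrightarrow> t x \<in> standard_simplex n"
  shows "continuous_map Q (fjoin n E p) (\<lambda>x. fjoin_pt n E p (a x, t x))"
  by (intro continuous_map_comp [OF continuous_map_fjoin_pt] continuous_map_pairedI
      continuous_map_into_fibred_product continuous_map_into_simplex_top assms)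

section \<open>Weights and coordinates on a fibred join\<close>

definition fjoin_weight :: "'e fjoin_point \<Rightarrow> nat \<Rightarrow> real" where
  "fjoin_weight c = snd (rep c)"

lemma fjoin_weight_pt [simp]:
  assumes "a \<in> topspace (fibred_product n E p)" "t \<in> standard_simplex n"
  shows "fjoin_weight (fjoin_pt n E p (a, t)) = t"
  by (rule rep_fjoin_pt [OF assms]) (simp add: fjoin_weight_def)

lemma fjoin_weight_simplex: "c \<in> topspace (fjoin n E p) \<Longrightarrow> fjoin_weight c \<in> standard_simplex n"
  by (erule fjoin_cases) simp

lemma continuous_map_fjoin_weight: "continuous_map (fjoin n E p) euclideanreal (\<lambda>c. fjoin_weight c i)"
proof (rule continuous_map_from_fjoin)
  have "continuous_map (prejoin n E p) euclideanreal (\<lambda>x. snd x i)"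
    by (rule continuous_map_comp [OF continuous_map_simplex_coord continuous_map_snd])
  then show "continuous_map (prejoin n E p) euclideanreal (\<lambda>x. fjoin_weight (fjoin_pt n E p x) i)"
    by (rule continuous_map_eq) auto
qed

text \<open>Independent of the representative only where the weight is nonzero. Elsewhere it is some
  point of the same fibre, which is enough as a filler.\<close>

definition fjoin_coord :: "'e fjoin_point \<Rightarrow> nat \<Rightarrow> 'e" where
  "fjoin_coord c = fst (rep c)"

lemma fjoin_coord_pt:
  assumes "a \<in> topspace (fibred_product n E p)" "t \<in> standard_simplex n" "t i \<noteq> 0"
  shows "fjoin_coord (fjoin_pt n E p (a, t)) i = a i"
  by (rule rep_fjoin_pt [OF assms(1,2)]) (simp add: fjoin_coord_def assms(3))

lemma fjoin_rep:
  assumes "c \<in> topspace (fjoin n E p)"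
  shows "fjoin_coord c \<in> topspace (fibred_product n E p)" "fjoin_weight c \<in> standard_simplex n"
    "fjoin_pt n E p (fjoin_coord c, fjoin_weight c) = c"
proof -
  obtain a t where at: "a \<in> topspace (fibred_product n E p)" "t \<in> standard_simplex n" "c = fjoin_pt n E p (a, t)"
    using assms by (rule fjoin_cases)
  obtain a' where a': "rep c = (a', t)" "a' \<in> topspace (fibred_product n E p)" "\<And>i. t i \<noteq> 0 \<Longrightarrow> a' i = a i"
    using rep_fjoin_pt [OF at(1,2)] at(3) by metis
  show "fjoin_coord c \<in> topspace (fibred_product n E p)" "fjoin_weight c \<in> standard_simplex n"
    "fjoin_pt n E p (fjoin_coord c, fjoin_weight c) = c"
    using a' at by (auto simp: fjoin_coord_def fjoin_weight_def fjoin_pt_eq_iff)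
qed

text \<open>The preimage of this open set is saturated, so the projection restricts to a quotient
  map over it, and there the coordinate of a class is that of any representative.\<close>

lemma continuous_map_fjoin_coord:
  assumes "i \<le> n"
  shows "continuous_map (subtopology (fjoin n E p) {c. 0 < fjoin_weight c i}) E (\<lambda>c. fjoin_coord c i)"
proof -
  let ?V = "{c \<in> topspace (fjoin n E p). 0 < fjoin_weight c i}"
  let ?U = "{x \<in> topspace (prejoin n E p). fjoin_pt n E p x \<in> ?V}"
  have "openin (fjoin n E p) {c \<in> topspace (fjoin n E p). fjoin_weight c i \<in> {0<..}}"
    by (rule openin_continuous_map_preimage [OF continuous_map_fjoin_weight]) auto
  then have V: "openin (fjoin n E p) ?V" by simp
  have eq: "subtopology (fjoin n E p) {c. 0 < fjoin_weight c i} = subtopology (fjoin n E p) ?V"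
    using subtopology_restrict [of "fjoin n E p" "{c. 0 < fjoin_weight c i}"] by (simp add: Int_def)
  have q: "quotient_map (subtopology (prejoin n E p) ?U) (subtopology (fjoin n E p) ?V) (fjoin_pt n E p)"
    using quotient_map_restriction [OF quotient_map_fjoin_pt refl] V by blast
  have "continuous_map (prejoin n E p) E (\<lambda>x. fst x i)"
    by (rule continuous_map_comp [OF continuous_map_fibred_coord [OF assms] continuous_map_fst])
  then have "continuous_map (subtopology (prejoin n E p) ?U) E (\<lambda>x. fst x i)"
    by (rule continuous_map_from_subtopology)
  then have "continuous_map (subtopology (prejoin n E p) ?U) E ((\<lambda>c. fjoin_coord c i) \<circ> fjoin_pt n E p)"
    by (rule continuous_map_eq) (auto simp: fjoin_coord_pt)
  then show ?thesis
    unfolding eq by (rule continuous_compose_quotient_map [OF q])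
qed

text \<open>Distinct points differ in a weight, or have equal weights and differ in a coordinate
  with positive weight; the latter is separated on the open set where that coordinate is continuous.
  Required for products of the quotient maps onto joins.\<close>

lemma Hausdorff_fjoin:
  assumes "Hausdorff_space E"
  shows "Hausdorff_space (fjoin n E p)"
  unfolding Hausdorff_space_def
proof (intro allI impI, elim conjE)
  let ?J = "fjoin n E p"
  fix c d assume c: "c \<in> topspace ?J" and d: "d \<in> topspace ?J" and "c \<noteq> d"
  show "\<exists>U V. openin ?J U \<and> openin ?J V \<and> c \<in> U \<and> d \<in> V \<and> disjnt U V"
  proof (cases "fjoin_weight c = fjoin_weight d")
    case False
    then obtain i where i: "fjoin_weight c i \<noteq> fjoin_weight d i" by auto
    then obtain U V where UV: "open U" "open V" "fjoin_weight c i \<in> U" "fjoin_weight d i \<in> V" "U \<inter> V = {}"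
      using hausdorff by metis
    then have "openin ?J {x \<in> topspace ?J. fjoin_weight x i \<in> U}" "openin ?J {x \<in> topspace ?J. fjoin_weight x i \<in> V}"
      by (auto intro!: openin_continuous_map_preimage [OF continuous_map_fjoin_weight])
    then show ?thesis
      using UV c d
      by (intro exI[of _ "{x \<in> topspace ?J. fjoin_weight x i \<in> U}"] exI[of _ "{x \<in> topspace ?J. fjoin_weight x i \<in> V}"])
         (auto simp: disjnt_iff)
  next
    case True
    obtain i where i: "fjoin_weight c i \<noteq> 0" "fjoin_coord c i \<noteq> fjoin_coord d i"
      using \<open>c \<noteq> d\<close> True fjoin_rep [OF c] fjoin_rep [OF d] fjoin_pt_eq_iff by metis
    then have pos: "0 < fjoin_weight c i"
      using standard_simplex_nonneg [OF fjoin_rep(2) [OF c], of i] by linarith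
    then have "i \<le> n" using fjoin_rep(2) [OF c] i(1) unfolding standard_simplex_def
      by (metis (mono_tags, lifting) mem_Collect_eq not_le)
    let ?V = "{c \<in> topspace ?J. 0 < fjoin_weight c i}"
    have "openin ?J {c \<in> topspace ?J. fjoin_weight c i \<in> {0<..}}"
      by (rule openin_continuous_map_preimage [OF continuous_map_fjoin_weight]) auto
    then have V: "openin ?J ?V" by simp
    have eq: "subtopology ?J {c. 0 < fjoin_weight c i} = subtopology ?J ?V"
      using subtopology_restrict [of "fjoin n E p" "{c. 0 < fjoin_weight c i}"] by (simp add: Int_def)
    have cc: "continuous_map (subtopology ?J ?V) E (\<lambda>c. fjoin_coord c i)"
      using continuous_map_fjoin_coord [OF \<open>i \<le> n\<close>, of E p] unfolding eq .
    have "fjoin_coord c i \<in> topspace E" "fjoin_coord d i \<in> topspace E"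
      using fjoin_rep(1) [OF c] fjoin_rep(1) [OF d] \<open>i \<le> n\<close> by (auto simp: topspace_fibred_product)
    then obtain A B where AB: "openin E A" "openin E B" "fjoin_coord c i \<in> A" "fjoin_coord d i \<in> B" "disjnt A B"
      using assms i(2) unfolding Hausdorff_space_def by metis
    have "openin ?J {x \<in> topspace (subtopology ?J ?V). fjoin_coord x i \<in> A}"
      "openin ?J {x \<in> topspace (subtopology ?J ?V). fjoin_coord x i \<in> B}"
      using openin_continuous_map_preimage [OF cc] AB V openin_trans_full by blast+
    then show ?thesis
      using AB c d pos True
      by (intro exI[of _ "{x \<in> topspace (subtopology ?J ?V). fjoin_coord x i \<in> A}"]
          exI[of _ "{x \<in> topspace (subtopology ?J ?V). fjoin_coord x i \<in> B}"]) (auto simp: disjnt_iff)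
  qed
qed

lemma fjoin_proj_pt:
  assumes "a \<in> topspace (fibred_product n E p)" "t \<in> standard_simplex n" "i \<le> n"
  shows "fjoin_proj p (fjoin_pt n E p (a, t)) = p (a i)"
proof -
  obtain a' where a': "rep (fjoin_pt n E p (a, t)) = (a', t)" "a' \<in> topspace (fibred_product n E p)"
      "\<And>i. t i \<noteq> 0 \<Longrightarrow> a' i = a i"
    using rep_fjoin_pt [OF assms(1,2)] by metis
  \<comment> \<open>The representative may have a different coordinate 0 or i; the comparison goes
    through a coordinate of positive weight, which all representatives share.\<close>
  obtain j where j: "j \<le> n" "0 < t j"
    using standard_simplex_nonzero [OF assms(2)] by blast
  have "fjoin_proj p (fjoin_pt n E p (a, t)) = p (a' 0)"
    by (simp add: fjoin_proj_def a'(1))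
  also have "p (a' 0) = p (a' j)"
    by (rule fibred_product_fibre [OF a'(2) _ j(1)]) simp
  also have "a' j = a j"
    using a'(3) j(2) by simp
  also have "p (a j) = p (a i)"
    by (rule fibred_product_fibre [OF assms(1) j(1) assms(3)])
  finally show ?thesis .
qed

lemma continuous_map_fjoin_proj:
  assumes "continuous_map E X p"
  shows "continuous_map (fjoin n E p) X (fjoin_proj p)"
proof (rule continuous_map_from_fjoin)
  have "continuous_map (prejoin n E p) X (\<lambda>x. p (fst x 0))"
    by (intro continuous_map_comp [OF assms] continuous_map_comp [OF continuous_map_fibred_coord continuous_map_fst]) auto
  then show "continuous_map (prejoin n E p) X (\<lambda>x. fjoin_proj p (fjoin_pt n E p x))"
    by (rule continuous_map_eq) (auto simp: fjoin_proj_pt [where i = 0])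
qed

lemma fjoin_proj_coord:
  assumes "c \<in> topspace (fjoin n E p)" "i \<le> n"
  shows "p (fjoin_coord c i) = fjoin_proj p c"
  using fjoin_proj_pt [OF fjoin_rep(1,2) [OF assms(1)] assms(2)] by (simp add: fjoin_rep(3) [OF assms(1)])

section \<open>Shuffles\<close>

definition cum :: "(nat \<Rightarrow> real) \<Rightarrow> nat \<Rightarrow> real" where
  "cum t i = (\<Sum>l<i. t l)"

text \<open>Cut [0,1] into consecutive intervals of lengths t and likewise for s: this is the length
  of the intersection of the i-th interval of t with the j-th of s.\<close>

definition overlap :: "(nat \<Rightarrow> real) \<Rightarrow> (nat \<Rightarrow> real) \<Rightarrow> nat \<Rightarrow> nat \<Rightarrow> real" where
  "overlap t s i j = max 0 (min (cum t (Suc i)) (cum s (Suc j)) - max (cum t i) (cum s j))"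

text \<open>The k-th vertex of an edge path lies on the antidiagonal i + j = k, so summing over it
  yields a barycentric coordinate without knowing the shuffle.\<close>

definition shuffle_weight :: "(nat \<Rightarrow> real) \<Rightarrow> (nat \<Rightarrow> real) \<Rightarrow> nat \<Rightarrow> real" where
  "shuffle_weight t s k = (\<Sum>i\<le>k. overlap t s i (k - i))"

lemma sum_chain_min_max:
  fixes r :: "nat \<Rightarrow> real"
  assumes "A \<subseteq> B \<or> B \<subseteq> A" "finite A" "finite B" "\<And>k. 0 \<le> r k"
  shows "min (sum r A) (sum r B) = sum r (A \<inter> B)" "max (sum r A) (sum r B) = sum r (A \<union> B)"
  using assms sum_mono2 [of A B r] sum_mono2 [of B A r]
  by (auto simp: Int_absorb1 Int_absorb2 Un_absorb1 Un_absorb2)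

text \<open>The partial sums of t and s are sums of r over initial segments of the path. Initial
  segments are nested, so min and max become intersection and union, and what remains is the part of
  the path at (i,j).\<close>

lemma overlap_lattice_path:
  fixes I J :: "nat \<Rightarrow> nat" and r :: "nat \<Rightarrow> real"
  assumes mono: "mono I" "mono J" and r: "\<And>k. 0 \<le> r k"
    and t: "\<And>i. t i = (\<Sum>k | k \<le> N \<and> I k = i. r k)" and s: "\<And>j. s j = (\<Sum>k | k \<le> N \<and> J k = j. r k)"
  shows "overlap t s i j = (\<Sum>k | k \<le> N \<and> I k = i \<and> J k = j. r k)"
proof -
  define A where "A i = {k. k \<le> N \<and> I k < i}" for i
  define B where "B j = {k. k \<le> N \<and> J k < j}" for j
  have cum: "cum w i = sum r {k. k \<le> N \<and> P k < i}" if "\<And>i. w i = (\<Sum>k | k \<le> N \<and> P k = i. r k)" for w P i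
  proof (induction i)
    case (Suc i)
    have "{k. k \<le> N \<and> P k < Suc i} = {k. k \<le> N \<and> P k < i} \<union> {k. k \<le> N \<and> P k = i}" by auto
    moreover have "sum r ({k. k \<le> N \<and> P k < i} \<union> {k. k \<le> N \<and> P k = i}) =
        sum r {k. k \<le> N \<and> P k < i} + sum r {k. k \<le> N \<and> P k = i}"
      by (rule sum.union_disjoint) auto
    ultimately show ?case using Suc that [of i] by (simp add: cum_def)
  qed (simp add: cum_def)
  have cA: "cum t i = sum r (A i)" for i unfolding A_def by (rule cum [OF t])
  have cB: "cum s j = sum r (B j)" for j unfolding B_def by (rule cum [OF s])
  have down: "A i \<subseteq> D \<or> D \<subseteq> A i" "B j \<subseteq> D \<or> D \<subseteq> B j"
    if "\<And>k l. k \<in> D \<Longrightarrow> l \<le> k \<Longrightarrow> l \<in> D" "D \<subseteq> {..N}" for D i j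
    using that mono unfolding A_def B_def mono_def by (auto, (meson le_less_trans nat_le_linear)+)
  have dB: "\<And>k l. k \<in> B j \<Longrightarrow> l \<le> k \<Longrightarrow> l \<in> B j" "B j \<subseteq> {..N}" for j
    using monoD [OF mono(2)] unfolding B_def by (auto, meson le_less_trans)
  have dA: "\<And>k l. k \<in> A j \<Longrightarrow> l \<le> k \<Longrightarrow> l \<in> A j" for j
    using monoD [OF mono(1)] unfolding A_def by (auto, meson le_less_trans)
  have fin: "finite (A i)" "finite (B j)" for i j by (auto simp: A_def B_def)
  let ?P = "A (Suc i) \<inter> B (Suc j)" and ?M = "A i \<union> B j" and ?D = "{k. k \<le> N \<and> I k = i \<and> J k = j}"
  have 1: "min (cum t (Suc i)) (cum s (Suc j)) = sum r ?P" "max (cum t i) (cum s j) = sum r ?M"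
    unfolding cA cB using sum_chain_min_max [OF down(1) [OF dB] fin r] by auto
  have D: "?D = ?P - ?M"
    by (auto simp: A_def B_def)
  \<comment> \<open>If the first inclusion holds, the path misses (i,j) and the maximum with 0 in
    \<open>overlap\<close> takes effect; otherwise the difference is the sum over
    \<open>?D\<close>.\<close>
  have "?P \<subseteq> ?M \<or> ?M \<subseteq> ?P"
  proof (rule disjCI)
    assume "\<not> ?M \<subseteq> ?P"
    then obtain k where k: "k \<in> ?M" "k \<notin> ?P" by blast
    show "?P \<subseteq> ?M"
    proof
      fix l assume l: "l \<in> ?P"
      have "l \<le> k"
        using k(2) l dA dB(1) by (metis IntD1 IntD2 IntI nat_le_linear)
      then show "l \<in> ?M" using k(1) dA dB(1) by blast
    qed
  qed
  then show ?thesis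
  proof
    assume PM: "?P \<subseteq> ?M"
    then have "sum r ?P \<le> sum r ?M" by (intro sum_mono2) (auto simp: fin r)
    moreover have De: "?D = {}" using PM D by blast
    ultimately show ?thesis unfolding overlap_def 1 De by simp
  next
    assume MP: "?M \<subseteq> ?P"
    then have "sum r ?P - sum r ?M = sum r ?D"
      unfolding D by (subst sum_diff) (auto simp: fin)
    then show ?thesis unfolding overlap_def 1 by (simp add: r sum_nonneg)
  qed
qed

text \<open>As I k + J k = k, the path meets each antidiagonal in at most one point, so at most one
  term of \<open>shuffle_weight\<close> is nonzero.\<close>

lemma shuffle_weight_lattice_path:
  fixes I J :: "nat \<Rightarrow> nat" and r :: "nat \<Rightarrow> real"
  assumes IJ: "\<And>k. I k + J k = k" and mono: "mono I" "mono J" and r: "\<And>k. 0 \<le> r k"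
    and t: "\<And>i. t i = (\<Sum>k | k \<le> N \<and> I k = i. r k)" and s: "\<And>j. s j = (\<Sum>k | k \<le> N \<and> J k = j. r k)"
  shows "overlap t s i j \<noteq> 0 \<Longrightarrow> i + j \<le> N \<and> I (i + j) = i \<and> J (i + j) = j"
    and "k \<le> N \<Longrightarrow> overlap t s (I k) (J k) = r k"
    and "shuffle_weight t s k = (if k \<le> N then r k else 0)"
proof -
  note ov = overlap_lattice_path [OF mono r t s]
  have IJ': "I k = i \<and> J k = j \<longleftrightarrow> k = i + j \<and> I (i + j) = i" for k i j
    using IJ [of k] IJ [of "i + j"] by auto
  show ov0: "overlap t s i j \<noteq> 0 \<Longrightarrow> i + j \<le> N \<and> I (i + j) = i \<and> J (i + j) = j" for i j
  proof -
    assume "overlap t s i j \<noteq> 0"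
    then have "{k. k \<le> N \<and> I k = i \<and> J k = j} \<noteq> {}"
      unfolding ov by (metis (no_types, lifting) sum.empty)
    then obtain k where "k \<le> N" "I k = i" "J k = j" by blast
    then show ?thesis using IJ [of k] by auto
  qed
  show ov1: "k \<le> N \<Longrightarrow> overlap t s (I k) (J k) = r k" for k
  proof -
    assume "k \<le> N"
    then have "{l. l \<le> N \<and> I l = I k \<and> J l = J k} = {k}"
      using IJ by (auto) (metis)
    then show ?thesis unfolding ov by simp
  qed
  show "shuffle_weight t s k = (if k \<le> N then r k else 0)"
  proof (cases "k \<le> N")
    case True
    have "shuffle_weight t s k = (\<Sum>i\<in>{I k}. overlap t s i (k - i))"
      unfolding shuffle_weight_def
    proof (rule sum.mono_neutral_right)
      show "{I k} \<subseteq> {..k}" using IJ [of k] by auto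
      show "\<forall>i\<in>{..k} - {I k}. overlap t s i (k - i) = 0"
        using ov0 by fastforce
    qed auto
    also have "k - I k = J k" using IJ [of k] by simp
    then have "(\<Sum>i\<in>{I k}. overlap t s i (k - i)) = r k" using ov1 True by simp
    finally show ?thesis using True by simp
  next
    case False
    then have "overlap t s i (k - i) = 0" if "i \<le> k" for i
      using ov0 [of i "k - i"] that by fastforce
    then show ?thesis using False by (simp add: shuffle_weight_def)
  qed
qed

section \<open>Shuffles as lattice paths and the covering by their simplices\<close>

text \<open>The last two parts transport the counts along \<theta>, so that a path is described by
  the positions of its horizontal (vertical) edges instead of the inverse permutation.\<close>

lemma shuffles_perm_path:
  assumes "\<theta> \<in> shuffles_perm n m"
  shows "path_i n \<theta> k + path_j n \<theta> k = k" "mono (path_i n \<theta>)" "mono (path_j n \<theta>)"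
    "k \<le> n + m \<Longrightarrow> path_i n \<theta> k = card {a \<in> {1..n}. \<theta> a \<le> k}"
    "k \<le> n + m \<Longrightarrow> path_j n \<theta> k = card {a \<in> {1..m}. \<theta> (n + a) \<le> k}"
proof -
  have p: "\<theta> permutes {1..n + m}" using assms by (simp add: shuffles_perm_def)
  have "path_i n \<theta> k + path_j n \<theta> k = card ({l \<in> {1..k}. inv_into UNIV \<theta> l \<le> n} \<union> {l \<in> {1..k}. \<not> inv_into UNIV \<theta> l \<le> n})"
    unfolding path_i_def path_j_def by (rule card_Un_disjoint [symmetric]) auto
  also have "{l \<in> {1..k}. inv_into UNIV \<theta> l \<le> n} \<union> {l \<in> {1..k}. \<not> inv_into UNIV \<theta> l \<le> n} = {1..k}" by auto
  finally show "path_i n \<theta> k + path_j n \<theta> k = k" by simp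
  show "mono (path_i n \<theta>)" "mono (path_j n \<theta>)"
    unfolding mono_def path_i_def path_j_def by (auto intro!: card_mono)
  have inv: "inv_into UNIV \<theta> (\<theta> a) = a" "\<theta> (inv_into UNIV \<theta> a) = a" for a
    using p permutes_inverses by metis+
  have mem: "1 \<le> a \<and> a \<le> n + m \<longleftrightarrow> 1 \<le> \<theta> a \<and> \<theta> a \<le> n + m" for a
    using permutes_in_image [OF p, of a] by auto
  assume k: "k \<le> n + m"
  have "bij_betw \<theta> {a \<in> {1..n}. \<theta> a \<le> k} {l \<in> {1..k}. inv_into UNIV \<theta> l \<le> n}"
  proof (rule bij_betw_byWitness [where f' = "inv_into UNIV \<theta>"])
    show "\<theta> ` {a \<in> {1..n}. \<theta> a \<le> k} \<subseteq> {l \<in> {1..k}. inv_into UNIV \<theta> l \<le> n}"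
    proof clarify
      fix a assume "a \<in> {1..n}" "\<theta> a \<le> k"
      then show "\<theta> a \<in> {1..k} \<and> inv_into UNIV \<theta> (\<theta> a) \<le> n" using mem [of a] by (simp add: inv(1))
    qed
    show "inv_into UNIV \<theta> ` {l \<in> {1..k}. inv_into UNIV \<theta> l \<le> n} \<subseteq> {a \<in> {1..n}. \<theta> a \<le> k}"
    proof clarify
      fix l assume "l \<in> {1..k}" "inv_into UNIV \<theta> l \<le> n"
      then show "inv_into UNIV \<theta> l \<in> {1..n} \<and> \<theta> (inv_into UNIV \<theta> l) \<le> k"
        using mem [of "inv_into UNIV \<theta> l"] k by (simp add: inv(2))
    qed
  qed (simp_all add: inv)
  from bij_betw_same_card [OF this] show "path_i n \<theta> k = card {a \<in> {1..n}. \<theta> a \<le> k}"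
    unfolding path_i_def by (rule sym)
  have "bij_betw (\<lambda>a. \<theta> (n + a)) {a \<in> {1..m}. \<theta> (n + a) \<le> k} {l \<in> {1..k}. \<not> inv_into UNIV \<theta> l \<le> n}"
  proof (rule bij_betw_byWitness [where f' = "\<lambda>l. inv_into UNIV \<theta> l - n"])
    show "(\<lambda>l. inv_into UNIV \<theta> l - n) ` {l \<in> {1..k}. \<not> inv_into UNIV \<theta> l \<le> n} \<subseteq> {a \<in> {1..m}. \<theta> (n + a) \<le> k}"
    proof clarify
      fix l assume l: "l \<in> {1..k}" "\<not> inv_into UNIV \<theta> l \<le> n"
      then have "1 \<le> inv_into UNIV \<theta> l \<and> inv_into UNIV \<theta> l \<le> n + m"
        using mem [of "inv_into UNIV \<theta> l"] k by (simp add: inv(2))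
      then show "inv_into UNIV \<theta> l - n \<in> {1..m} \<and> \<theta> (n + (inv_into UNIV \<theta> l - n)) \<le> k"
        using l by (simp add: inv(2)) linarith
    qed
    show "(\<lambda>a. \<theta> (n + a)) ` {a \<in> {1..m}. \<theta> (n + a) \<le> k} \<subseteq> {l \<in> {1..k}. \<not> inv_into UNIV \<theta> l \<le> n}"
    proof clarify
      fix a assume "a \<in> {1..m}" "\<theta> (n + a) \<le> k"
      then show "\<theta> (n + a) \<in> {1..k} \<and> \<not> inv_into UNIV \<theta> (\<theta> (n + a)) \<le> n"
        using mem [of "n + a"] by (simp add: inv(1))
    qed
  qed (auto simp: inv)
  from bij_betw_same_card [OF this] show "path_j n \<theta> k = card {a \<in> {1..m}. \<theta> (n + a) \<le> k}"
    unfolding path_j_def by (rule sym)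
qed

lemma shuffles_perm_path_le:
  assumes "\<theta> \<in> shuffles_perm n m" "k \<le> n + m"
  shows "path_i n \<theta> k \<le> n" "path_j n \<theta> k \<le> m"
proof -
  have "card {a \<in> {1..n}. \<theta> a \<le> k} \<le> card {1..n}" "card {a \<in> {1..m}. \<theta> (n + a) \<le> k} \<le> card {1..m}"
    by (rule card_mono; auto)+
  then show "path_i n \<theta> k \<le> n" "path_j n \<theta> k \<le> m"
    using shuffles_perm_path(4,5) [OF assms] by simp_all
qed

lemma finite_shuffles_perm: "finite (shuffles_perm n m)"
  by (rule finite_subset [OF _ finite_permutations [of "{1..n + m}"]]) (auto simp: shuffles_perm_def)

text \<open>A point of the simplex has t and s as the marginals of its barycentric coordinates, so
  the lattice path formula recovers these from (t,s) alone. Hence the parametrisation is injective,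
  and different shuffles containing (t,s) give the same weights.\<close>

lemma shuffle_simplexE:
  assumes \<theta>: "\<theta> \<in> shuffles_perm n m" and ts: "(t, s) \<in> shuffle_simplex n m \<theta>"
  shows "psi_simplex n m \<theta> (t, s) = shuffle_weight t s"
    and "shuffle_weight t s \<in> standard_simplex (n + m)"
    and "\<And>i j. overlap t s i j \<noteq> 0 \<Longrightarrow> i + j \<le> n + m \<and> path_i n \<theta> (i + j) = i \<and> path_j n \<theta> (i + j) = j"
    and "\<And>k. k \<le> n + m \<Longrightarrow> overlap t s (path_i n \<theta> k) (path_j n \<theta> k) = shuffle_weight t s k"
proof -
  note \<theta>' = shuffles_perm_path(1,2,3) [OF \<theta>]
  have *: "shuffle_weight t s = r" if r: "r \<in> standard_simplex (n + m)" "shuffle_param n m \<theta> r = (t, s)" for r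
  proof
    fix k
    have "shuffle_weight t s k = (if k \<le> n + m then r k else 0)"
      by (rule shuffle_weight_lattice_path(3) [OF \<theta>'])
         (use r in \<open>auto simp: shuffle_param_def standard_simplex_def\<close>)
    then show "shuffle_weight t s k = r k"
      using r(1) by (auto simp: standard_simplex_def)
  qed
  have psi: "psi_simplex n m \<theta> (t, s) \<in> standard_simplex (n + m)"
    "shuffle_param n m \<theta> (psi_simplex n m \<theta> (t, s)) = (t, s)"
    unfolding psi_simplex_def using ts [unfolded shuffle_simplex_def]
    by (rule inv_into_into, rule f_inv_into_f)
  show eq: "psi_simplex n m \<theta> (t, s) = shuffle_weight t s"
    using * [OF psi] by simp
  then show r: "shuffle_weight t s \<in> standard_simplex (n + m)"
    using psi by simp
  have ps: "shuffle_param n m \<theta> (shuffle_weight t s) = (t, s)" using psi eq by simp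
  have nn: "\<And>k. 0 \<le> shuffle_weight t s k" using r by (simp add: standard_simplex_def)
  have t: "t i = (\<Sum>k | k \<le> n + m \<and> path_i n \<theta> k = i. shuffle_weight t s k)"
    and s: "s i = (\<Sum>k | k \<le> n + m \<and> path_j n \<theta> k = i. shuffle_weight t s k)" for i
    using ps by (auto simp: shuffle_param_def dest!: fun_cong [where x = i])
  show "\<And>i j. overlap t s i j \<noteq> 0 \<Longrightarrow> i + j \<le> n + m \<and> path_i n \<theta> (i + j) = i \<and> path_j n \<theta> (i + j) = j"
    by (rule shuffle_weight_lattice_path(1) [OF \<theta>' nn t s])
  show "\<And>k. k \<le> n + m \<Longrightarrow> overlap t s (path_i n \<theta> k) (path_j n \<theta> k) = shuffle_weight t s k"
    by (rule shuffle_weight_lattice_path(2) [OF \<theta>' nn t s])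
qed

text \<open>The indices k with exactly i of the values q a at most k form the block from q i up to q
  (i + 1) - 1, and the gaps over a block telescope to the difference of two partial sums of
  t.\<close>

lemma sum_gaps:
  fixes u :: "nat \<Rightarrow> real"
  assumes t: "t \<in> standard_simplex n" and q: "strict_mono_on {1..n} q" "q ` {1..n} \<subseteq> {1..N}"
    and u: "u 0 = 0" "u (Suc N) = 1" "\<And>a. a \<in> {1..n} \<Longrightarrow> u (q a) = cum t a"
  shows "(\<Sum>k | k \<le> N \<and> card {a \<in> {1..n}. q a \<le> k} = i. u (Suc k) - u k) = t i"
proof -
  \<comment> \<open>The positions q completed by the two ends 0 and N + 1 of the interval.\<close>
  define pos where "pos i = (if i = 0 then 0 else if i \<le> n then q i else Suc N)" for i
  define c where "c k = card {a \<in> {1..n}. q a \<le> k}" for k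
  have q_less: "q a < q b" if "1 \<le> a" "a < b" "b \<le> n" for a b
    using q(1) that by (auto simp: strict_mono_on_def)
  have q_le: "q a \<le> q b" if "1 \<le> a" "a \<le> b" "b \<le> n" for a b
    using q_less [of a b] that by (cases "a = b") auto
  have q_mem: "1 \<le> q a" "q a \<le> N" if "1 \<le> a" "a \<le> n" for a
    using q(2) that by (auto simp: image_subset_iff)
  have upos: "u (pos i) = cum t i" if "i \<le> Suc n" for i
  proof -
    have "cum t (Suc n) = 1"
      using t by (simp add: cum_def standard_simplex_def lessThan_Suc_atMost)
    then show ?thesis
      using that u by (cases "i = Suc n") (auto simp: pos_def cum_def)
  qed
  have cI: "c k = i" if "i \<le> n" "pos i \<le> k" "k < pos (Suc i)" for i k
  proof -
    have "{a \<in> {1..n}. q a \<le> k} = {1..i}"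
    proof (intro equalityI subsetI)
      fix a assume a: "a \<in> {a \<in> {1..n}. q a \<le> k}"
      show "a \<in> {1..i}"
      proof (rule ccontr)
        assume "a \<notin> {1..i}"
        then have "Suc i \<le> a" using a by auto
        then have "q (Suc i) \<le> q a" "Suc i \<le> n" using a q_le [of "Suc i" a] by auto
        then show False using a that by (auto simp: pos_def)
      qed
    next
      fix a assume a: "a \<in> {1..i}"
      then have "q a \<le> q i" "1 \<le> i" using q_le that by auto
      then show "a \<in> {a \<in> {1..n}. q a \<le> k}" using a that by (auto simp: pos_def)
    qed
    then show ?thesis by (simp add: c_def)
  qed
  have cD: "\<exists>i\<le>n. pos i \<le> k \<and> k < pos (Suc i)" if "k \<le> N" for k
  proof -
    define i where "i = (GREATEST i. i \<le> n \<and> pos i \<le> k)"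
    have "0 \<le> n \<and> pos 0 \<le> k" by (simp add: pos_def)
    then have i: "i \<le> n \<and> pos i \<le> k"
      unfolding i_def by (rule GreatestI_nat [where b = n]) auto
    have "k < pos (Suc i)"
    proof (rule ccontr)
      assume *: "\<not> k < pos (Suc i)"
      then have "Suc i \<le> n" using that i by (auto simp: pos_def split: if_splits)
      then have "Suc i \<le> i"
        using * unfolding i_def by (intro Greatest_le_nat [where b = n]) (auto simp: i_def)
      then show False by simp
    qed
    then show ?thesis using i by blast
  qed
  show ?thesis
  proof (cases "i \<le> n")
    case True
    have le: "pos i \<le> pos (Suc i)"
      using True q_le [of i "Suc i"] q_mem [of i] by (auto simp: pos_def)
    have "pos (Suc i) \<le> Suc N"
      using q_mem [of "Suc i"] by (auto simp: pos_def)
    then have "{k. k \<le> N \<and> c k = i} = {pos i..<pos (Suc i)}"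
    proof (intro equalityI subsetI)
      fix k assume "k \<in> {k. k \<le> N \<and> c k = i}"
      then have k: "k \<le> N" "c k = i" by auto
      then obtain i' where "i' \<le> n" "pos i' \<le> k" "k < pos (Suc i')" using cD by blast
      moreover from this have "i' = i" using cI k(2) by simp
      ultimately show "k \<in> {pos i..<pos (Suc i)}" by simp
    next
      fix k assume "k \<in> {pos i..<pos (Suc i)}"
      then show "k \<in> {k. k \<le> N \<and> c k = i}"
        using cI [OF True] \<open>pos (Suc i) \<le> Suc N\<close> by simp
    qed
    then have "(\<Sum>k | k \<le> N \<and> c k = i. u (Suc k) - u k) = (\<Sum>k = pos i..<pos (Suc i). u (Suc k) - u k)"
      by simp
    also have "\<dots> = u (pos (Suc i)) - u (pos i)"
      by (rule sum_Suc_diff' [OF le])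
    also have "\<dots> = t i"
      using True by (simp add: upos cum_def)
    finally show ?thesis by (simp add: c_def)
  next
    case False
    have "c k \<le> card {1..n}" for k unfolding c_def by (rule card_mono) auto
    then have "{k. k \<le> N \<and> c k = i} = {}" using False by auto
    then have "(\<Sum>k | k \<le> N \<and> c k = i. u (Suc k) - u k) = 0" by (simp only: sum.empty)
    moreover have "t i = 0" using t False by (simp add: standard_simplex_def)
    ultimately show ?thesis by (simp add: c_def)
  qed
qed

text \<open>The shuffle containing \<open>(t, s)\<close> sorts the interior break points of the two subdivisions of
  \<open>[0, 1]\<close> with interval lengths \<open>t\<close> and \<open>s\<close>.\<close>

lemma shuffle_simplices_cover:
  assumes t: "t \<in> standard_simplex n" and s: "s \<in> standard_simplex m"
  obtains \<theta> where "\<theta> \<in> shuffles_perm n m" "(t, s) \<in> shuffle_simplex n m \<theta>"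
proof -
  define N where "N = n + m"
  \<comment> \<open>The n interior break points of t, followed by the m of s.\<close>
  define v where "v l = (if l \<le> n then cum t l else cum s (l - n))" for l
  \<comment> \<open>Ties are broken by the index. This makes the order total, so ranks are distinct,
    and it keeps each of the two blocks increasing even where some weights vanish.\<close>
  define le where "le l l' \<longleftrightarrow> v l < v l' \<or> (v l = v l' \<and> l \<le> l')" for l l'
  define rank where "rank l = card {l' \<in> {1..N}. le l' l}" for l
  define \<theta> where "\<theta> l = (if l \<in> {1..N} then rank l else l)" for l
  have le_trans: "le a b \<Longrightarrow> le b c \<Longrightarrow> le a c" and le_antisym: "le a b \<Longrightarrow> le b a \<Longrightarrow> a = b"
    and le_lin: "le a b \<or> le b a" and le_refl: "le a a" for a b c
    unfolding le_def by auto
  have rank_less: "rank a < rank b" if "le a b" "a \<noteq> b" "b \<in> {1..N}" for a b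
    unfolding rank_def
  proof (rule psubset_card_mono)
    have "b \<notin> {l' \<in> {1..N}. le l' a}" using that le_antisym by auto
    moreover have "b \<in> {l' \<in> {1..N}. le l' b}" using that le_refl by auto
    moreover have "{l' \<in> {1..N}. le l' a} \<subseteq> {l' \<in> {1..N}. le l' b}" using that le_trans by auto
    ultimately show "{l' \<in> {1..N}. le l' a} \<subset> {l' \<in> {1..N}. le l' b}" by blast
  qed auto
  have \<theta>_less: "\<theta> a < \<theta> b" if "le a b" "a \<noteq> b" "a \<in> {1..N}" "b \<in> {1..N}" for a b
    using rank_less that by (simp add: \<theta>_def)
  have \<theta>_le: "le a b" if "\<theta> a \<le> \<theta> b" "a \<in> {1..N}" "b \<in> {1..N}" for a b
    using \<theta>_less [of b a] that le_lin le_refl by (metis not_less)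
  have inj: "inj_on \<theta> {1..N}"
    using \<theta>_less le_lin unfolding inj_on_def by (metis less_irrefl)
  have into: "\<theta> ` {1..N} \<subseteq> {1..N}"
  proof clarify
    fix l assume l: "l \<in> {1..N}"
    have "{l' \<in> {1..N}. le l' l} \<noteq> {}" using l le_refl by auto
    then have "0 < card {l' \<in> {1..N}. le l' l}" by (simp add: card_gt_0_iff)
    moreover have "card {l' \<in> {1..N}. le l' l} \<le> card {1..N}" by (rule card_mono) auto
    ultimately show "\<theta> l \<in> {1..N}" using l by (simp add: \<theta>_def rank_def)
  qed
  have surj: "\<theta> ` {1..N} = {1..N}"
    by (rule endo_inj_surj [OF _ into inj]) simp
  have perm: "\<theta> permutes {1..N}"
    by (rule bij_imp_permutes) (use inj surj in \<open>auto simp: bij_betw_def \<theta>_def\<close>)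
  have cum_mono: "cum w a \<le> cum w b" if "a \<le> b" "\<And>i. 0 \<le> w i" for w :: "nat \<Rightarrow> real" and a b
    unfolding cum_def using that by (intro sum_mono2) auto
  have tn: "\<And>i. 0 \<le> t i" and sn: "\<And>i. 0 \<le> s i" using t s by (auto simp: standard_simplex_def)
  have mono1: "strict_mono_on {1..n} \<theta>"
  proof (rule strict_mono_onI)
    fix a b assume "a \<in> {1..n}" "b \<in> {1..n}" "a < b"
    moreover from this have "cum t a \<le> cum t b" using cum_mono tn by simp
    ultimately have "le a b" by (auto simp: le_def v_def)
    moreover note \<open>a \<in> {1..n}\<close> \<open>b \<in> {1..n}\<close> \<open>a < b\<close>
    ultimately show "\<theta> a < \<theta> b" using \<theta>_less by (simp add: N_def)
  qed
  have mono2: "strict_mono_on {n + 1..n + m} \<theta>"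
  proof (rule strict_mono_onI)
    fix a b assume "a \<in> {n + 1..n + m}" "b \<in> {n + 1..n + m}" "a < b"
    moreover from this have "cum s (a - n) \<le> cum s (b - n)" using cum_mono sn by simp
    ultimately have "le a b" by (auto simp: le_def v_def)
    moreover note \<open>a \<in> {n + 1..n + m}\<close> \<open>b \<in> {n + 1..n + m}\<close> \<open>a < b\<close>
    ultimately show "\<theta> a < \<theta> b" using \<theta>_less by (simp add: N_def)
  qed
  have \<theta>: "\<theta> \<in> shuffles_perm n m"
    using perm mono1 mono2 by (simp add: shuffles_perm_def N_def)
  \<comment> \<open>The sorted break points with 0 and 1 added; the gaps r between neighbours are
    the barycentric coordinates.\<close>
  define u where "u k = (if k = 0 then 0 else if k \<le> N then v (inv_into UNIV \<theta> k) else 1)" for k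
  have inv\<theta>: "inv_into UNIV \<theta> (\<theta> a) = a" "\<theta> (inv_into UNIV \<theta> a) = a" for a
    using perm permutes_inverses by metis+
  have u\<theta>: "u (\<theta> a) = v a" if "a \<in> {1..N}" for a
  proof -
    have "\<theta> a \<in> {1..N}" using into that by blast
    then show ?thesis by (auto simp: u_def inv\<theta>)
  qed
  have cum_le_1: "cum w a \<le> 1" "0 \<le> cum w a" if "w \<in> standard_simplex p" "a \<le> Suc p" for w p a
  proof -
    have "cum w (Suc p) = 1" using that by (simp add: cum_def standard_simplex_def lessThan_Suc_atMost)
    then show "cum w a \<le> 1" using cum_mono [of a "Suc p" w] that by (auto simp: standard_simplex_def)
    show "0 \<le> cum w a" unfolding cum_def using that by (intro sum_nonneg) (auto simp: standard_simplex_def)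
  qed
  have v01: "0 \<le> v l" "v l \<le> 1" if "l \<in> {1..N}" for l
    using that cum_le_1 [OF t, of l] cum_le_1 [OF s, of "l - n"] by (auto simp: v_def N_def)
  have inv_mem: "inv_into UNIV \<theta> k \<in> {1..N}" if "k \<in> {1..N}" for k
    using permutes_in_image [OF permutes_inv [OF perm]] that by blast
  have u_mono: "u k \<le> u (Suc k)" if "k \<le> N" for k
  proof (cases "k = 0 \<or> k = N")
    case True
    then show ?thesis
      using v01 inv_mem [of 1] inv_mem [of N] by (auto simp: u_def)
  next
    case False
    then have k: "k \<in> {1..N}" "Suc k \<in> {1..N}" using that by auto
    have "le (inv_into UNIV \<theta> k) (inv_into UNIV \<theta> (Suc k))"
      by (rule \<theta>_le) (simp add: inv\<theta>, use inv_mem k in blast, use inv_mem k in blast)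
    then show ?thesis using k by (auto simp: u_def le_def)
  qed
  define r where "r k = (if k \<le> N then u (Suc k) - u k else 0)" for k
  have rsum: "(\<Sum>k\<le>N. r k) = 1"
  proof -
    have "(\<Sum>k\<le>N. r k) = (\<Sum>k<Suc N. u (Suc k) - u k)"
      by (rule sum.cong) (auto simp: r_def)
    also have "\<dots> = u (Suc N) - u 0" by (rule sum_lessThan_telescope)
    finally show ?thesis by (simp add: u_def)
  qed
  have r0: "0 \<le> r k" for k using u_mono by (simp add: r_def)
  have r1: "r k \<le> 1" for k
  proof (cases "k \<le> N")
    case True
    then have "r k \<le> (\<Sum>k\<le>N. r k)" by (intro member_le_sum) (auto simp: r0)
    then show ?thesis using rsum by simp
  qed (simp add: r_def)
  have rs: "r \<in> standard_simplex (n + m)"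
    using rsum r0 r1 by (simp add: standard_simplex_def r_def N_def [symmetric])
  have "(\<Sum>k | k \<le> n + m \<and> path_i n \<theta> k = i. r k) = t i" for i
  proof -
    have "(\<Sum>k | k \<le> n + m \<and> path_i n \<theta> k = i. r k) =
        (\<Sum>k | k \<le> N \<and> card {a \<in> {1..n}. \<theta> a \<le> k} = i. u (Suc k) - u k)"
      by (rule sum.cong) (auto simp: shuffles_perm_path(4) [OF \<theta>] r_def N_def)
    also have "\<dots> = t i"
      by (rule sum_gaps [OF t mono1]) (use into u\<theta> in \<open>auto simp: u_def v_def N_def\<close>)
    finally show ?thesis .
  qed
  moreover have "(\<Sum>k | k \<le> n + m \<and> path_j n \<theta> k = i. r k) = s i" for i
  proof -
    have "(\<Sum>k | k \<le> n + m \<and> path_j n \<theta> k = i. r k) =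
        (\<Sum>k | k \<le> N \<and> card {a \<in> {1..m}. \<theta> (n + a) \<le> k} = i. u (Suc k) - u k)"
      by (rule sum.cong) (auto simp: shuffles_perm_path(5) [OF \<theta>] r_def N_def)
    also have "\<dots> = s i"
    proof (rule sum_gaps [OF s])
      show "strict_mono_on {1..m} (\<lambda>a. \<theta> (n + a))"
        using mono2 by (auto simp: strict_mono_on_def)
      show "(\<lambda>a. \<theta> (n + a)) ` {1..m} \<subseteq> {1..N}"
        using into by (auto simp: N_def image_subset_iff)
      show "u (\<theta> (n + a)) = cum s a" if "a \<in> {1..m}" for a
        using u\<theta> [of "n + a"] that by (auto simp: v_def N_def)
    qed (auto simp: u_def)
    finally show ?thesis .
  qed
  ultimately have "shuffle_param n m \<theta> r = (t, s)"
    by (simp add: shuffle_param_def)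
  then have "(t, s) \<in> shuffle_simplex n m \<theta>"
    unfolding shuffle_simplex_def using rs by (metis imageI)
  then show ?thesis using that \<theta> by blast
qed

lemma overlap_nonzero:
  assumes "overlap t s i j \<noteq> 0"
  shows "t i \<noteq> 0" "s j \<noteq> 0"
  using assms by (auto simp: overlap_def cum_def max_def min_def split: if_splits)

lemma shuffle_weight_nonzero:
  assumes "t \<in> standard_simplex n" "s \<in> standard_simplex m" "shuffle_weight t s k \<noteq> 0"
  obtains i j where "i \<le> n" "j \<le> m" "k = i + j" "overlap t s i j \<noteq> 0" "t i \<noteq> 0" "s j \<noteq> 0"
proof -
  obtain i where i: "i \<le> k" "overlap t s i (k - i) \<noteq> 0"
    using assms(3) unfolding shuffle_weight_def by (metis (no_types, lifting) atMost_iff sum.neutral)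
  moreover have "i \<le> n" "k - i \<le> m"
    using overlap_nonzero [OF i(2)] assms(1,2) by (auto simp: standard_simplex_def not_le [symmetric])
  ultimately show ?thesis
    using that [of i "k - i"] overlap_nonzero [OF i(2)] by simp
qed

lemma shuffle_weight_simplex:
  assumes "t \<in> standard_simplex n" "s \<in> standard_simplex m"
  shows "shuffle_weight t s \<in> standard_simplex (n + m)"
  using shuffle_simplices_cover [OF assms] shuffle_simplexE(2) by metis

section \<open>The fibrewise shuffle map\<close>

lemma fibred_product_coord:
  assumes "a \<in> topspace (fibred_product n E p)"
  shows "i \<le> n \<Longrightarrow> a i \<in> topspace E" "a \<in> extensional {..n}"
  using assms unfolding topspace_fibred_product by (auto simp only: mem_Collect_eq PiE_iff atMost_iff)

lemma fibred_productI:
  assumes "\<And>i. i \<le> n \<Longrightarrow> a i \<in> topspace E" "a \<in> extensional {..n}" "\<And>i. i \<le> n \<Longrightarrow> p (a i) = p (a 0)"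
  shows "a \<in> topspace (fibred_product n E p)"
proof -
  have "p (a i) = p (a j)" if "i \<le> n" "j \<le> n" for i j
    using assms(3) [OF that(1)] assms(3) [OF that(2)] by simp
  moreover have "a \<in> {..n} \<rightarrow>\<^sub>E topspace E"
    using assms(1,2) by (simp add: PiE_iff)
  ultimately show ?thesis unfolding topspace_fibred_product by blast
qed

lemma delta_shuffle_mem:
  assumes \<theta>: "\<theta> \<in> shuffles_perm n m"
    and a: "a \<in> topspace (fibred_product n E p)" and b: "b \<in> topspace (fibred_product m F q)"
  shows "delta_shuffle n m \<theta> a b \<in> topspace (fibred_product (n + m) (kprod E F) (map_prod p q))"
proof -
  have "delta_shuffle n m \<theta> a b \<in> {..n + m} \<rightarrow>\<^sub>E topspace E \<times> topspace F"
    using fibred_product_coord(1) [OF a] fibred_product_coord(1) [OF b] shuffles_perm_path_le [OF \<theta>]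
    by (simp add: delta_shuffle_def PiE_iff)
  moreover have "map_prod p q (delta_shuffle n m \<theta> a b i) = map_prod p q (delta_shuffle n m \<theta> a b j)"
    if "i \<le> n + m" "j \<le> n + m" for i j
  proof -
    have "p (a (path_i n \<theta> i)) = p (a (path_i n \<theta> j))" "q (b (path_j n \<theta> i)) = q (b (path_j n \<theta> j))"
      by (rule fibred_product_fibre [OF a] fibred_product_fibre [OF b];
          rule shuffles_perm_path_le [OF \<theta>]; fact)+
    then show ?thesis using that by (simp add: delta_shuffle_def)
  qed
  moreover have "delta_shuffle n m \<theta> a b \<in> {..n + m} \<rightarrow>\<^sub>E topspace (kprod E F)"
    using calculation(1) by simp
  ultimately show ?thesis unfolding topspace_fibred_product by blast
qed

text \<open>\<open>psi_map\<close> with general projections in place of the maps to a point; it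
  covers the product of the two base projections.\<close>

definition fjoin_shuffle ::
    "nat \<Rightarrow> nat \<Rightarrow> 'e topology \<Rightarrow> ('e \<Rightarrow> 'x) \<Rightarrow> 'f topology \<Rightarrow> ('f \<Rightarrow> 'y)
     \<Rightarrow> 'e fjoin_point \<Rightarrow> 'f fjoin_point \<Rightarrow> ('e \<times> 'f) fjoin_point" where
  "fjoin_shuffle n m E p F q c d =
     (case (rep c, rep d) of ((a, t), (b, s)) \<Rightarrow>
        let \<theta> = (SOME \<theta>. \<theta> \<in> shuffles_perm n m \<and> (t, s) \<in> shuffle_simplex n m \<theta>)
        in fjoin_pt (n + m) (kprod E F) (map_prod p q) (delta_shuffle n m \<theta> a b, psi_simplex n m \<theta> (t, s)))"

text \<open>This removes the chosen representatives and the chosen shuffle. Only coordinates of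
  nonzero weight matter; such an index is k = i + j with a nonzero overlap, there every admissible
  path passes through (i,j), and the coordinates a i and b j have nonzero weight too.\<close>

lemma fjoin_shuffle_pt:
  assumes a: "a \<in> topspace (fibred_product n E p)" and t: "t \<in> standard_simplex n"
    and b: "b \<in> topspace (fibred_product m F q)" and s: "s \<in> standard_simplex m"
    and f: "f \<in> topspace (fibred_product (n + m) (kprod E F) (map_prod p q))"
    and fab: "\<And>i j. overlap t s i j \<noteq> 0 \<Longrightarrow> f (i + j) = (a i, b j)"
  shows "fjoin_shuffle n m E p F q (fjoin_pt n E p (a, t)) (fjoin_pt m F q (b, s)) =
     fjoin_pt (n + m) (kprod E F) (map_prod p q) (f, shuffle_weight t s)"
proof -
  obtain a' where a': "rep (fjoin_pt n E p (a, t)) = (a', t)" "a' \<in> topspace (fibred_product n E p)"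
      "\<And>i. t i \<noteq> 0 \<Longrightarrow> a' i = a i"
    using rep_fjoin_pt [OF a t] by metis
  obtain b' where b': "rep (fjoin_pt m F q (b, s)) = (b', s)" "b' \<in> topspace (fibred_product m F q)"
      "\<And>i. s i \<noteq> 0 \<Longrightarrow> b' i = b i"
    using rep_fjoin_pt [OF b s] by metis
  define \<theta> where "\<theta> = (SOME \<theta>. \<theta> \<in> shuffles_perm n m \<and> (t, s) \<in> shuffle_simplex n m \<theta>)"
  have "\<exists>\<theta>. \<theta> \<in> shuffles_perm n m \<and> (t, s) \<in> shuffle_simplex n m \<theta>"
    using shuffle_simplices_cover [OF t s] by metis
  then have \<theta>: "\<theta> \<in> shuffles_perm n m" "(t, s) \<in> shuffle_simplex n m \<theta>"
    unfolding \<theta>_def by (metis (mono_tags, lifting) someI_ex)+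
  note ov = shuffle_simplexE [OF \<theta>]
  have "fjoin_shuffle n m E p F q (fjoin_pt n E p (a, t)) (fjoin_pt m F q (b, s)) =
      fjoin_pt (n + m) (kprod E F) (map_prod p q) (delta_shuffle n m \<theta> a' b', shuffle_weight t s)"
    by (simp add: fjoin_shuffle_def a'(1) b'(1) Let_def ov(1) flip: \<theta>_def)
  also have "\<dots> = fjoin_pt (n + m) (kprod E F) (map_prod p q) (f, shuffle_weight t s)"
  proof (subst fjoin_pt_eq_iff [OF delta_shuffle_mem [OF \<theta>(1) a'(2) b'(2)] ov(2) f ov(2)], intro conjI allI impI refl)
    fix k assume k: "shuffle_weight t s k \<noteq> 0"
    then obtain i j where ij: "i \<le> n" "j \<le> m" "k = i + j" "overlap t s i j \<noteq> 0" "t i \<noteq> 0" "s j \<noteq> 0"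
      using shuffle_weight_nonzero [OF t s] by metis
    then show "delta_shuffle n m \<theta> a' b' k = f k"
      using ov(3) [OF ij(4)] fab [OF ij(4)] a'(3) b'(3) by (simp add: delta_shuffle_def)
  qed
  finally show ?thesis .
qed

lemma fjoin_shuffle_obtain:
  assumes a: "a \<in> topspace (fibred_product n E p)" and t: "t \<in> standard_simplex n"
    and b: "b \<in> topspace (fibred_product m F q)" and s: "s \<in> standard_simplex m"
  obtains f where "f \<in> topspace (fibred_product (n + m) (kprod E F) (map_prod p q))"
    "\<And>i j. overlap t s i j \<noteq> 0 \<Longrightarrow> f (i + j) = (a i, b j)"
    "fjoin_shuffle n m E p F q (fjoin_pt n E p (a, t)) (fjoin_pt m F q (b, s)) =
       fjoin_pt (n + m) (kprod E F) (map_prod p q) (f, shuffle_weight t s)"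
proof -
  obtain \<theta> where \<theta>: "\<theta> \<in> shuffles_perm n m" "(t, s) \<in> shuffle_simplex n m \<theta>"
    using shuffle_simplices_cover [OF t s] by metis
  have 1: "delta_shuffle n m \<theta> a b \<in> topspace (fibred_product (n + m) (kprod E F) (map_prod p q))"
    by (rule delta_shuffle_mem [OF \<theta>(1) a b])
  have 2: "delta_shuffle n m \<theta> a b (i + j) = (a i, b j)" if "overlap t s i j \<noteq> 0" for i j
    using shuffle_simplexE(3) [OF \<theta> that] by (simp add: delta_shuffle_def)
  show ?thesis
    using that [OF 1 2] fjoin_shuffle_pt [OF a t b s 1 2] by blast
qed

text \<open>A product of maps to a point ends in \<open>unit \<times> unit\<close> instead of
  \<open>unit\<close>; both impose no condition on coordinates, so the joins are the same.\<close>

lemma psi_map_eq_fjoin_shuffle: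
  "psi_map n m A B = fjoin_shuffle n m A to_point B to_point"
  "njoin N (kprod A B) = fjoin N (kprod A B) (map_prod to_point to_point)"
  "njoin_pt N (kprod A B) = fjoin_pt N (kprod A B) (map_prod to_point to_point)"
proof -
  have "{a :: nat \<Rightarrow> 'a \<times> 'b. \<forall>i\<le>n. \<forall>j\<le>n. to_point (a i) = to_point (a j)} =
      {a. \<forall>i\<le>n. \<forall>j\<le>n. map_prod to_point to_point (a i) = map_prod to_point to_point (a j)}" for n :: nat
    by (simp add: map_prod_def case_prod_unfold)
  then have "fibred_product n (kprod A B) to_point = fibred_product n (kprod A B) (map_prod to_point to_point)" for n
    by (simp only: fibred_product_def)
  then show pt: "njoin N (kprod A B) = fjoin N (kprod A B) (map_prod to_point to_point)"
    "njoin_pt N (kprod A B) = fjoin_pt N (kprod A B) (map_prod to_point to_point)" for N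
    by (simp_all only: fjoin_def fjoin_pt_def)
  show "psi_map n m A B = fjoin_shuffle n m A to_point B to_point"
    by (intro ext) (simp add: psi_map_def fjoin_shuffle_def pt)
qed

lemma fjoin_shuffle_mem:
  assumes "c \<in> topspace (fjoin n E p)" "d \<in> topspace (fjoin m F q)"
  shows "fjoin_shuffle n m E p F q c d \<in> topspace (fjoin (n + m) (kprod E F) (map_prod p q))"
    "fjoin_weight (fjoin_shuffle n m E p F q c d) = shuffle_weight (fjoin_weight c) (fjoin_weight d)"
    "fjoin_proj (map_prod p q) (fjoin_shuffle n m E p F q c d) = (fjoin_proj p c, fjoin_proj q d)"
proof -
  obtain a t where c: "a \<in> topspace (fibred_product n E p)" "t \<in> standard_simplex n" "c = fjoin_pt n E p (a, t)"
    using assms(1) by (rule fjoin_cases)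
  obtain b s where d: "b \<in> topspace (fibred_product m F q)" "s \<in> standard_simplex m" "d = fjoin_pt m F q (b, s)"
    using assms(2) by (rule fjoin_cases)
  obtain f where f: "f \<in> topspace (fibred_product (n + m) (kprod E F) (map_prod p q))"
    "\<And>i j. overlap t s i j \<noteq> 0 \<Longrightarrow> f (i + j) = (a i, b j)"
    "fjoin_shuffle n m E p F q c d = fjoin_pt (n + m) (kprod E F) (map_prod p q) (f, shuffle_weight t s)"
    using fjoin_shuffle_obtain [OF c(1,2) d(1,2)] c(3) d(3) by metis
  note w = shuffle_weight_simplex [OF c(2) d(2)]
  show "fjoin_shuffle n m E p F q c d \<in> topspace (fjoin (n + m) (kprod E F) (map_prod p q))"
    "fjoin_weight (fjoin_shuffle n m E p F q c d) = shuffle_weight (fjoin_weight c) (fjoin_weight d)"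
    using c d f w by (simp_all add: fjoin_pt_mem)
  \<comment> \<open>The projection may be read off any coordinate; one of positive weight comes from
    an overlap, where f is known.\<close>
  obtain k where k: "k \<le> n + m" "0 < shuffle_weight t s k"
    using standard_simplex_nonzero [OF w] by blast
  then obtain i j where ij: "i \<le> n" "j \<le> m" "k = i + j" "overlap t s i j \<noteq> 0"
    using shuffle_weight_nonzero [OF c(2) d(2), of k] by (metis less_irrefl)
  have "fjoin_proj (map_prod p q) (fjoin_shuffle n m E p F q c d) = map_prod p q (f k)"
    unfolding f(3) by (rule fjoin_proj_pt [OF f(1) w k(1)])
  also have "\<dots> = (p (a i), q (b j))"
    using f(2) [OF ij(4)] ij(3) by simp
  finally show "fjoin_proj (map_prod p q) (fjoin_shuffle n m E p F q c d) = (fjoin_proj p c, fjoin_proj q d)"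
    by (simp add: c(3) d(3) fjoin_proj_pt [OF c(1,2) ij(1)] fjoin_proj_pt [OF d(1,2) ij(2)])
qed

lemma continuous_map_shuffle_weight:
  assumes "\<And>i. continuous_map Q euclideanreal (\<lambda>x. t x i)" "\<And>i. continuous_map Q euclideanreal (\<lambda>x. s x i)"
  shows "continuous_map Q euclideanreal (\<lambda>x. shuffle_weight (t x) (s x) k)"
  unfolding shuffle_weight_def overlap_def cum_def
  by (intro continuous_map_sum continuous_map_real_max continuous_map_real_min continuous_map_diff assms)
     (auto intro: assms)

lemma closedin_shuffle_simplex:
  "closedin (prod_topology (powertop_real UNIV) (powertop_real UNIV)) (shuffle_simplex n m \<theta>)"
proof (rule compactin_imp_closedin)
  show "Hausdorff_space (prod_topology (powertop_real UNIV) (powertop_real UNIV))"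
    by (simp add: Hausdorff_space_prod_topology Hausdorff_space_product_topology)
  have "continuous_map (powertop_real UNIV) (prod_topology (powertop_real UNIV) (powertop_real UNIV)) (shuffle_param n m \<theta>)"
    unfolding shuffle_param_def
    by (intro continuous_map_pairedI continuous_map_componentwise_UNIV [THEN iffD2] allI continuous_map_sum
        continuous_map_product_projection) auto
  then show "compactin (prod_topology (powertop_real UNIV) (powertop_real UNIV)) (shuffle_simplex n m \<theta>)"
    unfolding shuffle_simplex_def by (rule image_compactin [OF compactin_standard_simplex])
qed

text \<open>Before passing to classes, the shuffle simplices give a finite closed cover with an
  explicit continuous formula on each. The formulas agree on overlaps because each equals the
  choice-free map, and the product of the two projections is a quotient map of k-products.\<close>

lemma continuous_map_fjoin_shuffle:
  fixes E :: "'e topology" and F :: "'f topology"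
  assumes E: "Hausdorff_space E" and F: "Hausdorff_space F"
  shows "continuous_map (kprod (fjoin n E p) (fjoin m F q)) (fjoin (n + m) (kprod E F) (map_prod p q))
    (\<lambda>(c, d). fjoin_shuffle n m E p F q c d)"
proof -
  let ?D = "kprod (prejoin n E p) (prejoin m F q)"
  let ?Z = "fjoin (n + m) (kprod E F) (map_prod p q)"
  have quo: "quotient_map ?D (kprod (fjoin n E p) (fjoin m F q)) (\<lambda>(x, y). (fjoin_pt n E p x, fjoin_pt m F q y))"
    by (intro quotient_map_kprod quotient_map_fjoin_pt k_space_prejoin Hausdorff_fjoin E)
       (simp add: Hausdorff_space_prod_topology Hausdorff_fibred_product F Hausdorff_simplex_top)
  have t: "continuous_map ?D (simplex_top n) (\<lambda>x. snd (fst x))"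
    by (rule continuous_map_comp [OF continuous_map_snd continuous_map_kprod_fst])
  have s: "continuous_map ?D (simplex_top m) (\<lambda>x. snd (snd x))"
    by (rule continuous_map_comp [OF continuous_map_snd continuous_map_kprod_snd])
  have a: "continuous_map ?D E (\<lambda>x. fst (fst x) i)" if "i \<le> n" for i
    by (rule continuous_map_comp [OF continuous_map_fibred_coord [OF that]
          continuous_map_comp [OF continuous_map_fst continuous_map_kprod_fst]])
  have b: "continuous_map ?D F (\<lambda>x. fst (snd x) i)" if "i \<le> m" for i
    by (rule continuous_map_comp [OF continuous_map_fibred_coord [OF that]
          continuous_map_comp [OF continuous_map_fst continuous_map_kprod_snd]])
  have "continuous_map (simplex_top k) (powertop_real UNIV) id" for k
    unfolding simplex_top_def by (simp add: continuous_map_from_subtopology)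
  then have ts: "continuous_map ?D (prod_topology (powertop_real UNIV) (powertop_real UNIV))
      (\<lambda>x. (snd (fst x), snd (snd x)))"
    using continuous_map_comp [OF _ t, of _ id] continuous_map_comp [OF _ s, of _ id]
    by (simp add: continuous_map_pairedI)
  define T where "T \<theta> = {x \<in> topspace ?D. (snd (fst x), snd (snd x)) \<in> shuffle_simplex n m \<theta>}" for \<theta>
  define G where "G \<theta> x = fjoin_pt (n + m) (kprod E F) (map_prod p q)
      (delta_shuffle n m \<theta> (fst (fst x)) (fst (snd x)), shuffle_weight (snd (fst x)) (snd (snd x)))"
    for \<theta> and x :: "((nat \<Rightarrow> 'e) \<times> (nat \<Rightarrow> real)) \<times> (nat \<Rightarrow> 'f) \<times> (nat \<Rightarrow> real)"
  let ?f = "\<lambda>x. fjoin_shuffle n m E p F q (fjoin_pt n E p (fst x)) (fjoin_pt m F q (snd x))"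
  have Gf: "?f x = G \<theta> x" if \<theta>: "\<theta> \<in> shuffles_perm n m" and x: "x \<in> T \<theta>" for \<theta> x
  proof -
    obtain a t b s where xe: "x = ((a, t), (b, s))" by (metis surj_pair)
    then have m: "a \<in> topspace (fibred_product n E p)" "t \<in> standard_simplex n"
      "b \<in> topspace (fibred_product m F q)" "s \<in> standard_simplex m" "(t, s) \<in> shuffle_simplex n m \<theta>"
      using x by (auto simp: T_def)
    show ?thesis
      unfolding xe G_def fst_conv snd_conv
      by (rule fjoin_shuffle_pt [OF m(1-4) delta_shuffle_mem [OF \<theta> m(1,3)]])
         (use shuffle_simplexE(3) [OF \<theta> m(5)] in \<open>auto simp: delta_shuffle_def\<close>)
  qed
  have "continuous_map ?D ?Z ?f"
  proof (rule pasting_lemma_closed [OF finite_shuffles_perm, where T = T and f = G])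
    fix \<theta> assume \<theta>: "\<theta> \<in> shuffles_perm n m"
    show cl: "closedin ?D (T \<theta>)"
      unfolding T_def by (rule closedin_continuous_map_preimage [OF ts closedin_shuffle_simplex])
    have k: "k_space (subtopology ?D (T \<theta>))"
      by (rule k_space_closed_subtopology [OF k_space_kprod cl])
    show "continuous_map (subtopology ?D (T \<theta>)) ?Z (G \<theta>)"
      unfolding G_def
    proof (rule continuous_map_into_fjoin [OF k])
      fix k assume k': "k \<le> n + m"
      have "continuous_map (subtopology ?D (T \<theta>)) (kprod E F)
          (\<lambda>x. (fst (fst x) (path_i n \<theta> k), fst (snd x) (path_j n \<theta> k)))"
        by (intro continuous_map_into_kprod [OF k] continuous_map_from_subtopology a b
            shuffles_perm_path_le [OF \<theta> k'])
      then show "continuous_map (subtopology ?D (T \<theta>)) (kprod E F)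
          (\<lambda>x. delta_shuffle n m \<theta> (fst (fst x)) (fst (snd x)) k)"
        using k' by (simp add: delta_shuffle_def)
    next
      fix x assume x: "x \<in> topspace (subtopology ?D (T \<theta>))"
      then have m: "fst (fst x) \<in> topspace (fibred_product n E p)" "fst (snd x) \<in> topspace (fibred_product m F q)"
        "(snd (fst x), snd (snd x)) \<in> shuffle_simplex n m \<theta>"
        by (auto simp: T_def)
      note dm = delta_shuffle_mem [OF \<theta> m(1,2)]
      show "delta_shuffle n m \<theta> (fst (fst x)) (fst (snd x)) \<in> extensional {..n + m}"
        by (simp add: delta_shuffle_def)
      show "map_prod p q (delta_shuffle n m \<theta> (fst (fst x)) (fst (snd x)) k) =
          map_prod p q (delta_shuffle n m \<theta> (fst (fst x)) (fst (snd x)) 0)" if "k \<le> n + m" for k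
        by (rule fibred_product_fibre [OF dm that]) simp
      show "shuffle_weight (snd (fst x)) (snd (snd x)) \<in> standard_simplex (n + m)"
        by (rule shuffle_simplexE(2) [OF \<theta> m(3)])
    next
      fix k show "continuous_map (subtopology ?D (T \<theta>)) euclideanreal (\<lambda>x. shuffle_weight (snd (fst x)) (snd (snd x)) k)"
        by (intro continuous_map_from_subtopology continuous_map_shuffle_weight
            continuous_map_comp [OF continuous_map_simplex_coord t] continuous_map_comp [OF continuous_map_simplex_coord s])
    qed
  next
    fix \<theta> \<theta>' x assume "\<theta> \<in> shuffles_perm n m" "\<theta>' \<in> shuffles_perm n m" "x \<in> topspace ?D \<inter> T \<theta> \<inter> T \<theta>'"
    then show "G \<theta> x = G \<theta>' x" using Gf by (metis IntD1 IntD2)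
  next
    fix x assume x: "x \<in> topspace ?D"
    then have "snd (fst x) \<in> standard_simplex n" "snd (snd x) \<in> standard_simplex m" by auto
    then obtain \<theta> where \<theta>: "\<theta> \<in> shuffles_perm n m" "(snd (fst x), snd (snd x)) \<in> shuffle_simplex n m \<theta>"
      using shuffle_simplices_cover by metis
    then have "x \<in> T \<theta>" using x by (simp add: T_def)
    then show "\<exists>\<theta>. \<theta> \<in> shuffles_perm n m \<and> x \<in> T \<theta> \<and> ?f x = G \<theta> x"
      using \<theta> Gf by blast
  qed
  then show ?thesis
    by (intro continuous_compose_quotient_map [OF quo]) (simp add: o_def case_prod_unfold)
qed

section \<open>Removing and adding a last coordinate\<close>

lemma standard_simplex_SucD:
  assumes "t \<in> standard_simplex (Suc n)" "t (Suc n) = 0"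
  shows "t \<in> standard_simplex n"
proof -
  have "t i = 0" if "n < i" for i
    using assms that by (cases "i = Suc n") (auto simp: standard_simplex_def)
  then show ?thesis using assms by (simp add: standard_simplex_def)
qed

lemma standard_simplex_SucI:
  assumes "t \<in> standard_simplex n"
  shows "t \<in> standard_simplex (Suc n)" "t (Suc n) = 0"
  using assms by (auto simp: standard_simplex_def)

text \<open>Meaningful where the last weight is 0: only then do the remaining weights sum to
  1.\<close>

definition fjoin_drop :: "nat \<Rightarrow> 'e topology \<Rightarrow> ('e \<Rightarrow> 'x) \<Rightarrow> 'e fjoin_point \<Rightarrow> 'e fjoin_point" where
  "fjoin_drop n E p c = fjoin_pt n E p (restrict (fjoin_coord c) {..n}, fjoin_weight c)"

text \<open>The new coordinate has weight 0, but must lie in the same fibre; repeating coordinate 0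
  provides such a point without a section.\<close>

definition fjoin_raise :: "nat \<Rightarrow> 'e topology \<Rightarrow> ('e \<Rightarrow> 'x) \<Rightarrow> 'e fjoin_point \<Rightarrow> 'e fjoin_point" where
  "fjoin_raise n E p c = fjoin_pt (Suc n) E p ((fjoin_coord c)(Suc n := fjoin_coord c 0), fjoin_weight c)"

lemma restrict_fibred_product:
  assumes "a \<in> topspace (fibred_product (Suc n) E p)"
  shows "restrict a {..n} \<in> topspace (fibred_product n E p)"
proof (rule fibred_productI)
  show "p (restrict a {..n} i) = p (restrict a {..n} 0)" if "i \<le> n" for i
    using fibred_product_fibre [OF assms, of i 0] that by simp
qed (use fibred_product_coord [OF assms] in auto)

lemma extend_fibred_product:
  assumes a: "a \<in> topspace (fibred_product n E p)" and e: "e \<in> topspace E" "p e = p (a 0)"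
  shows "a(Suc n := e) \<in> topspace (fibred_product (Suc n) E p)"
proof (rule fibred_productI)
  show "p ((a(Suc n := e)) i) = p ((a(Suc n := e)) 0)" if "i \<le> Suc n" for i
    using fibred_product_fibre [OF a, of i 0] that e by auto
qed (use fibred_product_coord [OF a] e in \<open>auto simp: extensional_def\<close>)

lemma fjoin_drop_pt:
  assumes a: "a \<in> topspace (fibred_product (Suc n) E p)" and t: "t \<in> standard_simplex (Suc n)" "t (Suc n) = 0"
  shows "fjoin_drop n E p (fjoin_pt (Suc n) E p (a, t)) = fjoin_pt n E p (restrict a {..n}, t)"
proof -
  let ?c = "fjoin_pt (Suc n) E p (a, t)"
  note c = fjoin_pt_mem [OF a t(1)]
  have w: "fjoin_weight ?c = t" using a t by simp
  note tn = standard_simplex_SucD [OF t]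
  show ?thesis
    unfolding fjoin_drop_def w
  proof (subst fjoin_pt_eq_iff [OF restrict_fibred_product [OF fjoin_rep(1) [OF c]] tn
          restrict_fibred_product [OF a] tn], intro conjI allI impI refl)
    fix i assume "t i \<noteq> 0"
    then show "restrict (fjoin_coord ?c) {..n} i = restrict a {..n} i"
      using fjoin_coord_pt [OF a t(1)] by (auto simp: restrict_def)
  qed
qed

lemma fjoin_raise_pt:
  assumes a: "a \<in> topspace (fibred_product n E p)" and t: "t \<in> standard_simplex n"
  shows "fjoin_raise n E p (fjoin_pt n E p (a, t)) = fjoin_pt (Suc n) E p (a(Suc n := a 0), t)"
proof -
  let ?c = "fjoin_pt n E p (a, t)"
  note c = fjoin_pt_mem [OF a t(1)]
  have w: "fjoin_weight ?c = t" using a t by simp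
  note tn = standard_simplex_SucI [OF t]
  have e: "x(Suc n := x 0) \<in> topspace (fibred_product (Suc n) E p)"
    if "x \<in> topspace (fibred_product n E p)" for x
    by (rule extend_fibred_product [OF that fibred_product_coord(1) [OF that] refl]) simp
  show ?thesis
    unfolding fjoin_raise_def w
  proof (subst fjoin_pt_eq_iff [OF e [OF fjoin_rep(1) [OF c]] tn(1) e [OF a] tn(1)], intro conjI allI impI refl)
    fix i assume "t i \<noteq> 0"
    then show "((fjoin_coord ?c)(Suc n := fjoin_coord ?c 0)) i = (a(Suc n := a 0)) i"
      using fjoin_coord_pt [OF a t(1)] tn(2) by (cases "i = Suc n") auto
  qed
qed

lemma fjoin_raise:
  assumes "c \<in> topspace (fjoin n E p)"
  shows "fjoin_raise n E p c \<in> topspace (fjoin (Suc n) E p)"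
    "fjoin_weight (fjoin_raise n E p c) = fjoin_weight c"
    "fjoin_proj p (fjoin_raise n E p c) = fjoin_proj p c"
proof -
  obtain a t where c: "a \<in> topspace (fibred_product n E p)" "t \<in> standard_simplex n" "c = fjoin_pt n E p (a, t)"
    using assms by (rule fjoin_cases)
  have e: "a(Suc n := a 0) \<in> topspace (fibred_product (Suc n) E p)"
    by (rule extend_fibred_product [OF c(1) fibred_product_coord(1) [OF c(1)] refl]) simp
  note t = standard_simplex_SucI(1) [OF c(2)]
  show "fjoin_raise n E p c \<in> topspace (fjoin (Suc n) E p)"
    "fjoin_weight (fjoin_raise n E p c) = fjoin_weight c"
    "fjoin_proj p (fjoin_raise n E p c) = fjoin_proj p c"
    unfolding c(3) fjoin_raise_pt [OF c(1,2)]
    using fjoin_pt_mem [OF e t] fjoin_weight_pt [OF e t] fjoin_weight_pt [OF c(1,2)]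
      fjoin_proj_pt [OF e t, of 0] fjoin_proj_pt [OF c(1,2), of 0] by simp_all
qed

lemma continuous_map_prejoin:
  assumes "i \<le> n"
  shows "continuous_map (prejoin n E p) E (\<lambda>x. fst x i)"
  by (rule continuous_map_comp [OF continuous_map_fibred_coord [OF assms] continuous_map_fst])

lemma continuous_map_prejoin_weight:
  "continuous_map (prejoin n E p) euclideanreal (\<lambda>x. snd x i)"
  by (rule continuous_map_comp [OF continuous_map_simplex_coord continuous_map_snd])

lemma continuous_map_fjoin_raise: "continuous_map (fjoin n E p) (fjoin (Suc n) E p) (fjoin_raise n E p)"
proof (rule continuous_map_from_fjoin)
  have "continuous_map (prejoin n E p) (fjoin (Suc n) E p)
      (\<lambda>x. fjoin_pt (Suc n) E p ((fst x)(Suc n := fst x 0), snd x))"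
  proof (rule continuous_map_into_fjoin [OF k_space_prejoin])
    show "continuous_map (prejoin n E p) E (\<lambda>x. ((fst x)(Suc n := fst x 0)) i)" if "i \<le> Suc n" for i
      using that by (cases "i = Suc n") (auto intro: continuous_map_prejoin)
    fix x assume x: "x \<in> topspace (prejoin n E p)"
    then have a: "fst x \<in> topspace (fibred_product n E p)" by auto
    have e: "(fst x)(Suc n := fst x 0) \<in> topspace (fibred_product (Suc n) E p)"
      by (rule extend_fibred_product [OF a fibred_product_coord(1) [OF a] refl]) simp
    show "(fst x)(Suc n := fst x 0) \<in> extensional {..Suc n}"
      by (rule fibred_product_coord(2) [OF e])
    show "p (((fst x)(Suc n := fst x 0)) i) = p (((fst x)(Suc n := fst x 0)) 0)" if "i \<le> Suc n" for i
      by (rule fibred_product_fibre [OF e that]) simp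
    show "snd x \<in> standard_simplex (Suc n)" using x standard_simplex_SucI(1) by auto
  qed (rule continuous_map_prejoin_weight)
  then show "continuous_map (prejoin n E p) (fjoin (Suc n) E p) (\<lambda>x. fjoin_raise n E p (fjoin_pt n E p x))"
    by (rule continuous_map_eq) (auto simp: fjoin_raise_pt)
qed

lemma fjoin_drop:
  assumes "c \<in> topspace (fjoin (Suc n) E p)" "fjoin_weight c (Suc n) = 0"
  shows "fjoin_drop n E p c \<in> topspace (fjoin n E p)"
    "fjoin_weight (fjoin_drop n E p c) = fjoin_weight c"
    "fjoin_proj p (fjoin_drop n E p c) = fjoin_proj p c"
proof -
  obtain a t where c: "a \<in> topspace (fibred_product (Suc n) E p)" "t \<in> standard_simplex (Suc n)"
      "c = fjoin_pt (Suc n) E p (a, t)"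
    using assms(1) by (rule fjoin_cases)
  have t0: "t (Suc n) = 0" using assms(2) c by simp
  note e = restrict_fibred_product [OF c(1)]
  note t = standard_simplex_SucD [OF c(2) t0]
  show "fjoin_drop n E p c \<in> topspace (fjoin n E p)"
    "fjoin_weight (fjoin_drop n E p c) = fjoin_weight c"
    "fjoin_proj p (fjoin_drop n E p c) = fjoin_proj p c"
    unfolding c(3) fjoin_drop_pt [OF c(1,2) t0]
    using fjoin_pt_mem [OF e t] fjoin_weight_pt [OF e t] fjoin_weight_pt [OF c(1,2)]
      fjoin_proj_pt [OF e t, of 0] fjoin_proj_pt [OF c(1,2), of 0] by simp_all
qed

text \<open>The set of zero last weight is closed, so the projection restricts to a quotient map
  over it, and its preimage is again a k-space.\<close>

lemma continuous_map_fjoin_drop: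
  "continuous_map (subtopology (fjoin (Suc n) E p) {c. fjoin_weight c (Suc n) = 0}) (fjoin n E p) (fjoin_drop n E p)"
proof -
  let ?J = "fjoin (Suc n) E p"
  let ?V = "{c \<in> topspace ?J. fjoin_weight c (Suc n) = 0}"
  let ?U = "{x \<in> topspace (prejoin (Suc n) E p). fjoin_pt (Suc n) E p x \<in> ?V}"
  let ?P = "subtopology (prejoin (Suc n) E p) ?U"
  have "closedin ?J {c \<in> topspace ?J. fjoin_weight c (Suc n) \<in> {0}}"
    by (rule closedin_continuous_map_preimage [OF continuous_map_fjoin_weight]) auto
  then have V: "closedin ?J ?V" by simp
  have eq: "subtopology ?J {c. fjoin_weight c (Suc n) = 0} = subtopology ?J ?V"
    using subtopology_restrict [of ?J "{c. fjoin_weight c (Suc n) = 0}"] by (simp add: Int_def)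
  have q: "quotient_map ?P (subtopology ?J ?V) (fjoin_pt (Suc n) E p)"
    using quotient_map_restriction [OF quotient_map_fjoin_pt refl] V by blast
  have "closedin (prejoin (Suc n) E p) ?U"
    by (rule closedin_continuous_map_preimage [OF continuous_map_fjoin_pt V])
  then have k: "k_space ?P"
    by (rule k_space_closed_subtopology [OF k_space_prejoin])
  have U: "fst x \<in> topspace (fibred_product (Suc n) E p)" "snd x \<in> standard_simplex (Suc n)" "snd x (Suc n) = 0"
    if "x \<in> topspace ?P" for x
    using that by auto
  have "continuous_map ?P (fjoin n E p) (\<lambda>x. fjoin_pt n E p (restrict (fst x) {..n}, snd x))"
  proof (rule continuous_map_into_fjoin [OF k])
    show "continuous_map ?P E (\<lambda>x. restrict (fst x) {..n} i)" if "i \<le> n" for i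
      using that by (simp add: continuous_map_from_subtopology continuous_map_prejoin)
    fix x assume x: "x \<in> topspace ?P"
    note a = restrict_fibred_product [OF U(1) [OF x]]
    show "p (restrict (fst x) {..n} i) = p (restrict (fst x) {..n} 0)" if "i \<le> n" for i
      by (rule fibred_product_fibre [OF a that]) simp
    show "snd x \<in> standard_simplex n" by (rule standard_simplex_SucD [OF U(2,3) [OF x]])
  qed (auto intro: continuous_map_from_subtopology continuous_map_prejoin_weight)
  then have "continuous_map ?P (fjoin n E p) (fjoin_drop n E p \<circ> fjoin_pt (Suc n) E p)"
  proof (rule continuous_map_eq)
    fix x assume "x \<in> topspace ?P"
    from fjoin_drop_pt [OF U [OF this]]
    show "fjoin_pt n E p (restrict (fst x) {..n}, snd x) = (fjoin_drop n E p \<circ> fjoin_pt (Suc n) E p) x"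
      by simp
  qed
  then show ?thesis
    unfolding eq by (rule continuous_compose_quotient_map [OF q])
qed

lemma extend_simplex:
  assumes "t \<in> standard_simplex n" "0 \<le> u" "u \<le> 1"
  shows "(\<lambda>i. if i = Suc n then u else (1 - u) * t i) \<in> standard_simplex (Suc n)"
  using assms by (auto simp: standard_simplex_def mult_le_one simp flip: sum_distrib_left)

lemma join_extend_pt:
  assumes a: "a \<in> topspace (fibred_product n A to_point)" and t: "t \<in> standard_simplex n"
    and a0: "a0 \<in> topspace A" and u: "0 \<le> u" "u \<le> 1"
  shows "join_extend n A a0 (njoin_pt n A (a, t)) u =
     njoin_pt (Suc n) A (a(Suc n := a0), \<lambda>i. if i = Suc n then u else (1 - u) * t i)"
proof -
  obtain a' where a': "rep (njoin_pt n A (a, t)) = (a', t)" "a' \<in> topspace (fibred_product n A to_point)"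
      "\<And>i. t i \<noteq> 0 \<Longrightarrow> a' i = a i"
    using rep_fjoin_pt [OF a t] by metis
  show ?thesis
    unfolding join_extend_def a'(1) prod.case Suc_eq_plus1 [symmetric]
    by (subst fjoin_pt_eq_iff [OF extend_fibred_product [OF a'(2) a0] extend_simplex [OF t u]
          extend_fibred_product [OF a a0] extend_simplex [OF t u]]) (use a'(3) in auto)
qed

lemma join_extend_mem:
  assumes "c \<in> topspace (njoin n A)" "a0 \<in> topspace A" "0 \<le> u" "u \<le> 1"
  shows "join_extend n A a0 c u \<in> topspace (njoin (Suc n) A)" "fjoin_weight (join_extend n A a0 c u) (Suc n) = u"
proof -
  obtain a t where c: "a \<in> topspace (fibred_product n A to_point)" "t \<in> standard_simplex n"
      "c = njoin_pt n A (a, t)"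
    using assms(1) by (rule fjoin_cases)
  have e: "a(Suc n := a0) \<in> topspace (fibred_product (Suc n) A to_point)"
    by (rule extend_fibred_product [OF c(1) assms(2)]) simp
  show "join_extend n A a0 c u \<in> topspace (njoin (Suc n) A)" "fjoin_weight (join_extend n A a0 c u) (Suc n) = u"
    unfolding c(3) join_extend_pt [OF c(1,2) assms(2-4)]
    by (simp_all add: fjoin_pt_mem [OF e extend_simplex [OF c(2) assms(3,4)]]
        fjoin_weight_pt [OF e extend_simplex [OF c(2) assms(3,4)]])
qed

lemma continuous_map_join_extend:
  assumes a0: "a0 \<in> topspace A"
  shows "continuous_map (prod_topology unit_interval (njoin n A)) (njoin (Suc n) A)
    (\<lambda>x. join_extend n A a0 (snd x) (fst x))"
proof (rule continuous_map_from_interval_fjoin)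
  let ?Q = "prod_topology unit_interval (prejoin n A to_point)"
  have "continuous_map ?Q (njoin (Suc n) A) (\<lambda>x. njoin_pt (Suc n) A ((fst (snd x))(Suc n := a0),
      \<lambda>i. if i = Suc n then fst x else (1 - fst x) * snd (snd x) i))"
  proof (rule continuous_map_into_fjoin [OF k_space_interval_prod [OF k_space_prejoin]])
    show "continuous_map ?Q A (\<lambda>x. ((fst (snd x))(Suc n := a0)) i)" if "i \<le> Suc n" for i
      using that a0 by (cases "i = Suc n") (auto intro: continuous_map_comp [OF continuous_map_prejoin continuous_map_snd])
    have "continuous_map ?Q euclideanreal (\<lambda>x. snd (snd x) i)" for i
      by (rule continuous_map_comp [OF continuous_map_prejoin_weight continuous_map_snd])
    then show "continuous_map ?Q euclideanreal (\<lambda>x. if i = Suc n then fst x else (1 - fst x) * snd (snd x) i)" for i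
      by (cases "i = Suc n") (auto intro!: continuous_intros)
    fix x assume x: "x \<in> topspace ?Q"
    then have a: "fst (snd x) \<in> topspace (fibred_product n A to_point)" by auto
    show "(fst (snd x))(Suc n := a0) \<in> extensional {..Suc n}"
      by (rule fibred_product_coord(2) [OF extend_fibred_product [OF a a0]]) simp
    show "(\<lambda>i. if i = Suc n then fst x else (1 - fst x) * snd (snd x) i) \<in> standard_simplex (Suc n)"
      by (rule extend_simplex) (use x in auto)
  qed simp
  then show "continuous_map ?Q (njoin (Suc n) A)
      (\<lambda>x. join_extend n A a0 (snd (fst x, njoin_pt n A (snd x))) (fst (fst x, njoin_pt n A (snd x))))"
  proof (rule continuous_map_eq)
    fix x assume x: "x \<in> topspace ?Q"
    then obtain r a t where xe: "x = (r, (a, t))" by (metis surj_pair)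
    show "njoin_pt (Suc n) A ((fst (snd x))(Suc n := a0), \<lambda>i. if i = Suc n then fst x else (1 - fst x) * snd (snd x) i) =
        join_extend n A a0 (snd (fst x, njoin_pt n A (snd x))) (fst (fst x, njoin_pt n A (snd x)))"
      using x unfolding xe fst_conv snd_conv by (subst join_extend_pt [OF _ _ a0]) auto
  qed
qed

section \<open>The join of a fibre inside the fibred join\<close>

lemma fibre_subset_fibred_product:
  assumes "a \<in> topspace (fibred_product n (fibre E p x0) to_point)"
  shows "a \<in> topspace (fibred_product n E p)" "i \<le> n \<Longrightarrow> p (a i) = x0"
proof -
  have a: "a i \<in> topspace E" "p (a i) = x0" if "i \<le> n" for i
    using fibred_product_coord(1) [OF assms that] by (auto simp: fibre_def)
  then show "a \<in> topspace (fibred_product n E p)" "i \<le> n \<Longrightarrow> p (a i) = x0"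
    using fibred_product_coord(2) [OF assms] by (auto intro: fibred_productI)
qed

lemma fjoin_incl_pt:
  assumes a: "a \<in> topspace (fibred_product n (fibre E p x0) to_point)" and t: "t \<in> standard_simplex n"
  shows "fjoin_incl n E p (njoin_pt n (fibre E p x0) (a, t)) = fjoin_pt n E p (a, t)"
proof -
  obtain a' where a': "rep (njoin_pt n (fibre E p x0) (a, t)) = (a', t)"
      "a' \<in> topspace (fibred_product n (fibre E p x0) to_point)" "\<And>i. t i \<noteq> 0 \<Longrightarrow> a' i = a i"
    using rep_fjoin_pt [OF a t] by metis
  then show ?thesis
    unfolding fjoin_incl_def
    by (simp add: fjoin_pt_eq_iff [OF fibre_subset_fibred_product(1) [OF a'(2)] t fibre_subset_fibred_product(1) [OF a] t])
qed

lemma fjoin_incl: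
  assumes "c \<in> topspace (njoin n (fibre E p x0))"
  shows "fjoin_incl n E p c \<in> topspace (fjoin n E p)"
    "fjoin_weight (fjoin_incl n E p c) = fjoin_weight c"
    "fjoin_proj p (fjoin_incl n E p c) = x0"
proof -
  obtain a t where c: "a \<in> topspace (fibred_product n (fibre E p x0) to_point)" "t \<in> standard_simplex n"
      "c = njoin_pt n (fibre E p x0) (a, t)"
    using assms by (rule fjoin_cases)
  note a = fibre_subset_fibred_product [OF c(1)]
  show "fjoin_incl n E p c \<in> topspace (fjoin n E p)"
    "fjoin_weight (fjoin_incl n E p c) = fjoin_weight c"
    "fjoin_proj p (fjoin_incl n E p c) = x0"
    unfolding c(3) fjoin_incl_pt [OF c(1,2)] using c(1,2) a
    by (simp_all add: fjoin_pt_mem fjoin_proj_pt [where i = 0])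
qed

lemma continuous_map_fjoin_incl:
  "continuous_map (njoin n (fibre E p x0)) (fjoin n E p) (fjoin_incl n E p)"
proof (rule continuous_map_from_fjoin)
  let ?P = "prejoin n (fibre E p x0) to_point"
  have "continuous_map ?P (fjoin n E p) (\<lambda>x. fjoin_pt n E p (fst x, snd x))"
  proof (rule continuous_map_into_fjoin [OF k_space_prejoin])
    show "continuous_map ?P E (\<lambda>x. fst x i)" if "i \<le> n" for i
      using continuous_map_prejoin [OF that, of "fibre E p x0" to_point]
      by (simp add: fibre_def continuous_map_in_subtopology)
    fix x assume "x \<in> topspace ?P"
    then have a: "fst x \<in> topspace (fibred_product n (fibre E p x0) to_point)" by auto
    show "fst x \<in> extensional {..n}" by (rule fibred_product_coord(2) [OF a])
    show "p (fst x i) = p (fst x 0)" if "i \<le> n" for i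
      using fibre_subset_fibred_product(2) [OF a] that by simp
  qed (auto intro: continuous_map_prejoin_weight)
  then show "continuous_map ?P (fjoin n E p) (\<lambda>x. fjoin_incl n E p (njoin_pt n (fibre E p x0) x))"
    by (rule continuous_map_eq) (auto simp: fjoin_incl_pt)
qed

lemma fjoin_incl_drop:
  assumes "c \<in> topspace (njoin (Suc n) (fibre E p x0))" "fjoin_weight c (Suc n) = 0"
  shows "fjoin_incl n E p (fjoin_drop n (fibre E p x0) to_point c) = fjoin_drop n E p (fjoin_incl (Suc n) E p c)"
proof -
  obtain a t where c: "a \<in> topspace (fibred_product (Suc n) (fibre E p x0) to_point)" "t \<in> standard_simplex (Suc n)"
      "c = njoin_pt (Suc n) (fibre E p x0) (a, t)"
    using assms(1) by (rule fjoin_cases)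
  have t0: "t (Suc n) = 0" using assms(2) c by simp
  show ?thesis
    unfolding c(3) fjoin_drop_pt [OF c(1,2) t0] fjoin_incl_pt [OF c(1,2)]
      fjoin_incl_pt [OF restrict_fibred_product [OF c(1)] standard_simplex_SucD [OF c(2) t0]]
      fjoin_drop_pt [OF fibre_subset_fibred_product(1) [OF c(1)] c(2) t0] ..
qed

text \<open>Fibres over points of Hausdorff spaces are closed, and restriction to closed sets
  commutes with k-ification.\<close>

lemma fibre_kprod:
  assumes "continuous_map E X p" "continuous_map F Y q" "Hausdorff_space X" "Hausdorff_space Y"
  shows "fibre (kprod E F) (map_prod p q) (x0, y0) = kprod (fibre E p x0) (fibre F q y0)"
proof -
  let ?A = "{e \<in> topspace E. p e = x0}" and ?B = "{f \<in> topspace F. q f = y0}"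
  have "fibre E p x0 = subtopology E ?A" "fibre F q y0 = subtopology F ?B"
    using subtopology_restrict [of E "{e. p e = x0}"] subtopology_restrict [of F "{e. q e = y0}"]
    by (simp_all add: fibre_def Int_def)
  then have "kprod (fibre E p x0) (fibre F q y0) = subtopology (kprod E F) (?A \<times> ?B)"
    using kprod_closed_subtopology [OF closedin_eq_const [OF assms(1,3)] closedin_eq_const [OF assms(2,4)]]
    by simp
  also have "?A \<times> ?B = topspace (kprod E F) \<inter> {e. map_prod p q e = (x0, y0)}" by auto
  finally show ?thesis
    by (simp only: subtopology_restrict fibre_def)
qed

text \<open>One coordinate vector f, with the same overlaps, computes both sides.\<close>

lemma fjoin_incl_shuffle:
  assumes pq: "continuous_map E X p" "continuous_map F Y q" "Hausdorff_space X" "Hausdorff_space Y"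
    and c: "c \<in> topspace (njoin n (fibre E p x0))" and d: "d \<in> topspace (njoin m (fibre F q y0))"
  shows "fjoin_incl (n + m) (kprod E F) (map_prod p q)
      (fjoin_shuffle n m (fibre E p x0) to_point (fibre F q y0) to_point c d) =
    fjoin_shuffle n m E p F q (fjoin_incl n E p c) (fjoin_incl m F q d)"
proof -
  let ?A = "fibre E p x0" and ?B = "fibre F q y0"
  obtain a t where ce: "a \<in> topspace (fibred_product n ?A to_point)" "t \<in> standard_simplex n" "c = njoin_pt n ?A (a, t)"
    using c by (rule fjoin_cases)
  obtain b s where de: "b \<in> topspace (fibred_product m ?B to_point)" "s \<in> standard_simplex m" "d = njoin_pt m ?B (b, s)"
    using d by (rule fjoin_cases)
  obtain f where f: "f \<in> topspace (fibred_product (n + m) (kprod ?A ?B) (map_prod to_point to_point))"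
    "\<And>i j. overlap t s i j \<noteq> 0 \<Longrightarrow> f (i + j) = (a i, b j)"
    "fjoin_shuffle n m ?A to_point ?B to_point (njoin_pt n ?A (a, t)) (njoin_pt m ?B (b, s)) =
       fjoin_pt (n + m) (kprod ?A ?B) (map_prod to_point to_point) (f, shuffle_weight t s)"
    using fjoin_shuffle_obtain [OF ce(1,2) de(1,2)] by metis
  have f': "f \<in> topspace (fibred_product (n + m) (fibre (kprod E F) (map_prod p q) (x0, y0)) to_point)"
    unfolding fibre_kprod [OF pq]
    by (rule fibred_productI) (use fibred_product_coord [OF f(1)] in auto)
  have "fjoin_pt (n + m) (kprod ?A ?B) (map_prod to_point to_point) (f, shuffle_weight t s) =
      njoin_pt (n + m) (fibre (kprod E F) (map_prod p q) (x0, y0)) (f, shuffle_weight t s)"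
    by (simp only: psi_map_eq_fjoin_shuffle fibre_kprod [OF pq])
  then have "fjoin_incl (n + m) (kprod E F) (map_prod p q) (fjoin_shuffle n m ?A to_point ?B to_point c d) =
      fjoin_pt (n + m) (kprod E F) (map_prod p q) (f, shuffle_weight t s)"
    unfolding ce(3) de(3) f(3) using fjoin_incl_pt [OF f' shuffle_weight_simplex [OF ce(2) de(2)]] by simp
  also have "\<dots> = fjoin_shuffle n m E p F q (fjoin_pt n E p (a, t)) (fjoin_pt m F q (b, s))"
    by (rule fjoin_shuffle_pt [symmetric, OF fibre_subset_fibred_product(1) [OF ce(1)] ce(2)
          fibre_subset_fibred_product(1) [OF de(1)] de(2) fibre_subset_fibred_product(1) [OF f'] f(2)])
  finally show ?thesis
    by (simp add: ce(3) de(3) fjoin_incl_pt [OF ce(1,2)] fjoin_incl_pt [OF de(1,2)])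
qed

text \<open>The only grid point on the last antidiagonal is (n + 1, m + 1), and an overlap there
  requires both last weights to be nonzero.\<close>

lemma shuffle_weight_top:
  assumes "t \<in> standard_simplex (Suc n)" "s \<in> standard_simplex (Suc m)" "t (Suc n) = 0 \<or> s (Suc m) = 0"
  shows "shuffle_weight t s (Suc (Suc (n + m))) = 0"
proof (rule ccontr)
  assume "shuffle_weight t s (Suc (Suc (n + m))) \<noteq> 0"
  then obtain i j where ij: "i \<le> Suc n" "j \<le> Suc m" "Suc (Suc (n + m)) = i + j" "t i \<noteq> 0" "s j \<noteq> 0"
    using shuffle_weight_nonzero [OF assms(1,2)] by metis
  then have "i = Suc n" "j = Suc m" by auto
  with ij assms(3) show False by simp
qed

text \<open>A coordinate of weight 0 creates no overlap, so the weights of the two shuffles coincide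
  and a coordinate vector of the longer one restricts to one for the shorter.\<close>

lemma fjoin_shuffle_raise_left:
  assumes a: "a \<in> topspace (fibred_product n E p)" and a': "a' \<in> topspace (fibred_product (Suc n) E p)"
    and aa': "\<And>i. t i \<noteq> 0 \<Longrightarrow> a' i = a i" and t: "t \<in> standard_simplex n"
    and d: "d \<in> topspace (fjoin m F q)"
  shows "fjoin_shuffle n m E p F q (fjoin_pt n E p (a, t)) d =
    fjoin_drop (n + m) (kprod E F) (map_prod p q) (fjoin_shuffle (Suc n) m E p F q (fjoin_pt (Suc n) E p (a', t)) d)"
proof -
  obtain b s where de: "b \<in> topspace (fibred_product m F q)" "s \<in> standard_simplex m" "d = fjoin_pt m F q (b, s)"
    using d by (rule fjoin_cases)
  note t' = standard_simplex_SucI [OF t]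
  obtain f where f: "f \<in> topspace (fibred_product (Suc n + m) (kprod E F) (map_prod p q))"
    "\<And>i j. overlap t s i j \<noteq> 0 \<Longrightarrow> f (i + j) = (a' i, b j)"
    "fjoin_shuffle (Suc n) m E p F q (fjoin_pt (Suc n) E p (a', t)) (fjoin_pt m F q (b, s)) =
       fjoin_pt (Suc n + m) (kprod E F) (map_prod p q) (f, shuffle_weight t s)"
    using fjoin_shuffle_obtain [OF a' t'(1) de(1,2)] by metis
  have f1: "f \<in> topspace (fibred_product (Suc (n + m)) (kprod E F) (map_prod p q))" using f(1) by simp
  note w = shuffle_weight_simplex [OF t de(2)]
  have "fjoin_drop (n + m) (kprod E F) (map_prod p q) (fjoin_shuffle (Suc n) m E p F q (fjoin_pt (Suc n) E p (a', t)) d) =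
      fjoin_pt (n + m) (kprod E F) (map_prod p q) (restrict f {..n + m}, shuffle_weight t s)"
    unfolding de(3) f(3) add_Suc by (rule fjoin_drop_pt [OF f1 standard_simplex_SucI [OF w]])
  also have "\<dots> = fjoin_shuffle n m E p F q (fjoin_pt n E p (a, t)) d"
    unfolding de(3)
  proof (rule fjoin_shuffle_pt [symmetric, OF a t de(1,2) restrict_fibred_product [OF f1]])
    fix i j assume ij: "overlap t s i j \<noteq> 0"
    then have nz: "t i \<noteq> 0" "s j \<noteq> 0" by (rule overlap_nonzero)+
    then have "i \<le> n" "j \<le> m" using t de(2) by (auto simp: standard_simplex_def not_le [symmetric])
    then show "restrict f {..n + m} (i + j) = (a i, b j)"
      using f(2) [OF ij] aa' nz by simp
  qed
  finally show ?thesis ..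
qed

lemma fjoin_shuffle_raise_right:
  assumes b: "b \<in> topspace (fibred_product m F q)" and b': "b' \<in> topspace (fibred_product (Suc m) F q)"
    and bb': "\<And>i. s i \<noteq> 0 \<Longrightarrow> b' i = b i" and s: "s \<in> standard_simplex m"
    and c: "c \<in> topspace (fjoin n E p)"
  shows "fjoin_shuffle n m E p F q c (fjoin_pt m F q (b, s)) =
    fjoin_drop (n + m) (kprod E F) (map_prod p q) (fjoin_shuffle n (Suc m) E p F q c (fjoin_pt (Suc m) F q (b', s)))"
proof -
  obtain a t where ce: "a \<in> topspace (fibred_product n E p)" "t \<in> standard_simplex n" "c = fjoin_pt n E p (a, t)"
    using c by (rule fjoin_cases)
  note s' = standard_simplex_SucI [OF s]
  obtain f where f: "f \<in> topspace (fibred_product (n + Suc m) (kprod E F) (map_prod p q))"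
    "\<And>i j. overlap t s i j \<noteq> 0 \<Longrightarrow> f (i + j) = (a i, b' j)"
    "fjoin_shuffle n (Suc m) E p F q (fjoin_pt n E p (a, t)) (fjoin_pt (Suc m) F q (b', s)) =
       fjoin_pt (n + Suc m) (kprod E F) (map_prod p q) (f, shuffle_weight t s)"
    using fjoin_shuffle_obtain [OF ce(1,2) b' s'(1)] by metis
  have f1: "f \<in> topspace (fibred_product (Suc (n + m)) (kprod E F) (map_prod p q))" using f(1) by simp
  note w = shuffle_weight_simplex [OF ce(2) s]
  have "fjoin_drop (n + m) (kprod E F) (map_prod p q) (fjoin_shuffle n (Suc m) E p F q c (fjoin_pt (Suc m) F q (b', s))) =
      fjoin_pt (n + m) (kprod E F) (map_prod p q) (restrict f {..n + m}, shuffle_weight t s)"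
    unfolding ce(3) f(3) add_Suc_right by (rule fjoin_drop_pt [OF f1 standard_simplex_SucI [OF w]])
  also have "\<dots> = fjoin_shuffle n m E p F q c (fjoin_pt m F q (b, s))"
    unfolding ce(3)
  proof (rule fjoin_shuffle_pt [symmetric, OF ce(1,2) b s restrict_fibred_product [OF f1]])
    fix i j assume ij: "overlap t s i j \<noteq> 0"
    then have nz: "t i \<noteq> 0" "s j \<noteq> 0" by (rule overlap_nonzero)+
    then have "i \<le> n" "j \<le> m" using s ce(2) by (auto simp: standard_simplex_def not_le [symmetric])
    then show "restrict f {..n + m} (i + j) = (a i, b j)"
      using f(2) [OF ij] bb' nz by simp
  qed
  finally show ?thesis ..
qed

section \<open>Cones and cofibres\<close>

lemma quotient_map_cone_pt:
  assumes "k_space S"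
  shows "quotient_map (prod_topology S unit_interval) (cone S) (\<lambda>x. cone_pt S (fst x) (snd x))"
proof -
  have "kprod S unit_interval = prod_topology S unit_interval"
    by (simp add: kprod_eq_prod assms compact_unit_interval Hausdorff_unit_interval)
  then show ?thesis
    using quotient_map_qclass [of "kprod S unit_interval" "collapse_rel (topspace S \<times> {1})"]
    by (simp add: cone_def cone_pt_def)
qed

lemma topspace_cone: "topspace (cone S) = (\<lambda>x. cone_pt S (fst x) (snd x)) ` (topspace S \<times> {0..1})"
  by (simp add: cone_def topspace_quotient_topology cone_pt_def)

lemma cone_pt_mem: "s \<in> topspace S \<Longrightarrow> 0 \<le> u \<Longrightarrow> u \<le> 1 \<Longrightarrow> cone_pt S s u \<in> topspace (cone S)"
  unfolding topspace_cone by force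

lemma cone_cases:
  assumes "c \<in> topspace (cone S)"
  obtains s u where "s \<in> topspace S" "0 \<le> u" "u \<le> 1" "c = cone_pt S s u"
  using assms unfolding topspace_cone by auto

lemma cone_pt_eq_iff:
  assumes "s \<in> topspace S" "0 \<le> u" "u \<le> 1" "s' \<in> topspace S" "0 \<le> u'" "u' \<le> 1"
  shows "cone_pt S s u = cone_pt S s' u' \<longleftrightarrow> u = u' \<and> (u = 1 \<or> s = s')"
  unfolding cone_pt_def using assms by (subst qclass_collapse_eq) auto

lemma rep_cone_pt:
  assumes "s \<in> topspace S" "0 \<le> u" "u \<le> 1"
  obtains s' where "rep (cone_pt S s u) = (s', u)" "s' \<in> topspace S" "u \<noteq> 1 \<Longrightarrow> s' = s"
proof -
  have "(s, u) \<in> cone_pt S s u"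
    using assms by (simp add: cone_pt_def qclass_def collapse_rel_def)
  then have "rep (cone_pt S s u) \<in> cone_pt S s u"
    unfolding rep_def by (rule someI)
  then show ?thesis
    using that by (cases "rep (cone_pt S s u)") (auto simp: cone_pt_def qclass_def collapse_rel_def)
qed

lemma topspace_cone_base: "topspace (cone_base S) = (\<lambda>s. cone_pt S s 0) ` topspace S"
  by (auto simp: cone_base_def cone_pt_mem)

lemma cone_map_pt:
  assumes "s \<in> topspace S" "0 \<le> u" "u \<le> 1" "f \<in> topspace S \<rightarrow> topspace B"
  shows "cone_map B f (cone_pt S s u) = cone_pt B (f s) u"
proof -
  obtain s' where "rep (cone_pt S s u) = (s', u)" "s' \<in> topspace S" "u \<noteq> 1 \<Longrightarrow> s' = s"
    using rep_cone_pt [OF assms(1-3)] by metis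
  then show ?thesis
    using assms by (auto simp: cone_map_def cone_pt_eq_iff Pi_iff)
qed

text \<open>The parameter r is carried along so that one statement serves homotopies, and maps too
  by freezing r.\<close>

lemma cone_family_lift:
  assumes k: "k_space S"
    and g: "continuous_map (prod_topology unit_interval (prod_topology S unit_interval)) Z g"
    and g1: "\<And>r s s'. \<lbrakk>0 \<le> r; r \<le> 1; s \<in> topspace S; s' \<in> topspace S\<rbrakk> \<Longrightarrow> g (r, (s, 1)) = g (r, (s', 1))"
  obtains G where "continuous_map (prod_topology unit_interval (cone S)) Z G"
    "\<And>r s u. \<lbrakk>0 \<le> r; r \<le> 1; s \<in> topspace S; 0 \<le> u; u \<le> 1\<rbrakk> \<Longrightarrow> G (r, cone_pt S s u) = g (r, (s, u))"
proof -
  let ?Q = "prod_topology unit_interval (prod_topology S unit_interval)"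
  obtain G where G: "continuous_map (prod_topology unit_interval (cone S)) Z G"
    "\<And>x. x \<in> topspace ?Q \<Longrightarrow> G (case x of (r, y) \<Rightarrow> (r, cone_pt S (fst y) (snd y))) = g x"
  proof (rule quotient_map_lift_exists [OF quotient_map_interval_prod [OF quotient_map_cone_pt [OF k]] g])
    fix x y assume "x \<in> topspace ?Q" "y \<in> topspace ?Q"
      "(case x of (r, y) \<Rightarrow> (r, cone_pt S (fst y) (snd y))) = (case y of (r, y) \<Rightarrow> (r, cone_pt S (fst y) (snd y)))"
    then obtain r s u s' where "x = (r, (s, u))" "y = (r, (s', u))" "0 \<le> r" "r \<le> 1"
        "s \<in> topspace S" "s' \<in> topspace S" "u = 1 \<or> s = s'"
      by (cases x; cases y) (auto simp: cone_pt_eq_iff)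
    then show "g x = g y" using g1 by metis
  qed blast
  show ?thesis
  proof
    show "G (r, cone_pt S s u) = g (r, (s, u))"
      if "0 \<le> r" "r \<le> 1" "s \<in> topspace S" "0 \<le> u" "u \<le> 1" for r s u
      using G(2) [of "(r, (s, u))"] that by simp
  qed (rule G(1))
qed

section \<open>The union of the two cylinders on \<open>S\<close> and \<open>T\<close>\<close>

lemma cjoin_cases:
  assumes "x \<in> topspace (cjoin S T)"
  obtains s u t v where "s \<in> topspace S" "0 \<le> u" "u \<le> 1" "t \<in> topspace T" "0 \<le> v" "v \<le> 1"
    "u = 0 \<or> v = 0" "x = (cone_pt S s u, cone_pt T t v)"
proof -
  obtain c d where x: "x = (c, d)" by (cases x)
  then consider "c \<in> topspace (cone S)" "d \<in> topspace (cone_base T)"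
    | "c \<in> topspace (cone_base S)" "d \<in> topspace (cone T)"
    using assms by (auto simp: cjoin_def topspace_union_topology)
  then show ?thesis
  proof cases
    case 1
    then obtain s u t where "s \<in> topspace S" "0 \<le> u" "u \<le> 1" "c = cone_pt S s u" "t \<in> topspace T" "d = cone_pt T t 0"
      by (auto simp: topspace_cone_base elim: cone_cases)
    then show ?thesis using that [of s u t 0] x by simp
  next
    case 2
    then obtain s t v where "s \<in> topspace S" "c = cone_pt S s 0" "t \<in> topspace T" "0 \<le> v" "v \<le> 1" "d = cone_pt T t v"
      by (auto simp: topspace_cone_base elim: cone_cases)
    then show ?thesis using that [of s 0 t v] x by simp
  qed
qed

lemma cone_pt_in_cjoin:
  assumes "s \<in> topspace S" "t \<in> topspace T"
  shows "(cone_pt S s 0, cone_pt T t 0) \<in> topspace (cjoin S T)"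
  using assms by (auto simp: cjoin_def topspace_union_topology topspace_cone_base cone_pt_mem)

lemma continuous_map_kprod_mono:
  assumes "continuous_map P P' id" "continuous_map Q Q' id"
  shows "continuous_map (kprod P Q) (kprod P' Q') id"
proof -
  have "continuous_map (kprod P Q) (kprod P' Q') (\<lambda>x. (fst x, snd x))"
    using continuous_map_comp [OF assms(1) continuous_map_kprod_fst] continuous_map_comp [OF assms(2) continuous_map_kprod_snd]
    by (intro continuous_map_into_kprod) auto
  then show ?thesis by (simp add: id_def)
qed

lemma continuous_map_cjoin: "continuous_map (cjoin S T) (kprod (cone S) (cone T)) id"
  unfolding cjoin_def cone_base_def
  by (intro continuous_map_from_union_topology continuous_map_kprod_mono)
     (auto simp: continuous_map_from_subtopology)

section \<open>Homotopies on a mapping cone\<close>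

lemma openin_tube:
  assumes W: "openin (prod_topology X Y) W" and C: "compactin X C"
  shows "openin Y {y \<in> topspace Y. C \<times> {y} \<subseteq> W}"
proof (subst openin_subopen, intro ballI)
  fix y assume y: "y \<in> {y \<in> topspace Y. C \<times> {y} \<subseteq> W}"
  then obtain U V where "openin X U" "openin Y V" "C \<subseteq> U" "y \<in> V" "U \<times> V \<subseteq> W"
    using tube_lemma_left [OF W C, of y] by blast
  then show "\<exists>T. openin Y T \<and> y \<in> T \<and> T \<subseteq> {y \<in> topspace Y. C \<times> {y} \<subseteq> W}"
    by (intro exI[of _ V]) (auto dest: openin_subset)
qed

lemma mapping_cone_continuous:
  assumes mc: "mapping_cone X K S \<alpha> \<alpha>'"
  shows "continuous_map K X id" "continuous_map (cone S) X \<alpha>'"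
proof -
  have op: "openin X U \<Longrightarrow> openin K (U \<inter> topspace K) \<and> openin (cone S) {c \<in> topspace (cone S). \<alpha>' c \<in> U}" for U
    using mc openin_subset [of X U] unfolding mapping_cone_def by blast
  have X: "topspace X = topspace K \<union> \<alpha>' ` topspace (cone S)"
    using mc by (simp add: mapping_cone_def)
  show "continuous_map K X id"
    using op X by (auto simp: continuous_map_def Int_def conj_commute)
  show "continuous_map (cone S) X \<alpha>'"
    using op X by (auto simp: continuous_map_def)
qed

text \<open>The interval is locally compact, so multiplying by it preserves the gluing of K and the
  cone. The argument is Whitehead's, carried out on the open sets that \<open>mapping_cone\<close>
  describes.\<close>

lemma mapping_cone_openin_prod:
  assumes mc: "mapping_cone X K S \<alpha> \<alpha>'"
    and W: "W \<subseteq> {0..1} \<times> topspace X"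
    and WK: "openin (prod_topology unit_interval K) {x \<in> {0..1} \<times> topspace K. x \<in> W}"
    and WC: "openin (prod_topology unit_interval (cone S)) {x \<in> {0..1} \<times> topspace (cone S). (fst x, \<alpha>' (snd x)) \<in> W}"
  shows "openin (prod_topology unit_interval X) W"
proof (subst openin_subopen, intro ballI)
  fix z assume z: "z \<in> W"
  obtain r x where zr: "z = (r, x)" by (cases z)
  have rx: "0 \<le> r" "r \<le> 1" "x \<in> topspace X" using z W by (auto simp: zr)
  let ?WK = "{x \<in> {0..1} \<times> topspace K. x \<in> W}"
  let ?WC = "{x \<in> {0..1} \<times> topspace (cone S). (fst x, \<alpha>' (snd x)) \<in> W}"
  have X: "topspace X = topspace K \<union> \<alpha>' ` topspace (cone S)"
    using mc by (simp add: mapping_cone_def)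
  \<comment> \<open>The slice through x is open because it is a slice of the open set over K or over
    the cone, whichever contains x.\<close>
  have "openin unit_interval {r \<in> {0..1}. (r, x) \<in> W}"
  proof (cases "x \<in> topspace K")
    case True
    then have "continuous_map unit_interval (prod_topology unit_interval K) (\<lambda>r. (r, x))"
      by (intro continuous_map_pairedI) auto
    from openin_continuous_map_preimage [OF this WK] show ?thesis
      by (rule back_subst [of "openin unit_interval"]) (use True in auto)
  next
    case False
    then obtain c where c: "c \<in> topspace (cone S)" "x = \<alpha>' c" using rx X by auto
    then have "continuous_map unit_interval (prod_topology unit_interval (cone S)) (\<lambda>r. (r, c))"
      by (intro continuous_map_pairedI) auto
    from openin_continuous_map_preimage [OF this WC] show ?thesis
      by (rule back_subst [of "openin unit_interval"]) (use c in auto)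
  qed
  then obtain e where e: "0 < e" "\<And>r'. \<lbrakk>r' \<in> {0..1}; dist r' r \<le> e\<rbrakk> \<Longrightarrow> (r', x) \<in> W"
  proof -
    from \<open>openin unit_interval {r \<in> {0..1}. (r, x) \<in> W}\<close>
    obtain T where T: "open T" "{r \<in> {0..1}. (r, x) \<in> W} = {0..1} \<inter> T"
      unfolding openin_open by blast
    then have "r \<in> T" using z rx by (auto simp: zr)
    then obtain e where "0 < e" "cball r e \<subseteq> T" using T(1) open_contains_cball by blast
    moreover have "(r', x) \<in> W" if "r' \<in> {0..1}" "dist r' r \<le> e" for r'
    proof -
      have "r' \<in> T" using that \<open>cball r e \<subseteq> T\<close> by (auto simp: dist_commute)
      then have "r' \<in> {r \<in> {0..1}. (r, x) \<in> W}" using that(1) T(2) by blast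
      then show ?thesis by blast
    qed
    ultimately show ?thesis using that by blast
  qed
  define C where "C = {0..1} \<inter> cball r e"
  have "compact C" unfolding C_def by (intro compact_Int) auto
  then have C: "compactin unit_interval C"
    by (simp add: compactin_subtopology C_def)
  \<comment> \<open>With C a compact neighbourhood of r in the slice, the tube lemma makes V open on
    K and on the cone separately, hence open in X.\<close>
  define V where "V = {y \<in> topspace X. C \<times> {y} \<subseteq> W}"
  have CI: "C \<subseteq> {0..1}" by (simp add: C_def)
  have "V \<inter> topspace K = {y \<in> topspace K. C \<times> {y} \<subseteq> ?WK}"
    unfolding V_def X using CI by blast
  then have "openin K (V \<inter> topspace K)"
    using openin_tube [OF WK C] by (simp only:)
  moreover have "{c \<in> topspace (cone S). \<alpha>' c \<in> V} = {c \<in> topspace (cone S). C \<times> {c} \<subseteq> ?WC}"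
    unfolding V_def X using CI by (auto simp: subset_iff)
  then have "openin (cone S) {c \<in> topspace (cone S). \<alpha>' c \<in> V}"
    using openin_tube [OF WC C] by (simp only:)
  moreover have all: "\<forall>U \<subseteq> topspace X. openin X U \<longleftrightarrow>
      openin K (U \<inter> topspace K) \<and> openin (cone S) {c \<in> topspace (cone S). \<alpha>' c \<in> U}"
    using mc unfolding mapping_cone_def by (elim conjE)
  moreover have VX: "V \<subseteq> topspace X"
    by (auto simp: V_def)
  ultimately have V: "openin X V"
    using all [THEN spec, THEN mp, OF VX] by simp
  have "openin unit_interval ({0..1} \<inter> ball r e)"
    by (auto simp: openin_open)
  then have "openin (prod_topology unit_interval X) (({0..1} \<inter> ball r e) \<times> V)"
    using V by (simp add: openin_prod_Times_iff)
  moreover have "z \<in> ({0..1} \<inter> ball r e) \<times> V"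
    using e rx by (auto simp: zr V_def C_def dist_commute)
  moreover have "({0..1} \<inter> ball r e) \<times> V \<subseteq> W"
    by (auto simp: V_def C_def)
  ultimately show "\<exists>T. openin (prod_topology unit_interval X) T \<and> z \<in> T \<and> T \<subseteq> W"
    by blast
qed

lemma mapping_cone_family_lift:
  assumes mc: "mapping_cone X K S \<alpha> \<alpha>'"
    and f: "continuous_map (prod_topology unit_interval K) Z f"
    and g: "continuous_map (prod_topology unit_interval (cone S)) Z g"
    and fg: "\<And>r s. \<lbrakk>0 \<le> r; r \<le> 1; s \<in> topspace S\<rbrakk> \<Longrightarrow> g (r, cone_pt S s 0) = f (r, \<alpha> s)"
  obtains F where "continuous_map (prod_topology unit_interval X) Z F"
    "\<And>r x. \<lbrakk>0 \<le> r; r \<le> 1; x \<in> topspace K\<rbrakk> \<Longrightarrow> F (r, x) = f (r, x)"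
    "\<And>r c. \<lbrakk>0 \<le> r; r \<le> 1; c \<in> topspace (cone S)\<rbrakk> \<Longrightarrow> F (r, \<alpha>' c) = g (r, c)"
proof -
  let ?C = "topspace (cone S) - topspace (cone_base S)"
  have X: "topspace X = topspace K \<union> \<alpha>' ` topspace (cone S)"
    and base: "\<And>s. s \<in> topspace S \<Longrightarrow> \<alpha>' (cone_pt S s 0) = \<alpha> s"
    and inj: "inj_on \<alpha>' ?C" and disj: "\<alpha>' ` ?C \<inter> topspace K = {}"
    using mc by (auto simp: mapping_cone_def)
  \<comment> \<open>Off K the canonical map is injective on the open cone; base points of the cone
    land in K, where f and g agree.\<close>
  define F where "F y = (if snd y \<in> topspace K then f y else g (fst y, inv_into ?C \<alpha>' (snd y)))" for y
  have FK: "F (r, x) = f (r, x)" if "x \<in> topspace K" for r x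
    using that by (simp add: F_def)
  have \<alpha>K: "\<alpha> s \<in> topspace K" if "s \<in> topspace S" for s
    using mc that by (auto simp: mapping_cone_def continuous_map_def)
  have FC: "F (r, \<alpha>' c) = g (r, c)" if "0 \<le> r" "r \<le> 1" "c \<in> topspace (cone S)" for r c
  proof (cases "c \<in> topspace (cone_base S)")
    case True
    then obtain s where s: "s \<in> topspace S" "c = cone_pt S s 0"
      by (auto simp: topspace_cone_base)
    then show ?thesis
      using fg [OF that(1,2) s(1)] \<alpha>K by (simp add: base FK)
  next
    case False
    then have "c \<in> ?C" using that by simp
    then show ?thesis
      using disj inj by (auto simp: F_def inv_into_f_f)
  qed
  have "continuous_map (prod_topology unit_interval X) Z F"
    unfolding continuous_map_def
  proof (intro conjI allI impI funcsetI)
    fix y assume "y \<in> topspace (prod_topology unit_interval X)"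
    then obtain r x where y: "y = (r, x)" "0 \<le> r" "r \<le> 1" "x \<in> topspace X" by auto
    then consider "x \<in> topspace K" | c where "c \<in> topspace (cone S)" "x = \<alpha>' c" using X by auto
    then show "F y \<in> topspace Z"
    proof cases
      case 1
      then have "(r, x) \<in> topspace (prod_topology unit_interval K)" using y by simp
      with f have "f (r, x) \<in> topspace Z" unfolding continuous_map_def by blast
      then show ?thesis using FK 1 y by simp
    next
      case 2
      then have "(r, c) \<in> topspace (prod_topology unit_interval (cone S))" using y by simp
      with g have "g (r, c) \<in> topspace Z" unfolding continuous_map_def by blast
      then show ?thesis using FC 2 y by simp
    qed
  next
    fix U assume U: "openin Z U"
    show "openin (prod_topology unit_interval X) {y \<in> topspace (prod_topology unit_interval X). F y \<in> U}"
    proof (rule mapping_cone_openin_prod [OF mc])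
      have "{x \<in> {0..1} \<times> topspace K. x \<in> {y \<in> topspace (prod_topology unit_interval X). F y \<in> U}} =
          {x \<in> topspace (prod_topology unit_interval K). f x \<in> U}"
        using X by (auto simp: FK)
      then show "openin (prod_topology unit_interval K)
          {x \<in> {0..1} \<times> topspace K. x \<in> {y \<in> topspace (prod_topology unit_interval X). F y \<in> U}}"
        using openin_continuous_map_preimage [OF f U] by simp
      have "{x \<in> {0..1} \<times> topspace (cone S). (fst x, \<alpha>' (snd x)) \<in> {y \<in> topspace (prod_topology unit_interval X). F y \<in> U}} =
          {x \<in> topspace (prod_topology unit_interval (cone S)). g x \<in> U}"
        using X by (auto simp: FC)
      then show "openin (prod_topology unit_interval (cone S))
          {x \<in> {0..1} \<times> topspace (cone S). (fst x, \<alpha>' (snd x)) \<in> {y \<in> topspace (prod_topology unit_interval X). F y \<in> U}}"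
        using openin_continuous_map_preimage [OF g U] by simp
    qed auto
  qed
  then show ?thesis using that FK FC by blast
qed

section \<open>The map \<open>Phi_map\<close> through the shuffle of enlarged joins\<close>

text \<open>At u = 1 the whole weight sits on the added coordinate a0, so the extension is well
  defined on the cone.\<close>

lemma join_extend_apex:
  assumes "c \<in> topspace (njoin n A)" "d \<in> topspace (njoin n A)" "a0 \<in> topspace A"
  shows "join_extend n A a0 c 1 = join_extend n A a0 d 1"
proof -
  obtain a t where c: "a \<in> topspace (fibred_product n A to_point)" "t \<in> standard_simplex n" "c = njoin_pt n A (a, t)"
    using assms(1) by (rule fjoin_cases)
  obtain b s where d: "b \<in> topspace (fibred_product n A to_point)" "s \<in> standard_simplex n" "d = njoin_pt n A (b, s)"
    using assms(2) by (rule fjoin_cases)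
  have 1: "(\<lambda>i. if i = Suc n then 1 else (1 - 1) * w i) = (\<lambda>i. if i = Suc n then 1 else 0 :: real)" for w
    by auto
  have 2: "(\<lambda>i. if i = Suc n then 1 else 0 :: real) \<in> standard_simplex (Suc n)" by simp
  show ?thesis
    unfolding c(3) d(3) join_extend_pt [OF c(1,2) assms(3) zero_le_one order_refl]
      join_extend_pt [OF d(1,2) assms(3) zero_le_one order_refl] 1
    by (subst fjoin_pt_eq_iff [OF extend_fibred_product [OF c(1) assms(3)] 2
          extend_fibred_product [OF d(1) assms(3)] 2]) auto
qed

lemma join_extend_zero:
  assumes a: "a \<in> topspace (fibred_product n A to_point)" and t: "t \<in> standard_simplex n" and a0: "a0 \<in> topspace A"
  shows "join_extend n A a0 (njoin_pt n A (a, t)) 0 = njoin_pt (Suc n) A (a(Suc n := a0), t)"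
proof -
  have "(\<lambda>i. if i = Suc n then 0 else (1 - 0) * t i) = t"
    using standard_simplex_SucI(2) [OF t] by auto
  then show ?thesis using join_extend_pt [OF a t a0, of 0] by simp
qed

text \<open>Both branches of \<open>Phi_map\<close> are the shuffle map of \<open>J\<^sup>n\<^sup>+\<^sup>1(A) \<times> J\<^sup>m\<^sup>+\<^sup>1(B)\<close>: where one of the last
  weights vanishes, so does the last weight of the shuffle, and the last coordinate can be dropped.\<close>

lemma Phi_map_cone_pt:
  assumes x: "x \<in> topspace (njoin n A)" and y: "y \<in> topspace (njoin m B)"
    and a0: "a0 \<in> topspace A" and b0: "b0 \<in> topspace B"
    and u: "0 \<le> u" "u \<le> 1" and v: "0 \<le> v" "v \<le> 1" and uv: "u = 0 \<or> v = 0"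
  shows "Phi_map n m A a0 B b0 (cone_pt (njoin n A) x u, cone_pt (njoin m B) y v) =
    fjoin_drop (Suc (n + m)) (kprod A B) (map_prod to_point to_point)
      (fjoin_shuffle (Suc n) (Suc m) A to_point B to_point (join_extend n A a0 x u) (join_extend m B b0 y v))"
proof -
  \<comment> \<open>The representative of the cone point may have another first component, but its
    extension is the same there.\<close>
  obtain x' where x': "rep (cone_pt (njoin n A) x u) = (x', u)" "x' \<in> topspace (njoin n A)" "u \<noteq> 1 \<Longrightarrow> x' = x"
    using rep_cone_pt [OF x u] by metis
  obtain y' where y': "rep (cone_pt (njoin m B) y v) = (y', v)" "y' \<in> topspace (njoin m B)" "v \<noteq> 1 \<Longrightarrow> y' = y"
    using rep_cone_pt [OF y v] by metis
  have ex: "join_extend n A a0 x' u = join_extend n A a0 x u"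
    using x'(2,3) join_extend_apex [OF x'(2) x a0] by (cases "u = 1") auto
  have ey: "join_extend m B b0 y' v = join_extend m B b0 y v"
    using y'(2,3) join_extend_apex [OF y'(2) y b0] by (cases "v = 1") auto
  obtain a t where xe: "a \<in> topspace (fibred_product n A to_point)" "t \<in> standard_simplex n" "x = njoin_pt n A (a, t)"
    using x by (rule fjoin_cases)
  obtain b s where ye: "b \<in> topspace (fibred_product m B to_point)" "s \<in> standard_simplex m" "y = njoin_pt m B (b, s)"
    using y by (rule fjoin_cases)
  have tz: "t i \<noteq> 0 \<Longrightarrow> (a(Suc n := a0)) i = a i" and sz: "s i \<noteq> 0 \<Longrightarrow> (b(Suc m := b0)) i = b i" for i
    using standard_simplex_SucI(2) [OF xe(2)] standard_simplex_SucI(2) [OF ye(2)] by auto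
  note ea = extend_fibred_product [OF xe(1) a0, simplified] and eb = extend_fibred_product [OF ye(1) b0, simplified]
  have Phi: "Phi_map n m A a0 B b0 (cone_pt (njoin n A) x u, cone_pt (njoin m B) y v) =
      (if u = 0 then psi_map n (Suc m) A B x' (join_extend m B b0 y v)
       else psi_map (Suc n) m A B (join_extend n A a0 x u) y')"
    by (simp add: Phi_map_def x'(1) y'(1) ex ey)
  show ?thesis
  proof (cases "u = 0")
    case True
    then have "Phi_map n m A a0 B b0 (cone_pt (njoin n A) x u, cone_pt (njoin m B) y v) =
        fjoin_shuffle n (Suc m) A to_point B to_point (njoin_pt n A (a, t)) (join_extend m B b0 y v)"
      unfolding Phi psi_map_eq_fjoin_shuffle(1) using x'(3) xe(3) by simp
    also have "\<dots> = fjoin_drop (n + Suc m) (kprod A B) (map_prod to_point to_point)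
        (fjoin_shuffle (Suc n) (Suc m) A to_point B to_point (njoin_pt (Suc n) A (a(Suc n := a0), t)) (join_extend m B b0 y v))"
      by (rule fjoin_shuffle_raise_left [OF xe(1) ea tz xe(2) join_extend_mem(1) [OF y b0 v]])
    also have "njoin_pt (Suc n) A (a(Suc n := a0), t) = join_extend n A a0 x u"
      using join_extend_zero [OF xe(1,2) a0] True xe(3) by simp
    finally show ?thesis by simp
  next
    case False
    with uv have v0: "v = 0" by simp
    then have "Phi_map n m A a0 B b0 (cone_pt (njoin n A) x u, cone_pt (njoin m B) y v) =
        fjoin_shuffle (Suc n) m A to_point B to_point (join_extend n A a0 x u) (njoin_pt m B (b, s))"
      unfolding Phi psi_map_eq_fjoin_shuffle(1) using y'(3) ye(3) False by simp
    also have "\<dots> = fjoin_drop (Suc n + m) (kprod A B) (map_prod to_point to_point)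
        (fjoin_shuffle (Suc n) (Suc m) A to_point B to_point (join_extend n A a0 x u) (njoin_pt (Suc m) B (b(Suc m := b0), s)))"
      by (rule fjoin_shuffle_raise_right [OF ye(1) eb sz ye(2) join_extend_mem(1) [OF x a0 u]])
    also have "njoin_pt (Suc m) B (b(Suc m := b0), s) = join_extend m B b0 y v"
      using join_extend_zero [OF ye(1,2) b0] v0 ye(3) by simp
    finally show ?thesis by simp
  qed
qed

section \<open>Hopf invariants of a fibration and of a product\<close>

lemma famcat_map: "(\<lambda>z. k (famcat f g z)) = famcat (\<lambda>z. k (f z)) (\<lambda>z. k (g z))"
  by (auto simp: famcat_def)

lemma path_family_map:
  "path_family S X f \<Longrightarrow> continuous_map X Y k \<Longrightarrow> path_family S Y (\<lambda>z. k (f z))"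
  unfolding path_family_def by (rule continuous_map_comp)

lemma path_family_subtopology: "path_family S X f \<Longrightarrow> path_family (subtopology S A) X f"
  unfolding path_family_def
  by (metis continuous_map_from_subtopology prod_topology_subtopology(2))

definition fjoin_vertex :: "nat \<Rightarrow> 'e topology \<Rightarrow> ('e \<Rightarrow> 'x) \<Rightarrow> 'e \<Rightarrow> 'e fjoin_point" where
  "fjoin_vertex n E p e = fjoin_pt n E p (\<lambda>i\<in>{..n}. e, \<lambda>i. if i = 0 then 1 else 0)"

text \<open>The edge from e in position 0 to e0 in position 1. At v = 1 it no longer depends on e;
  position 1 exists because n is at least 1.\<close>

definition fjoin_edge :: "nat \<Rightarrow> 'e topology \<Rightarrow> ('e \<Rightarrow> 'x) \<Rightarrow> 'e \<Rightarrow> 'e \<Rightarrow> real \<Rightarrow> 'e fjoin_point" where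
  "fjoin_edge n E p e0 e v =
     fjoin_pt n E p (\<lambda>i\<in>{..n}. if i = 0 then e else e0, \<lambda>i. if i = 0 then 1 - v else if i = 1 then v else 0)"

lemma edge_simplex:
  assumes "1 \<le> n" "0 \<le> v" "v \<le> 1"
  shows "(\<lambda>i. if i = 0 then 1 - v else if i = 1 then v else 0) \<in> standard_simplex n"
proof -
  have "(\<Sum>i\<le>n. if i = 0 then 1 - v else if i = 1 then v else 0) =
      (\<Sum>i\<in>{0::nat, 1}. if i = 0 then 1 - v else if i = 1 then v else 0)"
    by (rule sum.mono_neutral_right) (use assms in auto)
  then show ?thesis using assms by (auto simp: standard_simplex_def)
qed

lemma fjoin_vertex_mem:
  assumes "e \<in> topspace E"
  shows "(\<lambda>i\<in>{..n}. e) \<in> topspace (fibred_product n E p)"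
  by (rule fibred_productI) (use assms in auto)

lemma fjoin_edge_mem:
  assumes "e \<in> topspace E" "e0 \<in> topspace E" "p e = p e0"
  shows "(\<lambda>i\<in>{..n}. if i = 0 then e else e0) \<in> topspace (fibred_product n E p)"
  by (rule fibred_productI) (use assms in auto)

lemma fjoin_vertex_proj: "e \<in> topspace E \<Longrightarrow> fjoin_proj p (fjoin_vertex n E p e) = p e"
  unfolding fjoin_vertex_def by (subst fjoin_proj_pt [where i = 0]) (auto intro: fjoin_vertex_mem)

lemma fjoin_edge_props:
  assumes "1 \<le> n" "e0 \<in> topspace E" "e \<in> topspace E" "p e = p e0"
  shows "fjoin_edge n E p e0 e 0 = fjoin_vertex n E p e"
    "e' \<in> topspace E \<Longrightarrow> p e' = p e0 \<Longrightarrow> fjoin_edge n E p e0 e 1 = fjoin_edge n E p e0 e' 1"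
    "0 \<le> v \<Longrightarrow> v \<le> 1 \<Longrightarrow> fjoin_proj p (fjoin_edge n E p e0 e v) = p e0"
proof -
  note m = fjoin_edge_mem [of _ E e0 p]
  have 0: "(\<lambda>i::nat. if i = 0 then 1 - 0 else if i = 1 then 0 else 0) = (\<lambda>i. if i = 0 then 1 else 0 :: real)"
    by auto
  show "fjoin_edge n E p e0 e 0 = fjoin_vertex n E p e"
    unfolding fjoin_edge_def fjoin_vertex_def 0
    by (subst fjoin_pt_eq_iff [OF m]) (use assms in \<open>auto intro: fjoin_vertex_mem\<close>)
  show "fjoin_edge n E p e0 e 1 = fjoin_edge n E p e0 e' 1" if "e' \<in> topspace E" "p e' = p e0"
    unfolding fjoin_edge_def
    by (subst fjoin_pt_eq_iff [OF m edge_simplex m edge_simplex]) (use assms that in \<open>auto simp: restrict_def\<close>)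
  show "fjoin_proj p (fjoin_edge n E p e0 e v) = p e0" if "0 \<le> v" "v \<le> 1"
    unfolding fjoin_edge_def
    by (subst fjoin_proj_pt [OF m edge_simplex, of _ _ _ 0]) (use assms that in auto)
qed

lemma continuous_map_fjoin_vertex:
  assumes "k_space Q" and e: "continuous_map Q E e"
  shows "continuous_map Q (fjoin n E p) (\<lambda>x. fjoin_vertex n E p (e x))"
  unfolding fjoin_vertex_def
  by (rule continuous_map_into_fjoin [OF assms(1)]) (use e in auto)

lemma continuous_map_fjoin_edge:
  assumes "k_space Q" "1 \<le> n" "e0 \<in> topspace E" and e: "continuous_map Q E e" and v: "continuous_map Q unit_interval v"
    and pe: "\<And>x. x \<in> topspace Q \<Longrightarrow> p (e x) = p e0"
  shows "continuous_map Q (fjoin n E p) (\<lambda>x. fjoin_edge n E p e0 (e x) (v x))"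
  unfolding fjoin_edge_def
proof (rule continuous_map_into_fjoin [OF assms(1)])
  show "continuous_map Q E (\<lambda>x. (\<lambda>i\<in>{..n}. if i = 0 then e x else e0) i)" if "i \<le> n" for i
    using that e assms(3) by (cases "i = 0") auto
  have "continuous_map Q euclideanreal v" using v by (rule continuous_map_from_interval)
  then show "continuous_map Q euclideanreal (\<lambda>x. if i = 0 then 1 - v x else if i = 1 then v x else 0)" for i :: nat
    by (cases "i = 0"; cases "i = 1") (auto intro: continuous_intros)
  fix x assume x: "x \<in> topspace Q"
  then have "0 \<le> v x" "v x \<le> 1" using v by (auto simp: continuous_map_def)
  then show "(\<lambda>i. if i = 0 then 1 - v x else if i = 1 then v x else 0) \<in> standard_simplex n"
    by (rule edge_simplex [OF assms(2)])
  show "p ((\<lambda>i\<in>{..n}. if i = 0 then e x else e0) i) = p ((\<lambda>i\<in>{..n}. if i = 0 then e x else e0) 0)"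
    if "i \<le> n" for i
    using that pe [OF x] by simp
qed auto

text \<open>For \<open>n \<ge> 1\<close> the fibre inclusion \<open>A \<rightarrow> J\<^sup>n(A)\<close> is null homotopic along the edge to a second vertex,
  so after lifting a family of loops of \<open>X\<close> to \<open>\<A>\<close> its end points can be joined back to the base point.\<close>

lemma fibred_join_lift_loops:
  assumes n: "1 \<le> n" and p: "pointed_fibration E e0 X x0 p" and E: "Hausdorff_space E" "e0 \<in> topspace E"
    and X: "Hausdorff_space X" and S: "compactly_generated S" and wp: "well_pointed S s0"
    and \<omega>: "path_family S X \<omega>"
    and \<omega>01: "\<And>s. s \<in> topspace S \<Longrightarrow> \<omega> (0, s) = x0" "\<And>s. s \<in> topspace S \<Longrightarrow> \<omega> (1, s) = x0"
    and tr: "fam_homotopic (subtopology S {s0}) X \<omega> (\<lambda>_. x0)"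
  obtains M where "path_family S (fjoin n E p) M"
    "\<And>s. s \<in> topspace S \<Longrightarrow> M (0, s) = fjoin_basept n E p e0"
    "\<And>s. s \<in> topspace S \<Longrightarrow> M (1, s) = fjoin_basept n E p e0"
    "\<And>q. 0 \<le> q \<Longrightarrow> q \<le> 1 \<Longrightarrow> M (q, s0) = fjoin_basept n E p e0"
    "fam_homotopic S X (\<lambda>z. fjoin_proj p (M z)) \<omega>"
proof -
  let ?J = "fjoin n E p" and ?b = "fjoin_basept n E p e0" and ?S0 = "subtopology S {s0}"
  have kS: "k_space S" and hS: "Hausdorff_space S" using S by (auto simp: compactly_generated_def)
  have s0: "s0 \<in> topspace S" using wp by (simp add: well_pointed_def)
  have pc: "continuous_map E X p" and pe0: "p e0 = x0"
    using p by (auto simp: pointed_fibration_def pointed_map_def)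
  \<comment> \<open>Constancy over s0 keeps the lifted path \<open>l (t, s0)\<close> in the fibre
    for all t, where the edges to e0 are available.\<close>
  obtain \<omega>' where \<omega>': "fam_homotopic S X \<omega> \<omega>'" "\<And>q. 0 \<le> q \<Longrightarrow> q \<le> 1 \<Longrightarrow> \<omega>' (q, s0) = x0"
    using fam_pointed_correction [OF wp S \<omega> tr] by metis
  have \<omega>'01: "\<omega>' (0, s) = x0" "\<omega>' (1, s) = x0" if "s \<in> topspace S" for s
    using fam_homotopic_ends [OF \<omega>'(1) that] \<omega>01 that by auto
  have \<omega>'c: "path_family S X \<omega>'" using fam_homotopic_imp_path_family [OF \<omega>'(1)] by blast
  obtain l where l: "continuous_map (prod_topology unit_interval S) E l"
    "\<And>z. z \<in> topspace S \<Longrightarrow> l (0, z) = e0"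
    "\<And>t z. \<lbrakk>t \<in> {0..1}; z \<in> topspace S\<rbrakk> \<Longrightarrow> p (l (t, z)) = \<omega>' (t, z)"
  proof (rule pointed_fibration_lift [OF p E(1) X kS])
    show "continuous_map S E (\<lambda>_. e0)" using E(2) by simp
    show "continuous_map (prod_topology unit_interval S) X \<omega>'" using \<omega>'c by (simp add: path_family_def)
    show "\<omega>' (0, z) = p e0" if "z \<in> topspace S" for z using \<omega>'01 that pe0 by simp
  qed blast
  have lE: "l (t, z) \<in> topspace E" if "0 \<le> t" "t \<le> 1" "z \<in> topspace S" for t z
    using l(1) that by (auto simp: continuous_map_def)
  have pl1: "p (l (1, z)) = p e0" if "z \<in> topspace S" for z
    using l(3) [of 1 z] \<omega>'01 that pe0 by simp
  let ?ed = "fjoin_edge n E p e0"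
  note edge = fjoin_edge_props [OF n E(2), of _ p]
  have vb: "fjoin_vertex n E p e0 = ?b" by (simp add: fjoin_vertex_def fjoin_basept_def)
  \<comment> \<open>The lift l starts at e0 but ends anywhere in the fibre. So: c1 follows l in
    position 0, c2 goes from its end to e0 in position 1, and d reversed returns from there to the
    base point.\<close>
  define c1 where "c1 = (\<lambda>(u, s). fjoin_vertex n E p (l (u, s)))"
  define c2 where "c2 = (\<lambda>(v, s). ?ed (l (1, s)) v)"
  define d where "d = (\<lambda>(v, s::'c). ?ed e0 v)"
  have kI: "k_space (prod_topology unit_interval Q)" if "k_space Q" for Q :: "'c topology"
    by (rule k_space_interval_prod [OF that])
  have l1: "continuous_map S E (\<lambda>s. l (1, s))"
    by (rule continuous_map_comp_pair [OF l(1)]) auto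
  have c1: "path_family S ?J c1"
    unfolding path_family_def c1_def case_prod_unfold
    using continuous_map_fjoin_vertex [OF kI [OF kS] l(1)] by simp
  have c2: "path_family S ?J c2"
    unfolding path_family_def c2_def case_prod_unfold
    by (rule continuous_map_fjoin_edge [OF kI [OF kS] n E(2) continuous_map_comp [OF l1 continuous_map_snd] continuous_map_fst])
       (auto simp: pl1)
  have d: "path_family S ?J d"
    unfolding path_family_def d_def case_prod_unfold
    by (rule continuous_map_fjoin_edge [OF kI [OF kS] n E(2) _ continuous_map_fst]) (auto simp: E(2))
  have ends: "c1 (0, s) = ?b" "c1 (1, s) = c2 (0, s)" "c2 (1, s) = d (1, s)" "d (0, s) = ?b" if "s \<in> topspace S" for s
  proof -
    have e: "l (1, s) \<in> topspace E" "p (l (1, s)) = p e0" using lE pl1 that by auto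
    show "c1 (0, s) = ?b" using that by (simp add: c1_def l(2) vb)
    show "c1 (1, s) = c2 (0, s)" using edge(1) [OF e] by (simp add: c1_def c2_def)
    show "c2 (1, s) = d (1, s)" using edge(2) [OF e E(2) refl] by (simp add: c2_def d_def)
    show "d (0, s) = ?b" using edge(1) [OF E(2) refl] by (simp add: d_def vb)
  qed
  define M0 where "M0 = famcat c1 (famcat c2 (famrev d))"
  have M0: "path_family S ?J M0"
    unfolding M0_def by (intro path_family_cat path_family_rev c1 c2 d) (simp_all add: ends)
  \<comment> \<open>Both edges lie in the fibre over x0, so the projection is the loop run on the
    first half followed by a rest.\<close>
  have projM0: "fam_homotopic S X (\<lambda>z. fjoin_proj p (M0 z)) \<omega>'"
  proof (rule fam_homotopic_reparamI [OF \<omega>'c, where \<sigma> = "\<lambda>u. min (2 * u) 1" and \<tau> = "\<lambda>u. u"])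
    show "continuous_map unit_interval unit_interval (\<lambda>u. min (2 * u) 1)"
      by (rule continuous_map_to_interval) (auto intro!: continuous_intros)
    fix u :: real and s assume u: "0 \<le> u" "u \<le> 1" and s: "s \<in> topspace S"
    have 1: "fjoin_proj p (c1 (v, s)) = \<omega>' (v, s)" if "0 \<le> v" "v \<le> 1" for v
      using l(3) lE that s by (simp add: c1_def fjoin_vertex_proj)
    have 2: "fjoin_proj p (c2 (v, s)) = x0" "fjoin_proj p (d (v, s)) = x0" if "0 \<le> v" "v \<le> 1" for v
      using edge(3) [of "l (1, s)" v] edge(3) [of e0 v] that lE [of 1 s] pl1 s E(2) pe0
      by (simp_all add: c2_def d_def)
    show "fjoin_proj p (M0 (u, s)) = \<omega>' (min (2 * u) 1, s)"
      using u s by (auto simp: M0_def famcat_def famrev_def 1 2 \<omega>'01 min_def)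
  qed auto
  \<comment> \<open>Over s0 the path l lies in the fibre and is shrunk along itself to e0; the edge
    from its end point follows and becomes d. What is left is d followed by its reverse.\<close>
  have tr0: "fam_homotopic ?S0 ?J M0 (\<lambda>_. ?b)"
  proof -
    have t0: "topspace ?S0 = {s0}" using s0 by auto
    note sub = path_family_subtopology [where A = "{s0}"]
    have kS0: "k_space ?S0"
      using hS s0 by (intro k_space_closed_subtopology [OF kS]) (simp add: closedin_Hausdorff_sing_eq)
    have plt: "p (l (t, s0)) = p e0" if "0 \<le> t" "t \<le> 1" for t
      using l(3) [of t s0] \<omega>'(2) that s0 pe0 by simp
    have ed1: "?ed (l (t, s0)) 1 = ?ed e0 1" if "0 \<le> t" "t \<le> 1" for t
      by (rule edge(2) [OF lE plt E(2) refl]) (use that s0 in auto)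
    let ?Q = "prod_topology unit_interval (prod_topology unit_interval ?S0)"
    have kQ: "k_space ?Q" by (intro k_space_interval_prod kS0)
    have u: "continuous_map ?Q euclideanreal (\<lambda>x. fst (snd x))" and w: "continuous_map ?Q euclideanreal fst"
      by (intro continuous_map_from_interval proj_cont)+
    have sS: "continuous_map ?Q S (\<lambda>x. snd (snd x))"
      by (rule continuous_map_into_fulltopology [OF continuous_map_projections(2)])
    let ?a = "\<lambda>x. (1 - fst x) * clamp01 (2 * fst (snd x))"
    have a01: "0 \<le> (1 - w) * clamp01 v" "(1 - w) * clamp01 v \<le> 1" if "0 \<le> w" "w \<le> 1" for w v :: real
      using that by (auto intro: mult_le_one)
    have la: "continuous_map ?Q E (\<lambda>x. l (?a x, snd (snd x)))"
    proof (rule continuous_map_comp_pair [OF l(1) continuous_map_to_interval sS])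
      show "continuous_map ?Q euclideanreal ?a"
        using u w by (intro continuous_intros continuous_map_from_interval [OF continuous_map_clamp01]) auto
    qed (use a01 in auto)
    have lb: "continuous_map ?Q E (\<lambda>x. l (1 - fst x, snd (snd x)))"
      by (rule continuous_map_comp_pair [OF l(1) continuous_map_to_interval sS])
         (use w in \<open>auto intro!: continuous_intros\<close>)
    have "fam_homotopic ?S0 ?J (famcat c1 c2) (famcat (\<lambda>_. ?b) d)"
    proof (rule fam_homotopicI)
      show "continuous_map ?Q ?J (\<lambda>x. if fst (snd x) \<le> 1/2 then fjoin_vertex n E p (l (?a x, snd (snd x)))
          else ?ed (l (1 - fst x, snd (snd x))) (clamp01 (2 * fst (snd x) - 1)))"
      proof (rule continuous_map_if_le)
        show "continuous_map ?Q ?J (\<lambda>x. fjoin_vertex n E p (l (?a x, snd (snd x))))"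
          by (rule continuous_map_fjoin_vertex [OF kQ la])
        show "continuous_map ?Q ?J (\<lambda>x. ?ed (l (1 - fst x, snd (snd x))) (clamp01 (2 * fst (snd x) - 1)))"
          by (rule continuous_map_fjoin_edge [OF kQ n E(2) lb])
             (use u in \<open>auto intro!: continuous_intros simp: plt t0\<close>)
        fix x assume x: "x \<in> topspace ?Q" and h: "fst (snd x) = 1/2"
        show "fjoin_vertex n E p (l (?a x, snd (snd x))) =
            ?ed (l (1 - fst x, snd (snd x))) (clamp01 (2 * fst (snd x) - 1))"
          unfolding h using x s0 by (auto simp: edge(1) lE plt t0)
      qed (use u in auto)
    qed (auto simp: famcat_def c1_def c2_def d_def t0 l(2) vb s0 ed1)
    also have "fam_homotopic ?S0 ?J (famcat (\<lambda>_. ?b) d) d"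
    proof -
      have "fam_homotopic ?S0 ?J (famcat (\<lambda>(u, s). d (0, s)) d) d"
        by (rule famcat_const_left [OF sub [OF d]])
      moreover have "(\<lambda>(u::real, s). d (0, s)) = (\<lambda>_. ?b)"
        using edge(1) [of e0] E(2) by (auto simp: d_def vb)
      ultimately show ?thesis by simp
    qed
    finally have cd: "fam_homotopic ?S0 ?J (famcat c1 c2) d" .
    have "fam_homotopic ?S0 ?J M0 (famcat (famcat c1 c2) (famrev d))"
      unfolding M0_def
      by (rule fam_homotopic_sym, rule famcat_assoc) (auto simp: ends intro: sub c1 c2 path_family_rev d)
    also have "fam_homotopic ?S0 ?J \<dots> (famcat d (famrev d))"
      by (rule famcat_cong [OF cd fam_homotopic_refl]) (auto simp: ends intro: sub path_family_rev d)
    also have "fam_homotopic ?S0 ?J \<dots> (\<lambda>(u, s). d (0, s))"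
      by (rule famcat_rev_right [OF sub [OF d]])
    also have "(\<lambda>(u::real, s). d (0, s)) = (\<lambda>_. ?b)"
      using edge(1) [of e0] E(2) by (auto simp: d_def vb)
    finally show ?thesis .
  qed
  obtain M where M: "fam_homotopic S ?J M0 M" "\<And>q. 0 \<le> q \<Longrightarrow> q \<le> 1 \<Longrightarrow> M (q, s0) = ?b"
    using fam_pointed_correction [OF wp S M0 tr0] by metis
  show ?thesis
  proof
    show "path_family S ?J M" using fam_homotopic_imp_path_family [OF M(1)] by blast
    show "M (0, s) = ?b" "M (1, s) = ?b" if "s \<in> topspace S" for s
      using fam_homotopic_ends [OF M(1) that] ends that by (simp_all add: M0_def)
    have "fam_homotopic S X (\<lambda>z. fjoin_proj p (M z)) (\<lambda>z. fjoin_proj p (M0 z))"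
      by (rule fam_homotopic_map [OF fam_homotopic_sym [OF M(1)] continuous_map_fjoin_proj [OF pc]])
    also note projM0
    also note fam_homotopic_sym [OF \<omega>'(1)]
    finally show "fam_homotopic S X (\<lambda>z. fjoin_proj p (M z)) \<omega>" .
  qed (rule M(2))
qed

text \<open>Since \<open>S\<close> is a suspension, any family of loops of \<open>X\<close> is the image of a self homotopy of \<open>H\<close>: do
  the loop on one half of \<open>S\<close> and keep \<open>H\<close> on the other half. Composing with it makes the paths of
  the given homotopy \<open>M\<close>, extended by \<open>\<kappa>\<close>, homotopic to a path that does not depend on \<open>s\<close>.\<close>

lemma fibred_join_correct_homotopy:
  fixes S :: "'s topology" and E :: "'e topology" and X :: "'x topology"
  assumes n: "1 \<le> n" and p: "pointed_fibration E e0 X x0 p" and E: "Hausdorff_space E" "e0 \<in> topspace E"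
    and X: "Hausdorff_space X" and S: "compactly_generated S" and wp: "well_pointed S s0"
    and D: "path_family S S D1" "path_family S S D2"
      "\<And>s. s \<in> topspace S \<Longrightarrow> D1 (0, s) = s \<and> D2 (0, s) = s"
      "\<And>t. \<lbrakk>0 \<le> t; t \<le> 1\<rbrakk> \<Longrightarrow> D1 (t, s0) = s0 \<and> D2 (t, s0) = s0"
      "\<And>s. s \<in> topspace S \<Longrightarrow> D1 (1, s) = s0 \<or> D2 (1, s) = s0"
    and H: "continuous_map S (fjoin n E p) H" "\<And>s. s \<in> topspace S \<Longrightarrow> fjoin_proj p (H s) = x0"
      "H s0 = fjoin_basept n E p e0"
    and M: "path_family S (fjoin n E p) M" "\<And>s. s \<in> topspace S \<Longrightarrow> M (0, s) = H s"
      "\<And>q. 0 \<le> q \<Longrightarrow> q \<le> 1 \<Longrightarrow> M (q, s0) = fjoin_basept n E p e0"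
    and \<kappa>: "path_family S X \<kappa>" "\<And>s. s \<in> topspace S \<Longrightarrow> \<kappa> (0, s) = fjoin_proj p (M (1, s))"
      "\<And>s. s \<in> topspace S \<Longrightarrow> \<kappa> (1, s) = a"
  obtains M' \<Theta> where "path_family S (fjoin n E p) M'" "\<And>s. s \<in> topspace S \<Longrightarrow> M' (0, s) = H s"
    "\<And>s. s \<in> topspace S \<Longrightarrow> M' (1, s) = M (1, s)"
    "\<And>q. 0 \<le> q \<Longrightarrow> q \<le> 1 \<Longrightarrow> M' (q, s0) = fjoin_basept n E p e0"
    "fam_homotopic S X (famcat (\<lambda>z. fjoin_proj p (M' z)) \<kappa>) (\<lambda>(u, s). \<Theta> u)"
proof -
  let ?J = "fjoin n E p" and ?b = "fjoin_basept n E p e0" and ?S0 = "subtopology S {s0}"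
  have hS: "Hausdorff_space S" using S by (auto simp: compactly_generated_def)
  have s0: "s0 \<in> topspace S" using wp by (simp add: well_pointed_def)
  have pc: "continuous_map E X p" using p by (auto simp: pointed_fibration_def pointed_map_def)
  note pJ = continuous_map_fjoin_proj [OF pc, of n]
  define \<pi> where "\<pi> = (fjoin_proj p :: 'e fjoin_point \<Rightarrow> 'x)"
  have \<pi>b: "\<pi> ?b = x0" using H(2) [OF s0] H(3) by (simp add: \<pi>_def)
  have \<pi>M: "path_family S X (\<lambda>z. \<pi> (M z))"
    unfolding \<pi>_def by (rule path_family_map [OF M(1) pJ])
  \<comment> \<open>The paths from x0 to a that have to become independent of s. Composing \<theta>
    with the loops \<open>\<omega>\<close> of \<theta>0 followed by the reverse of \<theta> leaves
    \<theta>0, which is constant in s.\<close>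
  define \<theta> where "\<theta> = famcat (\<lambda>z. \<pi> (M z)) \<kappa>"
  have \<theta>: "path_family S X \<theta>"
    unfolding \<theta>_def by (rule path_family_cat [OF \<pi>M \<kappa>(1)]) (simp add: \<kappa>(2) \<pi>_def)
  have \<theta>01: "\<theta> (0, s) = x0" "\<theta> (1, s) = a" if "s \<in> topspace S" for s
    using that by (simp_all add: \<theta>_def M(2) H(2) \<kappa>(3) \<pi>_def)
  define \<theta>0 where "\<theta>0 = (\<lambda>(u, s::'s). \<theta> (u, s0))"
  have \<theta>0: "path_family S X \<theta>0"
    unfolding path_family_def \<theta>0_def case_prod_unfold
    by (rule continuous_map_comp_pair [OF \<theta> [unfolded path_family_def] continuous_map_fst]) (simp add: s0)
  define \<omega> where "\<omega> = famcat \<theta>0 (famrev \<theta>)"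
  have \<omega>: "path_family S X \<omega>"
    unfolding \<omega>_def by (intro path_family_cat path_family_rev \<theta> \<theta>0) (simp add: \<theta>0_def \<theta>01 s0)
  have "fam_homotopic ?S0 X \<omega> (\<lambda>_. x0)"
  proof -
    have "fam_homotopic ?S0 X (famcat \<theta> (famrev \<theta>)) (\<lambda>(u, s). \<theta> (0, s))"
      by (rule famcat_rev_right [OF path_family_subtopology [OF \<theta>]])
    moreover have "fam_homotopic ?S0 X \<omega> (famcat \<theta> (famrev \<theta>))"
      by (rule fam_homotopic_eq [OF path_family_subtopology [OF \<omega>]]) (auto simp: \<omega>_def famcat_def \<theta>0_def)
    moreover have "fam_homotopic ?S0 X (\<lambda>(u, s). \<theta> (0, s)) (\<lambda>_. x0)"
      by (rule fam_homotopic_eq) (use calculation(1) in \<open>auto dest: fam_homotopic_imp_path_family simp: \<theta>01\<close>)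
    ultimately show ?thesis using fam_homotopic_trans by blast
  qed
  then obtain M0 where M0: "path_family S ?J M0"
    "\<And>s. s \<in> topspace S \<Longrightarrow> M0 (0, s) = ?b" "\<And>s. s \<in> topspace S \<Longrightarrow> M0 (1, s) = ?b"
    "\<And>q. 0 \<le> q \<Longrightarrow> q \<le> 1 \<Longrightarrow> M0 (q, s0) = ?b" "fam_homotopic S X (\<lambda>z. \<pi> (M0 z)) \<omega>"
    using fibred_join_lift_loops [OF n p E X S wp \<omega>] s0
    by (auto simp: \<omega>_def \<theta>0_def \<theta>01 \<pi>_def)
  have D1c: "continuous_map S S (\<lambda>s. D1 (1, s))" "continuous_map S S (\<lambda>s. D2 (1, s))"
    by (rule continuous_map_comp_pair [OF D(1) [unfolded path_family_def]]
          continuous_map_comp_pair [OF D(2) [unfolded path_family_def]]; simp)+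
  have Dim: "D1 (t, s) \<in> topspace S" "D2 (t, s) \<in> topspace S" if "0 \<le> t" "t \<le> 1" "s \<in> topspace S" for t s
    using D(1,2) that by (auto simp: path_family_def continuous_map_def)
  \<comment> \<open>First drag H along D2. On the half where \<open>D2 (1, s)\<close> is s0 the
    value is then the base point, and the lifted loop can be run there with parameter
    \<open>D1 (1, s)\<close>; on the other half, where \<open>D1 (1, s)\<close> is s0, nothing
    moves.\<close>
  define up where "up z = H (D2 z)" for z
  define mid where "mid = (\<lambda>(u, s). if D1 (1, s) = s0 then H (D2 (1, s)) else M0 (u, D1 (1, s)))"
  have up: "path_family S ?J up"
    unfolding up_def by (rule path_family_map [OF D(2) H(1)])
  have mid: "path_family S ?J mid"
    unfolding path_family_def mid_def case_prod_unfold
  proof (rule continuous_map_if_closed)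
    let ?Q = "prod_topology unit_interval S"
    note D1' = continuous_map_comp [OF D1c(1) continuous_map_snd [of unit_interval S]]
    note D2' = continuous_map_comp [OF D1c(2) continuous_map_snd [of unit_interval S]]
    show "closedin ?Q {x \<in> topspace ?Q. D1 (1, snd x) = s0}" "closedin ?Q {x \<in> topspace ?Q. D2 (1, snd x) = s0}"
      using closedin_eq_const [OF D1' hS] closedin_eq_const [OF D2' hS] by auto
    show "continuous_map ?Q ?J (\<lambda>x. H (D2 (1, snd x)))"
      by (rule continuous_map_comp [OF H(1) D2'])
    show "continuous_map ?Q ?J (\<lambda>x. M0 (fst x, D1 (1, snd x)))"
      by (rule continuous_map_comp_pair [OF M0(1) [unfolded path_family_def] continuous_map_fst D1'])
    show "D1 (1, snd x) = s0 \<or> D2 (1, snd x) = s0" if "x \<in> topspace ?Q" for x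
      using D(5) [of "snd x"] that by auto
  qed (use H(3) M0(4) in auto)
  have mid01: "mid (0, s) = H (D2 (1, s))" "mid (1, s) = H (D2 (1, s))" if "s \<in> topspace S" for s
    using D(5) [OF that] M0(2,3) [OF Dim(1) [OF _ _ that]] H(3) by (auto simp: mid_def)
  have \<pi>up: "\<pi> (up (u, s)) = x0" if "0 \<le> u" "u \<le> 1" "s \<in> topspace S" for u s
    using Dim(2) that H(2) by (simp add: up_def \<pi>_def)
  have \<pi>mid: "\<pi> (mid (u, s)) = \<pi> (M0 (u, D1 (1, s)))" if "0 \<le> u" "u \<le> 1" "s \<in> topspace S" for u s
    using Dim(2) [of 1 s] that H(2) \<pi>b by (auto simp: mid_def M0(4) \<pi>_def)
  \<comment> \<open>Undoing the drag gives a self homotopy of H.\<close>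
  define M2 where "M2 = famcat up (famcat mid (famrev up))"
  have M2: "path_family S ?J M2"
    unfolding M2_def by (intro path_family_cat path_family_rev up mid) (auto simp: mid01 up_def)
  have M201: "M2 (0, s) = H s" "M2 (1, s) = H s" if "s \<in> topspace S" for s
    using D(3) [OF that] by (simp_all add: M2_def up_def)
  have \<pi>M0: "path_family S X (\<lambda>z. \<pi> (M0 z))"
    unfolding \<pi>_def by (rule path_family_map [OF M0(1) pJ])
  \<comment> \<open>D1 deforms the parameter from s to \<open>D1 (1, s)\<close>; the ends stay fixed
    since M0 begins and ends at the base point for every s.\<close>
  have "fam_homotopic S X (\<lambda>z. \<pi> (M0 z)) (\<lambda>(u, s). \<pi> (M0 (u, D1 (1, s))))"
  proof (rule fam_homotopicI)
    show "continuous_map (prod_topology unit_interval (prod_topology unit_interval S)) X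
        (\<lambda>x. \<pi> (M0 (fst (snd x), D1 (fst x, snd (snd x)))))"
      by (intro continuous_map_comp_pair [OF \<pi>M0 [unfolded path_family_def]]
          continuous_map_comp_pair [OF D(1) [unfolded path_family_def]] proj_cont)
  qed (use D(3) Dim M0(2,3) in auto)
  \<comment> \<open>The outer pieces of M2 project to x0, and the middle piece occupies [1/2, 3/4],
    which 4u - 2 stretches to [0, 1].\<close>
  moreover have "fam_homotopic S X (\<lambda>z. \<pi> (M2 z)) (\<lambda>(u, s). \<pi> (M0 (u, D1 (1, s))))"
  proof (rule fam_homotopic_reparamI [where \<sigma> = "\<lambda>u. clamp01 (4 * u - 2)" and \<tau> = "\<lambda>u. u"])
    show "path_family S X (\<lambda>(u, s). \<pi> (M0 (u, D1 (1, s))))"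
      using calculation fam_homotopic_imp_path_family by blast
    show "continuous_map unit_interval unit_interval (\<lambda>u. clamp01 (4 * u - 2))"
      by (rule continuous_map_clamp01) (auto intro!: continuous_intros)
    fix u :: real and s assume u: "0 \<le> u" "u \<le> 1" and s: "s \<in> topspace S"
    have e: "\<pi> (M0 (0, D1 (1, s))) = x0" "\<pi> (M0 (1, D1 (1, s))) = x0"
      using M0(2,3) Dim(1) [of 1 s] s \<pi>b by simp_all
    consider "u \<le> 1/2" | "1/2 < u" "u \<le> 3/4" | "3/4 < u" by linarith
    then show "\<pi> (M2 (u, s)) = (case (clamp01 (4 * u - 2), s) of (u, s) \<Rightarrow> \<pi> (M0 (u, D1 (1, s))))"
    proof cases
      case 1
      then show ?thesis using u s e by (simp add: M2_def famcat_def \<pi>up)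
    next
      case 2
      then show ?thesis using u s by (simp add: M2_def famcat_def \<pi>mid)
    next
      case 3
      then show ?thesis using u s e by (simp add: M2_def famcat_def famrev_def \<pi>up)
    qed
  qed auto
  ultimately have \<pi>M2: "fam_homotopic S X (\<lambda>z. \<pi> (M2 z)) \<omega>"
    using M0(5) fam_homotopic_trans fam_homotopic_sym by blast
  define M' where "M' = famcat M2 M"
  have M': "path_family S ?J M'"
    unfolding M'_def by (rule path_family_cat [OF M2 M(1)]) (simp add: M201 M(2))
  have "fam_homotopic S X (famcat (\<lambda>z. \<pi> (M' z)) \<kappa>) (famcat (\<lambda>z. \<pi> (M2 z)) \<theta>)"
    unfolding M'_def famcat_map \<theta>_def
    by (rule famcat_assoc [OF _ \<pi>M \<kappa>(1)])
       (use fam_homotopic_imp_path_family [OF \<pi>M2] in \<open>simp_all add: M201 M(2) \<kappa>(2) \<pi>_def\<close>)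
  also have "fam_homotopic S X \<dots> (famcat \<omega> \<theta>)"
    by (rule famcat_cong [OF \<pi>M2 fam_homotopic_refl [OF \<theta>]]) (simp add: M201 \<theta>01 H(2) \<pi>_def)
  also have "fam_homotopic S X \<dots> (famcat \<theta>0 (famcat (famrev \<theta>) \<theta>))"
    unfolding \<omega>_def by (rule famcat_assoc [OF \<theta>0 path_family_rev [OF \<theta>] \<theta>]) (simp_all add: \<theta>0_def \<theta>01 s0)
  also have "fam_homotopic S X \<dots> (famcat \<theta>0 (\<lambda>(u, s). \<theta> (1, s)))"
    by (rule famcat_cong [OF fam_homotopic_refl [OF \<theta>0] famcat_rev_left [OF \<theta>]]) (simp add: \<theta>0_def \<theta>01 s0)
  also have "fam_homotopic S X \<dots> (famcat \<theta>0 (\<lambda>(u, s). \<theta>0 (1, s)))"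
  proof (rule fam_homotopic_eq)
    show "path_family S X (famcat \<theta>0 (\<lambda>(u, s). \<theta> (1, s)))"
      using fam_homotopic_imp_path_family [OF calculation] by blast
  qed (auto simp: famcat_def \<theta>0_def \<theta>01 s0)
  also have "fam_homotopic S X \<dots> \<theta>0"
    by (rule famcat_const_right [OF \<theta>0])
  finally have "fam_homotopic S X (famcat (\<lambda>z. fjoin_proj p (M' z)) \<kappa>) (\<lambda>(u, s). \<theta> (u, s0))"
    by (simp add: \<pi>_def \<theta>0_def)
  moreover have "M' (0, s) = H s" "M' (1, s) = M (1, s)" if "s \<in> topspace S" for s
    using M201 [OF that] by (simp_all add: M'_def)
  moreover have "M' (q, s0) = ?b" if "0 \<le> q" "q \<le> 1" for q
    by (simp add: M'_def M2_def famcat_def famrev_def up_def mid_def D(4) H(3) M(3))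
  ultimately show ?thesis
    using that [of M' "\<lambda>u. \<theta> (u, s0)"] M' by blast
qed

section \<open>Extending a lifting over the cofibre\<close>

lemma pointed_homotopicI:
  assumes "x0 \<in> topspace X" "continuous_map (prod_topology unit_interval X) Y h"
    and "\<And>x. x \<in> topspace X \<Longrightarrow> h (0, x) = f x" "\<And>x. x \<in> topspace X \<Longrightarrow> h (1, x) = g x"
    and "\<And>t. \<lbrakk>0 \<le> t; t \<le> 1\<rbrakk> \<Longrightarrow> h (t, x0) = y0"
  shows "pointed_homotopic X x0 Y y0 f g"
  unfolding pointed_homotopic_def by (subst homotopic_with) (use assms in \<open>auto intro!: exI [of _ h]\<close>)

text \<open>The two sides fill the last coordinate differently, by e0 and by coordinate 0, but its
  weight is 0.\<close>

lemma fjoin_incl_join_extend_zero: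
  assumes c: "c \<in> topspace (njoin n (fibre E p x0))" and e0: "e0 \<in> topspace (fibre E p x0)"
  shows "fjoin_incl (Suc n) E p (join_extend n (fibre E p x0) e0 c 0) = fjoin_raise n E p (fjoin_incl n E p c)"
proof -
  obtain a t where at: "a \<in> topspace (fibred_product n (fibre E p x0) to_point)" "t \<in> standard_simplex n"
      "c = njoin_pt n (fibre E p x0) (a, t)"
    using c by (rule fjoin_cases)
  note a = fibre_subset_fibred_product [OF at(1)]
  note t = standard_simplex_SucI [OF at(2)]
  have e: "a(Suc n := e0) \<in> topspace (fibred_product (Suc n) (fibre E p x0) to_point)"
    by (rule extend_fibred_product [OF at(1) e0]) simp
  have "fjoin_raise n E p (fjoin_incl n E p c) = fjoin_pt (Suc n) E p (a(Suc n := a 0), t)"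
    by (simp add: at(3) fjoin_incl_pt [OF at(1,2)] fjoin_raise_pt [OF a(1) at(2)])
  also have "\<dots> = fjoin_pt (Suc n) E p (a(Suc n := e0), t)"
    by (subst fjoin_pt_eq_iff [OF extend_fibred_product [OF a(1) fibred_product_coord(1) [OF a(1)] refl] t(1)
          fibre_subset_fibred_product(1) [OF e] t(1)]) (use t(2) in auto)
  also have "\<dots> = fjoin_incl (Suc n) E p (join_extend n (fibre E p x0) e0 c 0)"
    by (simp add: at(3) join_extend_zero [OF at(1,2) e0] fjoin_incl_pt [OF e t(1)])
  finally show ?thesis ..
qed

lemma fjoin_basept_raise_incl:
  assumes "e0 \<in> topspace E"
  shows "fjoin_raise n E p (fjoin_basept n E p e0) = fjoin_basept (Suc n) E p e0"
    "p e0 = x0 \<Longrightarrow> fjoin_incl n E p (njoin_basept n (fibre E p x0) e0) = fjoin_basept n E p e0"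
proof -
  have m: "(\<lambda>i\<in>{..k}. e0) \<in> topspace (fibred_product k E p)" for k
    by (rule fjoin_vertex_mem [OF assms])
  have d: "(\<lambda>i. if i = 0 then 1 else 0 :: real) \<in> standard_simplex k" for k by simp
  have "(\<lambda>i\<in>{..n}. e0)(Suc n := (\<lambda>i\<in>{..n}. e0) 0) = (\<lambda>i\<in>{..Suc n}. e0)"
    by (auto simp: restrict_def)
  then show "fjoin_raise n E p (fjoin_basept n E p e0) = fjoin_basept (Suc n) E p e0"
    unfolding fjoin_basept_def by (subst fjoin_raise_pt [OF m d]) simp
  assume "p e0 = x0"
  then have "e0 \<in> topspace (fibre E p x0)" using assms by (simp add: fibre_def)
  then show "fjoin_incl n E p (njoin_basept n (fibre E p x0) e0) = fjoin_basept n E p e0"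
    unfolding fjoin_basept_def by (intro fjoin_incl_pt fjoin_vertex_mem) simp_all
qed

text \<open>On the collar \<open>S \<times> [0, 1/2]\<close> of the cone the map \<open>\<phi>'\<close> is the corrected homotopy from \<open>\<phi> \<circ> \<alpha>\<close> to \<open>H\<close>;
  on the rest it is the cone on \<open>H\<close>, which lies in \<open>J\<^sup>n\<^sup>+\<^sup>1(A)\<close>.\<close>

lemma Hopf_invariant_cone_extension:
  fixes S :: "'s topology" and E :: "'e topology" and X :: "'x topology"
  assumes n: "1 \<le> n" and p: "pointed_fibration E e0 X x0 p" and E: "Hausdorff_space E" "e0 \<in> topspace E"
    and X: "Hausdorff_space X" and S: "compactly_generated S" and wp: "well_pointed S s0"
    and susp: "pointed_homotopy_equivalent S s0 (reduced_suspension S' s0') (suspension_pt S' s0' s0' 0)"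
    and S': "k_space S'" "s0' \<in> topspace S'"
    and x0: "x0 \<in> topspace K" and \<alpha>0: "\<alpha> s0 = x0" and mc: "mapping_cone X K S \<alpha> \<alpha>'"
    and Hopf: "is_Hopf_invariant n E e0 X x0 p K S s0 \<alpha> \<phi> H"
  obtains \<phi>' N where "continuous_map X (fjoin (Suc n) E p) \<phi>'" "\<phi>' x0 = fjoin_basept (Suc n) E p e0"
    "\<And>x. x \<in> topspace K \<Longrightarrow> fjoin_weight (\<phi>' x) (Suc n) = 0"
    "pointed_homotopic X x0 X x0 (fjoin_proj p \<circ> \<phi>') id"
    "continuous_map (prod_topology unit_interval (cone S)) (fjoin (Suc n) E p) N"
    "\<And>c. c \<in> topspace (cone S) \<Longrightarrow> N (0, c) = \<phi>' (\<alpha>' c)"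
    "\<And>s u. \<lbrakk>s \<in> topspace S; 0 \<le> u; u \<le> 1\<rbrakk> \<Longrightarrow>
        N (1, cone_pt S s u) = fjoin_incl (Suc n) E p (join_extend n (fibre E p x0) e0 (H s) u)"
    "\<And>r s. \<lbrakk>0 \<le> r; r \<le> 1; s \<in> topspace S\<rbrakk> \<Longrightarrow> fjoin_weight (N (r, cone_pt S s 0)) (Suc n) = 0"
    "\<And>r. \<lbrakk>0 \<le> r; r \<le> 1\<rbrakk> \<Longrightarrow> N (r, cone_pt S s0 0) = fjoin_basept (Suc n) E p e0"
proof -
  let ?A = "fibre E p x0" and ?J = "fjoin n E p" and ?J' = "fjoin (Suc n) E p"
  let ?b = "fjoin_basept n E p e0" and ?b' = "fjoin_basept (Suc n) E p e0"
  have kS: "k_space S" using S by (simp add: compactly_generated_def)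
  have s0: "s0 \<in> topspace S" using wp by (simp add: well_pointed_def)
  have pc: "continuous_map E X p" and pe0: "p e0 = x0"
    using p by (auto simp: pointed_fibration_def pointed_map_def)
  have eA: "e0 \<in> topspace ?A" using E(2) pe0 by (simp add: fibre_def)
  note mcc = mapping_cone_continuous [OF mc]
  have \<alpha>c: "continuous_map S K \<alpha>" and \<alpha>': "\<And>s. s \<in> topspace S \<Longrightarrow> \<alpha>' (cone_pt S s 0) = \<alpha> s"
    and Xe: "topspace X = topspace K \<union> \<alpha>' ` topspace (cone S)"
    using mc by (auto simp: mapping_cone_def)
  have \<alpha>K: "\<alpha> s \<in> topspace K" if "s \<in> topspace S" for s using \<alpha>c that by (auto simp: continuous_map_def)
  have \<phi>: "continuous_map K ?J \<phi>" "\<phi> x0 = ?b" and \<phi>h: "pointed_homotopic K x0 X x0 (fjoin_proj p \<circ> \<phi>) id"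
    and H: "continuous_map S (njoin n ?A) H" "H s0 = njoin_basept n ?A e0"
    and Hh: "pointed_homotopic S s0 ?J ?b (fjoin_incl n E p \<circ> H) (\<phi> \<circ> \<alpha>)"
    using Hopf by (auto simp: is_Hopf_invariant_def homotopy_lifting_def pointed_map_def)
  have Hm: "H s \<in> topspace (njoin n ?A)" if "s \<in> topspace S" for s
    using H(1) that by (auto simp: continuous_map_def)
  obtain hK where hK: "continuous_map (prod_topology unit_interval K) X hK"
    "\<And>k. hK (0, k) = fjoin_proj p (\<phi> k)" "\<And>k. hK (1, k) = k" "\<And>r. \<lbrakk>0 \<le> r; r \<le> 1\<rbrakk> \<Longrightarrow> hK (r, x0) = x0"
    using \<phi>h unfolding pointed_homotopic_def homotopic_with_def by auto
  obtain M where M: "path_family S ?J M" "\<And>s. M (0, s) = fjoin_incl n E p (H s)" "\<And>s. M (1, s) = \<phi> (\<alpha> s)"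
    "\<And>r. \<lbrakk>0 \<le> r; r \<le> 1\<rbrakk> \<Longrightarrow> M (r, s0) = ?b"
    using Hh unfolding pointed_homotopic_def homotopic_with_def path_family_def by auto
  define k1 where "k1 = (\<lambda>(u, s). hK (u, \<alpha> s))"
  define k2 where "k2 = (\<lambda>(u, s). \<alpha>' (cone_pt S s u))"
  have cp: "continuous_map (prod_topology S unit_interval) (cone S) (\<lambda>x. cone_pt S (fst x) (snd x))"
    by (rule quotient_imp_continuous_map [OF quotient_map_cone_pt [OF kS]])
  have cpt: "continuous_map Q (cone S) (\<lambda>x. cone_pt S (s x) (u x))"
    if "continuous_map Q S s" "continuous_map Q unit_interval u" for Q :: "'q topology" and s u
    using continuous_map_comp_pair [OF cp that] by simp
  have k1: "path_family S X k1"
    unfolding path_family_def k1_def case_prod_unfold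
    by (intro continuous_map_comp_pair [OF hK(1)] continuous_map_comp [OF \<alpha>c] proj_cont)
  have k2: "path_family S X k2"
    unfolding path_family_def k2_def case_prod_unfold
    by (intro continuous_map_comp [OF mcc(2)] cpt proj_cont)
  \<comment> \<open>The known part of the path to the cone point: from the projection of
    \<open>\<phi> (\<alpha> s)\<close> to \<alpha> s by the homotopy on K, then along the cone
    line.\<close>
  define \<kappa> where "\<kappa> = famcat k1 k2"
  define apex where "apex = \<alpha>' (cone_pt S s0 1)"
  have apex: "\<alpha>' (cone_pt S s 1) = apex" if "s \<in> topspace S" for s
  proof -
    have "cone_pt S s 1 = cone_pt S s0 1" using that s0 by (simp add: cone_pt_eq_iff)
    then show ?thesis by (simp add: apex_def)
  qed
  have \<kappa>: "path_family S X \<kappa>"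
    unfolding \<kappa>_def by (rule path_family_cat [OF k1 k2]) (simp add: k1_def k2_def hK(3) \<alpha>')
  obtain D1 D2 where D: "path_family S S D1" "path_family S S D2"
    "\<And>s. s \<in> topspace S \<Longrightarrow> D1 (0, s) = s \<and> D2 (0, s) = s"
    "\<And>t. \<lbrakk>0 \<le> t; t \<le> 1\<rbrakk> \<Longrightarrow> D1 (t, s0) = s0 \<and> D2 (t, s0) = s0"
    "\<And>s. s \<in> topspace S \<Longrightarrow> D1 (1, s) = s0 \<or> D2 (1, s) = s0"
    using suspension_pinch [OF susp S' s0] by metis
  obtain M' \<Theta> where M': "path_family S ?J M'" "\<And>s. s \<in> topspace S \<Longrightarrow> M' (0, s) = fjoin_incl n E p (H s)"
    "\<And>s. s \<in> topspace S \<Longrightarrow> M' (1, s) = M (1, s)"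
    "\<And>q. 0 \<le> q \<Longrightarrow> q \<le> 1 \<Longrightarrow> M' (q, s0) = ?b"
    "fam_homotopic S X (famcat (\<lambda>z. fjoin_proj p (M' z)) \<kappa>) (\<lambda>(u, s). \<Theta> u)"
  proof (rule fibred_join_correct_homotopy [OF n p E X S wp D _ _ _ M(1) M(2) M(4) \<kappa>])
    show "continuous_map S ?J (\<lambda>s. fjoin_incl n E p (H s))"
      by (rule continuous_map_comp [OF continuous_map_fjoin_incl H(1)])
    show "fjoin_proj p (fjoin_incl n E p (H s)) = x0" if "s \<in> topspace S" for s
      by (rule fjoin_incl(3) [OF Hm [OF that]])
    show "fjoin_incl n E p (H s0) = ?b"
      using fjoin_basept_raise_incl(2) [of e0 E p x0 n, OF E(2) pe0] H(2) by simp
    show "\<kappa> (0, s) = fjoin_proj p (M (1, s))" "\<kappa> (1, s) = apex" if "s \<in> topspace S" for s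
      using apex [OF that] by (simp_all add: \<kappa>_def k1_def k2_def hK(2) M(3))
  qed (assumption | (rule that; assumption))+
  define \<theta> where "\<theta> = famcat (\<lambda>z. fjoin_proj p (M' z)) \<kappa>"
  have \<theta>: "path_family S X \<theta>"
    using fam_homotopic_imp_path_family [OF M'(5)] by (simp add: \<theta>_def)
  obtain V where V: "continuous_map (prod_topology unit_interval (prod_topology unit_interval S)) X V"
    "\<And>u s. 0 \<le> u \<Longrightarrow> u \<le> 1 \<Longrightarrow> s \<in> topspace S \<Longrightarrow> V (0, (u, s)) = \<theta> (u, s)"
    "\<And>u s. 0 \<le> u \<Longrightarrow> u \<le> 1 \<Longrightarrow> s \<in> topspace S \<Longrightarrow> V (1, (u, s)) = \<Theta> u"
    "\<And>v s. 0 \<le> v \<Longrightarrow> v \<le> 1 \<Longrightarrow> s \<in> topspace S \<Longrightarrow> V (v, (0, s)) = \<theta> (0, s)"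
    "\<And>v s. 0 \<le> v \<Longrightarrow> v \<le> 1 \<Longrightarrow> s \<in> topspace S \<Longrightarrow> V (v, (1, s)) = \<theta> (1, s)"
    using M'(5) unfolding \<theta>_def [symmetric] by (auto elim!: fam_homotopicE)
  have M'm: "M' (u, s) \<in> topspace ?J" if "0 \<le> u" "u \<le> 1" "s \<in> topspace S" for u s
    using M'(1) that by (auto simp: path_family_def continuous_map_def)
  have \<theta>1: "\<theta> (u, s) = fjoin_proj p (M' (2 * u, s))" if "0 \<le> u" "u \<le> 1/2" "s \<in> topspace S" for u s
    using that by (simp add: \<theta>_def famcat_def)
  have \<theta>2: "\<theta> (u, s) = hK (4 * u - 2, \<alpha> s)" if "1/2 \<le> u" "u \<le> 3/4" "s \<in> topspace S" for u s
  proof (cases "u = 1/2")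
    case True
    show ?thesis unfolding True using that by (simp add: \<theta>_def famcat_def hK(2) M'(3) M(3))
  next
    case False
    then show ?thesis using that by (simp add: \<theta>_def famcat_def \<kappa>_def k1_def)
  qed
  have \<theta>3: "\<theta> (u, s) = \<alpha>' (cone_pt S s (4 * u - 3))" if "3/4 \<le> u" "u \<le> 1" "s \<in> topspace S" for u s
  proof (cases "u = 3/4")
    case True
    show ?thesis unfolding True using that by (simp add: \<theta>_def famcat_def \<kappa>_def k1_def hK(3) \<alpha>')
  next
    case False
    then show ?thesis using that by (simp add: \<theta>_def famcat_def \<kappa>_def k2_def)
  qed
  have \<theta>01: "\<theta> (0, s) = x0" "\<theta> (1, s) = apex" if "s \<in> topspace S" for s
    using \<theta>1 [of 0 s] \<theta>3 [of 1 s] that apex M'(2) fjoin_incl(3) [OF Hm [OF that]] by simp_all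
  let ?Q = "prod_topology unit_interval (prod_topology S unit_interval)"
  have cr: "continuous_map ?Q euclideanreal fst" and cu: "continuous_map ?Q euclideanreal (\<lambda>x. snd (snd x))"
    and cs: "continuous_map ?Q S (\<lambda>x. fst (snd x))" and crI: "continuous_map ?Q unit_interval fst"
    and cuI: "continuous_map ?Q unit_interval (\<lambda>x. snd (snd x))"
    by (intro continuous_map_from_interval proj_cont)+
  note M'c = M'(1) [unfolded path_family_def] and \<theta>c = \<theta> [unfolded path_family_def]
  define EE where "EE s u = fjoin_incl (Suc n) E p (join_extend n ?A e0 (H s) u)" for s u
  have EE: "continuous_map Q ?J' (\<lambda>x. EE (s x) (u x))"
    if "continuous_map Q S s" "continuous_map Q unit_interval u" for Q :: "'q topology" and s u
    unfolding EE_def using continuous_map_comp_pair [OF continuous_map_join_extend [OF eA] that(2) continuous_map_comp [OF H(1) that(1)]]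
    by (intro continuous_map_comp [OF continuous_map_fjoin_incl]) simp
  have EE0: "EE s 0 = fjoin_raise n E p (M' (0, s))" if "s \<in> topspace S" for s
    using fjoin_incl_join_extend_zero [OF Hm [OF that] eA] M'(2) [OF that] by (simp add: EE_def)
  \<comment> \<open>At time r the collar is u at most (1 - r)/2, so it has height 1/2 at r = 0 and
    is gone at r = 1. It carries M' run backwards from time 1 - r to 0; the quotient rescales the
    remainder to a full cone on H. On the base of the cone the value is a raised point, of last
    weight 0.\<close>
  define N0 where "N0 x = (if fst x + 2 * snd (snd x) \<le> 1
      then fjoin_raise n E p (M' (clamp01 (1 - fst x - 2 * snd (snd x)), fst (snd x)))
      else EE (fst (snd x)) (clamp01 ((2 * snd (snd x) - 1 + fst x) / (1 + fst x))))" for x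
  have N0: "continuous_map ?Q ?J' N0"
    unfolding N0_def
  proof (rule continuous_map_if_le)
    show "continuous_map ?Q euclideanreal (\<lambda>x. fst x + 2 * snd (snd x))"
      by (intro continuous_map_add continuous_map_real_mult_left cr cu)
    show "continuous_map ?Q ?J' (\<lambda>x. fjoin_raise n E p (M' (clamp01 (1 - fst x - 2 * snd (snd x)), fst (snd x))))"
      by (intro continuous_map_comp [OF continuous_map_fjoin_raise] continuous_map_comp_pair [OF M'c] cs
          continuous_map_clamp01 continuous_map_diff continuous_map_real_mult_left cr cu) auto
    show "continuous_map ?Q ?J' (\<lambda>x. EE (fst (snd x)) (clamp01 ((2 * snd (snd x) - 1 + fst x) / (1 + fst x))))"
      by (intro EE cs continuous_map_clamp01 continuous_map_real_divide continuous_map_add continuous_map_diff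
          continuous_map_real_mult_left cr cu) auto
    fix x assume x: "x \<in> topspace ?Q" and h: "fst x + 2 * snd (snd x) = 1"
    then have z: "1 - fst x - 2 * snd (snd x) = 0" "2 * snd (snd x) - 1 + fst x = 0" by linarith+
    have "fst (snd x) \<in> topspace S" using x by auto
    then show "fjoin_raise n E p (M' (clamp01 (1 - fst x - 2 * snd (snd x)), fst (snd x))) =
        EE (fst (snd x)) (clamp01 ((2 * snd (snd x) - 1 + fst x) / (1 + fst x)))"
      unfolding z by (simp add: EE0)
  qed auto
  obtain N where N: "continuous_map (prod_topology unit_interval (cone S)) ?J' N"
    "\<And>r s u. \<lbrakk>0 \<le> r; r \<le> 1; s \<in> topspace S; 0 \<le> u; u \<le> 1\<rbrakk> \<Longrightarrow> N (r, cone_pt S s u) = N0 (r, (s, u))"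
  proof (rule cone_family_lift [OF kS N0])
    show "N0 (r, (s, 1)) = N0 (r, (s', 1))" if "0 \<le> r" "r \<le> 1" "s \<in> topspace S" "s' \<in> topspace S" for r s s'
    proof -
      have "(1 + r) / (1 + r) = 1" using that by simp
      then show ?thesis
        using that join_extend_apex [OF Hm [OF that(3)] Hm [OF that(4)] eA] by (simp add: N0_def EE_def)
    qed
  qed blast
  have N_base: "N (r, cone_pt S s 0) = fjoin_raise n E p (M' (1 - r, s))" if "0 \<le> r" "r \<le> 1" "s \<in> topspace S" for r s
    using that by (simp add: N N0_def)
  have N_1: "N (1, cone_pt S s u) = EE s u" if "s \<in> topspace S" "0 \<le> u" "u \<le> 1" for s u
    using that EE0 by (cases "u = 0") (simp_all add: N N0_def)
  have N0c: "continuous_map (prod_topology unit_interval (cone S)) ?J' (\<lambda>x. N (0, snd x))"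
    by (rule continuous_map_comp_pair [OF N(1) _ continuous_map_snd]) simp
  have \<phi>c: "continuous_map (prod_topology unit_interval K) ?J' (\<lambda>x. fjoin_raise n E p (\<phi> (snd x)))"
    by (intro continuous_map_comp [OF continuous_map_fjoin_raise] continuous_map_comp [OF \<phi>(1)] continuous_map_snd)
  \<comment> \<open>A map on X is obtained from a constant homotopy by freezing r.\<close>
  obtain F where F: "continuous_map (prod_topology unit_interval X) ?J' F"
    "\<And>r x. \<lbrakk>0 \<le> r; r \<le> 1; x \<in> topspace K\<rbrakk> \<Longrightarrow> F (r, x) = fjoin_raise n E p (\<phi> x)"
    "\<And>r c. \<lbrakk>0 \<le> r; r \<le> 1; c \<in> topspace (cone S)\<rbrakk> \<Longrightarrow> F (r, \<alpha>' c) = N (0, c)"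
    using mapping_cone_family_lift [OF mc \<phi>c N0c] N_base [of 0] M'(3) M(3) by auto
  define \<phi>' where "\<phi>' x = F (0, x)" for x
  have \<phi>'c: "continuous_map X ?J' \<phi>'"
    unfolding \<phi>'_def by (rule continuous_map_comp_pair [OF F(1)]) auto
  have \<phi>'K: "\<phi>' x = fjoin_raise n E p (\<phi> x)" if "x \<in> topspace K" for x
    using F(2) that by (simp add: \<phi>'_def)
  have \<phi>'C: "\<phi>' (\<alpha>' c) = N (0, c)" if "c \<in> topspace (cone S)" for c
    using F(3) that by (simp add: \<phi>'_def)
  have \<phi>m: "\<phi> x \<in> topspace ?J" if "x \<in> topspace K" for x
    using \<phi>(1) that by (auto simp: continuous_map_def)
  \<comment> \<open>The homotopy on the cone. At u = 0 the parameter 1/2 + r/4 of \<theta> runs over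
    the piece that is the homotopy on K. At r = 0 it is the projection of \<phi>': first \<theta>
    backwards to x0, then rest. At r = 1 it is the cone line at double speed, then rest at the cone
    point. At u = 1 it is \<Theta> r, independent of s, hence well defined on the cone.\<close>
  define g where "g x = (if snd (snd x) \<le> 1/2
      then \<theta> ((1 - clamp01 (2 * snd (snd x))) * (1/2 + fst x / 4) + clamp01 (2 * snd (snd x)) * fst x, fst (snd x))
      else V (clamp01 (2 * snd (snd x) - 1), (fst x, fst (snd x))))" for x
  have gc: "continuous_map ?Q X g"
    unfolding g_def
  proof (rule continuous_map_if_le)
    let ?w = "\<lambda>x::real \<times> 's \<times> real. (1 - clamp01 (2 * snd (snd x))) * (1/2 + fst x / 4) + clamp01 (2 * snd (snd x)) * fst x"
    have "continuous_map ?Q unit_interval (\<lambda>x. clamp01 (2 * snd (snd x)))"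
      by (intro continuous_map_clamp01 continuous_map_real_mult_left cu)
    then have c2u: "continuous_map ?Q euclideanreal (\<lambda>x. clamp01 (2 * snd (snd x)))"
      by (rule continuous_map_from_interval)
    have "continuous_map ?Q unit_interval ?w"
    proof (rule continuous_map_to_interval)
      show "continuous_map ?Q euclideanreal ?w"
        by (intro continuous_map_add continuous_map_real_mult continuous_map_diff continuous_map_real_divide cr c2u) auto
      show "0 \<le> ?w x \<and> ?w x \<le> 1" if "x \<in> topspace ?Q" for x
        using that by (intro conjI add_nonneg_nonneg mult_nonneg_nonneg convex_bound_le) auto
    qed
    then show "continuous_map ?Q X (\<lambda>x. \<theta> (?w x, fst (snd x)))"
      by (rule continuous_map_comp_pair [OF \<theta>c _ cs])
    show "continuous_map ?Q X (\<lambda>x. V (clamp01 (2 * snd (snd x) - 1), (fst x, fst (snd x))))"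
      by (intro continuous_map_comp_pair [OF V(1)] continuous_map_pairedI crI cs continuous_map_clamp01
          continuous_map_diff continuous_map_real_mult_left cu) auto
    fix x assume x: "x \<in> topspace ?Q" and h: "snd (snd x) = 1/2"
    show "\<theta> (?w x, fst (snd x)) = V (clamp01 (2 * snd (snd x) - 1), (fst x, fst (snd x)))"
      unfolding h using x V(2) by auto
  qed (use cu in auto)
  obtain g' where g': "continuous_map (prod_topology unit_interval (cone S)) X g'"
    "\<And>r s u. \<lbrakk>0 \<le> r; r \<le> 1; s \<in> topspace S; 0 \<le> u; u \<le> 1\<rbrakk> \<Longrightarrow> g' (r, cone_pt S s u) = g (r, (s, u))"
  proof (rule cone_family_lift [OF kS gc])
    show "g (r, (s, 1)) = g (r, (s', 1))" if "0 \<le> r" "r \<le> 1" "s \<in> topspace S" "s' \<in> topspace S" for r s s'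
      using that V(3) by (simp add: g_def)
  qed blast
  have g'K: "g' (r, cone_pt S s 0) = hK (r, \<alpha> s)" if "0 \<le> r" "r \<le> 1" "s \<in> topspace S" for r s
    using that \<theta>2 [of "1/2 + r / 4" s] by (simp add: g' g_def)
  obtain G1 where G1: "continuous_map (prod_topology unit_interval X) X G1"
    "\<And>r x. \<lbrakk>0 \<le> r; r \<le> 1; x \<in> topspace K\<rbrakk> \<Longrightarrow> G1 (r, x) = hK (r, x)"
    "\<And>r c. \<lbrakk>0 \<le> r; r \<le> 1; c \<in> topspace (cone S)\<rbrakk> \<Longrightarrow> G1 (r, \<alpha>' c) = g' (r, c)"
    by (rule mapping_cone_family_lift [OF mc hK(1) g'(1) g'K]) (assumption | (rule that; assumption))+
  \<comment> \<open>The first homotopy ends at the map running through the cone lines at double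
    speed; the second slows it down to the identity, fixing K.\<close>
  have "continuous_map ?Q X (\<lambda>x. \<alpha>' (cone_pt S (fst (snd x)) (clamp01 ((2 - fst x) * snd (snd x)))))"
    by (intro continuous_map_comp [OF mcc(2)] cpt cs continuous_map_clamp01 continuous_map_real_mult
        continuous_map_diff cr cu) auto
  then obtain h' where h': "continuous_map (prod_topology unit_interval (cone S)) X h'"
    "\<And>r s u. \<lbrakk>0 \<le> r; r \<le> 1; s \<in> topspace S; 0 \<le> u; u \<le> 1\<rbrakk> \<Longrightarrow>
        h' (r, cone_pt S s u) = \<alpha>' (cone_pt S s (clamp01 ((2 - r) * u)))"
    by (rule cone_family_lift [OF kS]) (auto simp: apex)
  have "continuous_map (prod_topology unit_interval K) X (\<lambda>x. snd x)"
    using continuous_map_comp [OF mcc(1) continuous_map_snd] by simp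
  then obtain G2 where G2: "continuous_map (prod_topology unit_interval X) X G2"
    "\<And>r x. \<lbrakk>0 \<le> r; r \<le> 1; x \<in> topspace K\<rbrakk> \<Longrightarrow> G2 (r, x) = x"
    "\<And>r c. \<lbrakk>0 \<le> r; r \<le> 1; c \<in> topspace (cone S)\<rbrakk> \<Longrightarrow> G2 (r, \<alpha>' c) = h' (r, c)"
    by (rule mapping_cone_family_lift [OF mc _ h'(1)]) (auto simp: h'(2) \<alpha>')
  have x0X: "x0 \<in> topspace X" using x0 Xe by simp
  have Xcases: thesis if "x \<in> topspace X" "x \<in> topspace K \<Longrightarrow> thesis"
    "\<And>s u. s \<in> topspace S \<Longrightarrow> 0 \<le> u \<Longrightarrow> u \<le> 1 \<Longrightarrow> x = \<alpha>' (cone_pt S s u) \<Longrightarrow> thesis" for x thesis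
    using that Xe by (auto elim!: cone_cases)
  have "pointed_homotopic X x0 X x0 (fjoin_proj p \<circ> \<phi>') (\<lambda>x. G2 (0, x))"
  proof (rule pointed_homotopicI [OF x0X G1(1)])
    fix x assume x: "x \<in> topspace X"
    show "G1 (0, x) = (fjoin_proj p \<circ> \<phi>') x"
    proof (rule Xcases [OF x])
      assume "x \<in> topspace K"
      then show ?thesis by (simp add: G1(2) \<phi>'K hK(2) fjoin_raise(3) [OF \<phi>m])
    next
      fix s u assume s: "s \<in> topspace S" and u: "0 \<le> u" "u \<le> 1" and xe: "x = \<alpha>' (cone_pt S s u)"
      note c = cone_pt_mem [OF s u]
      have e: "fjoin_proj p (\<phi>' x) = fjoin_proj p (N0 (0, (s, u)))"
        using s u by (simp add: xe \<phi>'C [OF c] N)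
      have e': "G1 (0, x) = g (0, (s, u))"
        using s u by (simp add: xe G1(3) c g')
      show ?thesis
      proof (cases "u \<le> 1/2")
        case True
        have "fjoin_proj p (N0 (0, (s, u))) = fjoin_proj p (M' (1 - 2 * u, s))"
          using True u s by (simp add: N0_def fjoin_raise(3) [OF M'm])
        moreover have "g (0, (s, u)) = \<theta> ((1 - 2 * u) / 2, s)"
          using True u by (simp add: g_def)
        moreover have "\<theta> ((1 - 2 * u) / 2, s) = fjoin_proj p (M' (1 - 2 * u, s))"
        proof -
          have dd: "2 * ((1 - 2 * u) / 2) = 1 - 2 * u" by simp
          show ?thesis using \<theta>1 [of "(1 - 2 * u) / 2" s] True u s unfolding dd by simp
        qed
        ultimately show ?thesis using e e' by simp
      next
        case False
        then have "fjoin_proj p (N0 (0, (s, u))) = x0"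
          using u fjoin_incl(3) [OF join_extend_mem(1) [OF Hm [OF s] eA]] by (simp add: N0_def EE_def)
        moreover have "g (0, (s, u)) = x0"
          using False u s V(4) \<theta>01 by (simp add: g_def)
        ultimately show ?thesis using e e' by simp
      qed
    qed
  next
    fix x assume x: "x \<in> topspace X"
    show "G1 (1, x) = G2 (0, x)"
    proof (rule Xcases [OF x])
      assume "x \<in> topspace K"
      then show ?thesis by (simp add: G1(2) G2(2) hK(3))
    next
      fix s u assume s: "s \<in> topspace S" and u: "0 \<le> u" "u \<le> 1" and xe: "x = \<alpha>' (cone_pt S s u)"
      note c = cone_pt_mem [OF s u]
      have e: "G1 (1, x) = g (1, (s, u))" "G2 (0, x) = \<alpha>' (cone_pt S s (clamp01 (2 * u)))"
        using s u by (simp_all add: xe G1(3) G2(3) c g' h')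
      show ?thesis
      proof (cases "u \<le> 1/2")
        case True
        have dd: "(1 - 2 * u) * (1/2 + 1 / 4) + 2 * u * 1 = 3/4 + u / 2" by (simp add: field_simps)
        have "g (1, (s, u)) = \<theta> ((1 - 2 * u) * (1/2 + 1 / 4) + 2 * u * 1, s)"
          unfolding g_def using True u by simp
        also have "\<dots> = \<theta> (3/4 + u / 2, s)"
          unfolding dd ..
        also have "\<dots> = \<alpha>' (cone_pt S s (2 * u))"
          using \<theta>3 [of "3/4 + u / 2" s] True u s by (simp add: algebra_simps)
        finally show ?thesis using e True u by simp
      next
        case False
        then have "g (1, (s, u)) = apex"
          using u s V(5) \<theta>01 by (simp add: g_def)
        then show ?thesis using e False apex [OF s] by simp
      qed
    qed
  next
    show "G1 (r, x0) = x0" if "0 \<le> r" "r \<le> 1" for r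
      using that x0 by (simp add: G1(2) hK(4))
  qed
  moreover have "pointed_homotopic X x0 X x0 (\<lambda>x. G2 (0, x)) id"
  proof (rule pointed_homotopicI [OF x0X G2(1)])
    fix x assume x: "x \<in> topspace X"
    show "G2 (1, x) = id x"
    proof (rule Xcases [OF x])
      assume "x \<in> topspace K"
      then show ?thesis by (simp add: G2(2))
    next
      fix s u assume s: "s \<in> topspace S" and u: "0 \<le> u" "u \<le> 1" and xe: "x = \<alpha>' (cone_pt S s u)"
      then show ?thesis by (simp add: G2(3) cone_pt_mem h')
    qed
  qed (use x0 G2 in auto)
  ultimately have "pointed_homotopic X x0 X x0 (fjoin_proj p \<circ> \<phi>') id"
    unfolding pointed_homotopic_def by (rule homotopic_with_trans)
  moreover have "fjoin_weight (\<phi>' x) (Suc n) = 0" if "x \<in> topspace K" for x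
    using standard_simplex_SucI(2) [OF fjoin_weight_simplex [OF \<phi>m [OF that]]] that
    by (simp add: \<phi>'K fjoin_raise(2) [OF \<phi>m])
  moreover have "fjoin_weight (N (r, cone_pt S s 0)) (Suc n) = 0" if "0 \<le> r" "r \<le> 1" "s \<in> topspace S" for r s
    using standard_simplex_SucI(2) [OF fjoin_weight_simplex [OF M'm, of "1 - r" s]] that
    by (simp add: N_base fjoin_raise(2) [OF M'm])
  moreover have "\<phi>' x0 = ?b'" using \<phi>'K [OF x0] \<phi>(2) fjoin_basept_raise_incl(1) [OF E(2)] by simp
  moreover have "N (r, cone_pt S s0 0) = ?b'" if "0 \<le> r" "r \<le> 1" for r
    using that s0 M'(4) [of "1 - r"] fjoin_basept_raise_incl(1) [OF E(2)] by (simp add: N_base)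
  ultimately show ?thesis
    using that [of \<phi>' N] \<phi>'c N(1) \<phi>'C N_1 unfolding EE_def by simp
qed

section \<open>Shuffling the two extended liftings\<close>

lemma continuous_map_kprod_map:
  assumes "continuous_map X X' f" "continuous_map Y Y' g"
  shows "continuous_map (kprod X Y) (kprod X' Y') (\<lambda>x. (f (fst x), g (snd x)))"
  by (intro continuous_map_into_kprod k_space_kprod continuous_map_comp [OF assms(1) continuous_map_kprod_fst]
      continuous_map_comp [OF assms(2) continuous_map_kprod_snd])

lemma continuous_map_fjoin_shuffle_drop:
  assumes E: "Hausdorff_space E" and F: "Hausdorff_space F"
    and c: "continuous_map Q (kprod (fjoin (Suc n) E p) (fjoin (Suc m) F q)) c"
    and w: "\<And>x. x \<in> topspace Q \<Longrightarrow> fjoin_weight (fst (c x)) (Suc n) = 0 \<or> fjoin_weight (snd (c x)) (Suc m) = 0"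
  shows "continuous_map Q (fjoin (Suc (n + m)) (kprod E F) (map_prod p q))
      (\<lambda>x. fjoin_drop (Suc (n + m)) (kprod E F) (map_prod p q)
             (fjoin_shuffle (Suc n) (Suc m) E p F q (fst (c x)) (snd (c x))))"
proof -
  let ?J = "fjoin (Suc (Suc (n + m))) (kprod E F) (map_prod p q)"
  let ?sh = "\<lambda>x. fjoin_shuffle (Suc n) (Suc m) E p F q (fst (c x)) (snd (c x))"
  have cm: "fst (c x) \<in> topspace (fjoin (Suc n) E p)" "snd (c x) \<in> topspace (fjoin (Suc m) F q)"
    if "x \<in> topspace Q" for x
    using Pi_mem [OF continuous_map_funspace [OF c] that] by (auto simp: mem_Times_iff)
  have "continuous_map Q ?J ?sh"
    using continuous_map_comp [OF continuous_map_fjoin_shuffle [OF E F] c] by (simp add: case_prod_unfold)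
  moreover have "fjoin_weight (?sh x) (Suc (Suc (n + m))) = 0" if "x \<in> topspace Q" for x
    unfolding fjoin_shuffle_mem(2) [OF cm [OF that]]
    by (rule shuffle_weight_top [OF fjoin_weight_simplex [OF cm(1) [OF that]] fjoin_weight_simplex [OF cm(2) [OF that]] w [OF that]])
  ultimately have "continuous_map Q (subtopology ?J {d. fjoin_weight d (Suc (Suc (n + m))) = 0}) ?sh"
    by (auto simp: continuous_map_in_subtopology)
  then show ?thesis
    by (rule continuous_map_comp [OF continuous_map_fjoin_drop])
qed

lemma fjoin_shuffle_drop:
  assumes c: "c \<in> topspace (fjoin (Suc n) E p)" and d: "d \<in> topspace (fjoin (Suc m) F q)"
    and w: "fjoin_weight c (Suc n) = 0 \<or> fjoin_weight d (Suc m) = 0"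
  shows "fjoin_shuffle (Suc n) (Suc m) E p F q c d \<in> topspace (fjoin (Suc (Suc (n + m))) (kprod E F) (map_prod p q))"
    "fjoin_weight (fjoin_shuffle (Suc n) (Suc m) E p F q c d) (Suc (Suc (n + m))) = 0"
    "fjoin_proj (map_prod p q) (fjoin_drop (Suc (n + m)) (kprod E F) (map_prod p q)
       (fjoin_shuffle (Suc n) (Suc m) E p F q c d)) = (fjoin_proj p c, fjoin_proj q d)"
proof -
  show 1: "fjoin_shuffle (Suc n) (Suc m) E p F q c d \<in> topspace (fjoin (Suc (Suc (n + m))) (kprod E F) (map_prod p q))"
    using fjoin_shuffle_mem(1) [OF c d] by simp
  show 2: "fjoin_weight (fjoin_shuffle (Suc n) (Suc m) E p F q c d) (Suc (Suc (n + m))) = 0"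
    unfolding fjoin_shuffle_mem(2) [OF c d]
    by (rule shuffle_weight_top [OF fjoin_weight_simplex [OF c] fjoin_weight_simplex [OF d] w])
  show "fjoin_proj (map_prod p q) (fjoin_drop (Suc (n + m)) (kprod E F) (map_prod p q)
       (fjoin_shuffle (Suc n) (Suc m) E p F q c d)) = (fjoin_proj p c, fjoin_proj q d)"
    unfolding fjoin_drop(3) [OF 1 2] by (rule fjoin_shuffle_mem(3) [OF c d])
qed

lemma fjoin_shuffle_basept:
  assumes e: "e0 \<in> topspace E" and f: "f0 \<in> topspace F"
  shows "fjoin_drop (Suc (n + m)) (kprod E F) (map_prod p q)
      (fjoin_shuffle (Suc n) (Suc m) E p F q (fjoin_basept (Suc n) E p e0) (fjoin_basept (Suc m) F q f0)) =
    fjoin_basept (Suc (n + m)) (kprod E F) (map_prod p q) (e0, f0)"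
proof -
  let ?\<delta> = "\<lambda>i::nat. if i = 0 then 1 else 0 :: real"
  let ?N = "Suc (n + m)"
  have d: "?\<delta> \<in> standard_simplex k" for k by simp
  have w: "shuffle_weight ?\<delta> ?\<delta> = ?\<delta>"
  proof
    fix k
    have nz: "shuffle_weight ?\<delta> ?\<delta> k = 0" if "k \<noteq> 0" for k
    proof (rule ccontr)
      assume "shuffle_weight ?\<delta> ?\<delta> k \<noteq> 0"
      then obtain i j where "k = i + j" "?\<delta> i \<noteq> 0" "?\<delta> j \<noteq> 0"
        using shuffle_weight_nonzero [OF d d] by metis
      then show False using that by (auto split: if_splits)
    qed
    \<comment> \<open>The formula for the weights does not involve n and m, so the case n = m = 0
      gives the value at 0.\<close>
    have "(\<Sum>i\<le>0 + 0. shuffle_weight ?\<delta> ?\<delta> i) = 1"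
      using shuffle_weight_simplex [OF d [of 0] d [of 0]] unfolding standard_simplex_def by blast
    then show "shuffle_weight ?\<delta> ?\<delta> k = ?\<delta> k"
      using nz by (cases "k = 0") auto
  qed
  have ef: "(e0, f0) \<in> topspace (kprod E F)" using e f by simp
  note m = fjoin_vertex_mem [OF e] and m' = fjoin_vertex_mem [OF f] and mm = fjoin_vertex_mem [OF ef]
  have "fjoin_shuffle (Suc n) (Suc m) E p F q (fjoin_basept (Suc n) E p e0) (fjoin_basept (Suc m) F q f0) =
      fjoin_pt (Suc n + Suc m) (kprod E F) (map_prod p q) (\<lambda>i\<in>{..Suc n + Suc m}. (e0, f0), shuffle_weight ?\<delta> ?\<delta>)"
    unfolding fjoin_basept_def
  proof (rule fjoin_shuffle_pt [OF m d m' d mm])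
    fix i j assume "overlap ?\<delta> ?\<delta> i j \<noteq> 0"
    from overlap_nonzero [OF this] have "i = 0" "j = 0" by (auto split: if_splits)
    then show "(\<lambda>i\<in>{..Suc n + Suc m}. (e0, f0)) (i + j) = ((\<lambda>i\<in>{..Suc n}. e0) i, (\<lambda>i\<in>{..Suc m}. f0) j)"
      by simp
  qed
  also have "\<dots> = fjoin_pt (Suc ?N) (kprod E F) (map_prod p q) (\<lambda>i\<in>{..Suc ?N}. (e0, f0), ?\<delta>)"
    by (simp only: w add_Suc add_Suc_right)
  also have "fjoin_drop ?N (kprod E F) (map_prod p q) \<dots> =
      fjoin_pt ?N (kprod E F) (map_prod p q) (restrict (\<lambda>i\<in>{..Suc ?N}. (e0, f0)) {..?N}, ?\<delta>)"
    by (rule fjoin_drop_pt [OF mm d]) simp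
  also have "restrict (\<lambda>i\<in>{..Suc ?N}. (e0, f0)) {..?N} = (\<lambda>i\<in>{..?N}. (e0, f0))"
    by (auto simp: restrict_def)
  finally show ?thesis by (simp only: fjoin_basept_def)
qed

lemma join_extend_basept:
  assumes "a0 \<in> topspace A"
  shows "join_extend n A a0 (njoin_basept n A a0) 0 = njoin_basept (Suc n) A a0"
proof -
  have "(\<lambda>i\<in>{..n}. a0)(Suc n := a0) = (\<lambda>i\<in>{..Suc n}. a0)"
    by (auto simp: restrict_def)
  then show ?thesis
    unfolding fjoin_basept_def
    using join_extend_zero [OF fjoin_vertex_mem [OF assms, of n to_point] _ assms, of "\<lambda>i. if i = 0 then 1 else 0"] by simp
qed

text \<open>The coordinates of a lifting to the fibred join are local sections up to homotopy; the homotopy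
  lifting property makes them strict.\<close>

lemma secat_along_le:
  assumes p: "pointed_fibration E e0 X x0 p" "Hausdorff_space E" "Hausdorff_space X"
    and q: "pointed_fibration F f0 Y y0 q" "Hausdorff_space F" "Hausdorff_space Y"
    and Z: "k_space Z" "Hausdorff_space Z" "z0 \<in> topspace Z"
    and \<phi>: "continuous_map Z (fjoin N (kprod E F) (map_prod p q)) \<phi>"
    and h: "pointed_homotopic Z z0 (kprod X Y) z0 (fjoin_proj (map_prod p q) \<circ> \<phi>) id"
  shows "secat_along Z id (kprod E F) (map_prod p q) \<le> enat N"
proof -
  let ?J = "fjoin N (kprod E F) (map_prod p q)" and ?P = "pullback Z id (kprod E F) (map_prod p q)"
  obtain H where H: "continuous_map (prod_topology unit_interval Z) (kprod X Y) H"
    "\<And>z. H (0, z) = fjoin_proj (map_prod p q) (\<phi> z)" "\<And>z. H (1, z) = z"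
    using h unfolding pointed_homotopic_def homotopic_with_def by auto
  have \<phi>m: "\<phi> z \<in> topspace ?J" if "z \<in> topspace Z" for z
    using \<phi> that by (auto simp: continuous_map_def)
  \<comment> \<open>Where the i-th weight is positive, the i-th coordinate is a continuous map into
    the total space.\<close>
  define U where "U i = {z \<in> topspace Z. 0 < fjoin_weight (\<phi> z) i}" for i
  have opU: "openin Z (U i)" for i
  proof -
    have "openin Z {z \<in> topspace Z. fjoin_weight (\<phi> z) i \<in> {0<..}}"
      by (rule openin_continuous_map_preimage [OF continuous_map_comp [OF continuous_map_fjoin_weight \<phi>]]) auto
    then show ?thesis by (simp add: U_def)
  qed
  have cover: "topspace Z = (\<Union>i\<le>N. U i)"
  proof
    show "topspace Z \<subseteq> (\<Union>i\<le>N. U i)"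
    proof
      fix z assume z: "z \<in> topspace Z"
      obtain i where "i \<le> N" "0 < fjoin_weight (\<phi> z) i"
        using standard_simplex_nonzero [OF fjoin_weight_simplex [OF \<phi>m [OF z]]] by blast
      then show "z \<in> (\<Union>i\<le>N. U i)" using z by (auto simp: U_def)
    qed
  qed (auto simp: U_def)
  have "\<exists>s. continuous_map (subtopology Z (U i)) ?P s \<and> (\<forall>z\<in>U i. fst (s z) = z)" if i: "i \<le> N" for i
  proof -
    let ?Z = "subtopology Z (U i)"
    have tZ: "topspace ?Z = U i" by (auto simp: U_def)
    have kZ: "k_space ?Z"
      using k_space_open_subtopology Z opU by blast
    have "continuous_map ?Z (subtopology ?J {c. 0 < fjoin_weight c i}) \<phi>"
      using \<phi> by (auto simp: continuous_map_in_subtopology continuous_map_from_subtopology U_def)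
    then have c: "continuous_map ?Z (kprod E F) (\<lambda>z. fjoin_coord (\<phi> z) i)"
      by (rule continuous_map_comp [OF continuous_map_fjoin_coord [OF i]])
    have H': "continuous_map (prod_topology unit_interval ?Z) (kprod X Y) H"
      using H(1) by (simp add: prod_topology_subtopology(2) continuous_map_from_subtopology)
    have start: "H (0, z) = (p (fst (fjoin_coord (\<phi> z) i)), q (snd (fjoin_coord (\<phi> z) i)))" if "z \<in> topspace ?Z" for z
      using fjoin_proj_coord [OF \<phi>m i, of z] that H(2) by (auto simp: map_prod_def case_prod_unfold)
    \<comment> \<open>The lifting property is available for p and q, so the two components of the
      homotopy are lifted separately.\<close>
    obtain g1 where g1: "continuous_map (prod_topology unit_interval ?Z) E g1"
      "\<And>t z. \<lbrakk>t \<in> {0..1}; z \<in> topspace ?Z\<rbrakk> \<Longrightarrow> p (g1 (t, z)) = fst (H (t, z))"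
      using pointed_fibration_lift [OF p kZ continuous_map_comp [OF continuous_map_kprod_fst c]
          continuous_map_comp [OF continuous_map_kprod_fst H']] start by (metis fst_conv)
    obtain g2 where g2: "continuous_map (prod_topology unit_interval ?Z) F g2"
      "\<And>t z. \<lbrakk>t \<in> {0..1}; z \<in> topspace ?Z\<rbrakk> \<Longrightarrow> q (g2 (t, z)) = snd (H (t, z))"
      using pointed_fibration_lift [OF q kZ continuous_map_comp [OF continuous_map_kprod_snd c]
          continuous_map_comp [OF continuous_map_kprod_snd H']] start by (metis snd_conv)
    have i1: "continuous_map ?Z (prod_topology unit_interval ?Z) (\<lambda>z. (1, z))"
      by (intro continuous_map_pairedI) auto
    have "continuous_map ?Z (kprod E F) (\<lambda>z. (g1 (1, z), g2 (1, z)))"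
      by (intro continuous_map_into_kprod [OF kZ] continuous_map_comp [OF g1(1) i1] continuous_map_comp [OF g2(1) i1])
    then have "continuous_map ?Z ?P (\<lambda>z. (z, (g1 (1, z), g2 (1, z))))"
      unfolding pullback_def continuous_map_into_kification [OF kZ] continuous_map_in_subtopology
      using g1(2) [of 1] g2(2) [of 1] H(3)
      by (intro conjI continuous_map_pairedI) (auto simp: continuous_map_from_subtopology)
    then show ?thesis by (intro exI[of _ "\<lambda>z. (z, (g1 (1, z), g2 (1, z)))"]) auto
  qed
  then have "enat N \<in> {enat n | n. \<exists>U. (\<forall>i\<le>n. openin Z (U i) \<and>
        (\<exists>s. continuous_map (subtopology Z (U i)) ?P s \<and> (\<forall>x\<in>U i. fst (s x) = x))) \<and> topspace Z = (\<Union>i\<le>n. U i)}"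
    using opU cover by blast
  then show ?thesis
    unfolding secat_along_def secat_def by (rule Inf_lower)
qed

section \<open>The Hopf invariant of the product fibration\<close>

theorem theorem4p12:
  fixes X K :: "'x topology" and Y L :: "'y topology"
    and E :: "'e topology" and F :: "'f topology"
    and S :: "'s topology" and T :: "'t topology"
    and S' :: "'s1 topology" and T' :: "'t1 topology"
    and p :: "'e \<Rightarrow> 'x" and q :: "'f \<Rightarrow> 'y"
    and \<alpha> :: "'s \<Rightarrow> 'x" and \<beta> :: "'t \<Rightarrow> 'y"
    and \<alpha>' :: "('s \<times> real) set \<Rightarrow> 'x" and \<beta>' :: "('t \<times> real) set \<Rightarrow> 'y"
    and \<phi> :: "'x \<Rightarrow> 'e fjoin_point" and \<psi> :: "'y \<Rightarrow> 'f fjoin_point"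
    and Hp :: "'s \<Rightarrow> 'e fjoin_point" and Hq :: "'t \<Rightarrow> 'f fjoin_point"
    and n m :: nat
  assumes spaces: "pointed_space X x0" "pointed_space Y y0" "pointed_space K x0" "pointed_space L y0"
      "pointed_space E e0" "pointed_space F f0" "pointed_space S s0" "pointed_space T t0"
      "pointed_space S' s0'" "pointed_space T' t0'"
    and p: "pointed_fibration E e0 X x0 p"
    and q: "pointed_fibration F f0 Y y0 q"
    and \<alpha>: "pointed_map S s0 K x0 \<alpha>" "mapping_cone X K S \<alpha> \<alpha>'"
    and \<beta>: "pointed_map T t0 L y0 \<beta>" "mapping_cone Y L T \<beta> \<beta>'"
    and S: "pointed_homotopy_equivalent S s0 (reduced_suspension S' s0') (suspension_pt S' s0' s0' 0)"
    and T: "pointed_homotopy_equivalent T t0 (reduced_suspension T' t0') (suspension_pt T' t0' t0' 0)"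
    and nm: "n \<ge> 1" "m \<ge> 1"
    and secat_p: "secat_along K id E p \<le> enat n"
    and Hopf_p: "is_Hopf_invariant n E e0 X x0 p K S s0 \<alpha> \<phi> Hp"
    and secat_q: "secat_along L id F q \<le> enat m"
    and Hopf_q: "is_Hopf_invariant m F f0 Y y0 q L T t0 \<beta> \<psi> Hq"
  shows "secat_along (fat_product X K Y L) id (kprod E F) (map_prod p q) \<le> enat (n + m + 1)
    \<and> pointed_class (cjoin S T) (cjoin_basept S s0 T t0)
         (njoin (n + m + 1) (kprod (fibre E p x0) (fibre F q y0)))
         (njoin_basept (n + m + 1) (kprod (fibre E p x0) (fibre F q y0)) (e0, f0))
         (Phi_map n m (fibre E p x0) e0 (fibre F q y0) f0
          \<circ> cjoin_map (njoin n (fibre E p x0)) (njoin m (fibre F q y0)) Hp Hq)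
       \<in> Hopf_set (n + m + 1) (kprod E F) (e0, f0) (kprod X Y) (x0, y0) (map_prod p q)
           (fat_product X K Y L) (cjoin S T) (cjoin_basept S s0 T t0) (W_map \<alpha>' \<beta>')"
proof -
  let ?A = "fibre E p x0" and ?B = "fibre F q y0" and ?EF = "kprod E F" and ?pq = "map_prod p q"
  let ?N = "Suc (n + m)" and ?Z = "fat_product X K Y L" and ?C = "cjoin S T"
  let ?Jp = "fjoin (Suc n) E p" and ?Jq = "fjoin (Suc m) F q"
  let ?J = "fjoin ?N ?EF ?pq" and ?b = "fjoin_basept ?N ?EF ?pq (e0, f0)"
  have k: "k_space X" "k_space Y" "k_space K" "k_space L" "k_space S" "k_space T" "k_space S'" "k_space T'"
    and H: "Hausdorff_space X" "Hausdorff_space Y" "Hausdorff_space E" "Hausdorff_space F"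
    and cg: "compactly_generated S" "compactly_generated T"
    and wp: "well_pointed S s0" "well_pointed T t0"
    and mem: "x0 \<in> topspace K" "y0 \<in> topspace L" "e0 \<in> topspace E" "f0 \<in> topspace F"
      "s0 \<in> topspace S" "t0 \<in> topspace T" "s0' \<in> topspace S'" "t0' \<in> topspace T'"
    using spaces by (auto simp: pointed_space_def compactly_generated_def well_pointed_def)
  have pq: "continuous_map E X p" "continuous_map F Y q" "p e0 = x0" "q f0 = y0"
    using p q by (auto simp: pointed_fibration_def pointed_map_def)
  have eA: "e0 \<in> topspace ?A" and fB: "f0 \<in> topspace ?B"
    using mem pq by (auto simp: fibre_def)
  have base: "\<alpha> s0 = x0" "\<beta> t0 = y0"
    using \<alpha>(1) \<beta>(1) by (auto simp: pointed_map_def)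
  have Hp: "continuous_map S (njoin n ?A) Hp" "Hp s0 = njoin_basept n ?A e0"
    using Hopf_p by (auto simp: is_Hopf_invariant_def pointed_map_def)
  have Hq: "continuous_map T (njoin m ?B) Hq" "Hq t0 = njoin_basept m ?B f0"
    using Hopf_q by (auto simp: is_Hopf_invariant_def pointed_map_def)
  note fib = fibre_kprod [OF pq(1,2) H(1,2), of x0 y0]
  obtain \<phi>' M where M: "continuous_map X ?Jp \<phi>'" "\<phi>' x0 = fjoin_basept (Suc n) E p e0"
    "\<And>x. x \<in> topspace K \<Longrightarrow> fjoin_weight (\<phi>' x) (Suc n) = 0"
    "pointed_homotopic X x0 X x0 (fjoin_proj p \<circ> \<phi>') id"
    "continuous_map (prod_topology unit_interval (cone S)) ?Jp M"
    "\<And>c. c \<in> topspace (cone S) \<Longrightarrow> M (0, c) = \<phi>' (\<alpha>' c)"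
    "\<And>s u. \<lbrakk>s \<in> topspace S; 0 \<le> u; u \<le> 1\<rbrakk> \<Longrightarrow>
        M (1, cone_pt S s u) = fjoin_incl (Suc n) E p (join_extend n ?A e0 (Hp s) u)"
    "\<And>r s. \<lbrakk>0 \<le> r; r \<le> 1; s \<in> topspace S\<rbrakk> \<Longrightarrow> fjoin_weight (M (r, cone_pt S s 0)) (Suc n) = 0"
    "\<And>r. \<lbrakk>0 \<le> r; r \<le> 1\<rbrakk> \<Longrightarrow> M (r, cone_pt S s0 0) = fjoin_basept (Suc n) E p e0"
    by (rule Hopf_invariant_cone_extension [OF nm(1) p H(3) mem(3) H(1) cg(1) wp(1) S k(7) mem(7) mem(1) base(1) \<alpha>(2) Hopf_p])
       (assumption | (rule that; assumption))+
  obtain \<psi>' N where N: "continuous_map Y ?Jq \<psi>'" "\<psi>' y0 = fjoin_basept (Suc m) F q f0"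
    "\<And>x. x \<in> topspace L \<Longrightarrow> fjoin_weight (\<psi>' x) (Suc m) = 0"
    "pointed_homotopic Y y0 Y y0 (fjoin_proj q \<circ> \<psi>') id"
    "continuous_map (prod_topology unit_interval (cone T)) ?Jq N"
    "\<And>c. c \<in> topspace (cone T) \<Longrightarrow> N (0, c) = \<psi>' (\<beta>' c)"
    "\<And>s u. \<lbrakk>s \<in> topspace T; 0 \<le> u; u \<le> 1\<rbrakk> \<Longrightarrow>
        N (1, cone_pt T s u) = fjoin_incl (Suc m) F q (join_extend m ?B f0 (Hq s) u)"
    "\<And>r s. \<lbrakk>0 \<le> r; r \<le> 1; s \<in> topspace T\<rbrakk> \<Longrightarrow> fjoin_weight (N (r, cone_pt T s 0)) (Suc m) = 0"
    "\<And>r. \<lbrakk>0 \<le> r; r \<le> 1\<rbrakk> \<Longrightarrow> N (r, cone_pt T t0 0) = fjoin_basept (Suc m) F q f0"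
    by (rule Hopf_invariant_cone_extension [OF nm(2) q H(4) mem(4) H(2) cg(2) wp(2) T k(8) mem(8) mem(2) base(2) \<beta>(2) Hopf_q])
       (assumption | (rule that; assumption))+
  \<comment> \<open>Used only at pairs of which one has last weight 0; there the shuffle has last
    weight 0 and dropping is legitimate and continuous.\<close>
  define D where "D c = fjoin_drop ?N ?EF ?pq (fjoin_shuffle (Suc n) (Suc m) E p F q (fst c) (snd c))" for c
  define \<Phi> where "\<Phi> z = D (\<phi>' (fst z), \<psi>' (snd z))" for z
  have D: "continuous_map Q ?J (\<lambda>x. D (c x))"
    if "continuous_map Q (kprod ?Jp ?Jq) c"
      "\<And>x. x \<in> topspace Q \<Longrightarrow> fjoin_weight (fst (c x)) (Suc n) = 0 \<or> fjoin_weight (snd (c x)) (Suc m) = 0"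
    for Q :: "'q topology" and c
    unfolding D_def by (rule continuous_map_fjoin_shuffle_drop [OF H(3,4) that])
  have KX: "continuous_map K X id" and LY: "continuous_map L Y id" and \<alpha>'c: "continuous_map (cone S) X \<alpha>'"
    and \<beta>'c: "continuous_map (cone T) Y \<beta>'"
    using mapping_cone_continuous \<alpha>(2) \<beta>(2) by metis+
  have XKYL: "topspace K \<subseteq> topspace X" "topspace L \<subseteq> topspace Y"
    using \<alpha>(2) \<beta>(2) by (auto simp: mapping_cone_def)
  have tZ: "topspace ?Z = topspace X \<times> topspace L \<union> topspace K \<times> topspace Y"
    by (simp add: fat_product_def topspace_union_topology)
  have Zid: "continuous_map ?Z (kprod X Y) id"
    unfolding fat_product_def
    by (intro continuous_map_from_union_topology continuous_map_kprod_mono KX LY continuous_map_id)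
  have kZ: "k_space ?Z"
    unfolding fat_product_def by (intro k_space_union_topology k_space_kprod)
  \<comment> \<open>The push-out topology is finer than that of the product, so points are separated
    by the identity map.\<close>
  have HZ: "Hausdorff_space ?Z"
    unfolding Hausdorff_space_def
    using separate_by_map [OF Zid Hausdorff_space_kprod [OF H(1,2)]] by simp
  have z0: "(x0, y0) \<in> topspace ?Z"
    using mem XKYL by (auto simp: tZ)
  have \<phi>m: "\<phi>' x \<in> topspace ?Jp" if "x \<in> topspace X" for x using M(1) that by (auto simp: continuous_map_def)
  have \<psi>m: "\<psi>' y \<in> topspace ?Jq" if "y \<in> topspace Y" for y using N(1) that by (auto simp: continuous_map_def)
  have w: "fjoin_weight (\<phi>' (fst z)) (Suc n) = 0 \<or> fjoin_weight (\<psi>' (snd z)) (Suc m) = 0"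
    if "z \<in> topspace ?Z" for z
    using that M(3) N(3) by (auto simp: tZ)
  have \<Phi>: "continuous_map ?Z ?J \<Phi>"
    unfolding \<Phi>_def
    using continuous_map_comp [OF continuous_map_kprod_map [OF M(1) N(1)] Zid] w by (intro D) simp_all
  have \<Phi>0: "\<Phi> (x0, y0) = ?b"
    using fjoin_shuffle_basept [OF mem(3,4)] by (simp add: \<Phi>_def D_def M(2) N(2))
  have \<Phi>h: "pointed_homotopic ?Z (x0, y0) (kprod X Y) (x0, y0) (fjoin_proj ?pq \<circ> \<Phi>) id"
  proof -
    obtain g where g: "continuous_map (prod_topology unit_interval X) X g" "\<And>x. g (0, x) = fjoin_proj p (\<phi>' x)"
      "\<And>x. g (1, x) = x" "\<And>t. 0 \<le> t \<Longrightarrow> t \<le> 1 \<Longrightarrow> g (t, x0) = x0"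
      using M(4) unfolding pointed_homotopic_def homotopic_with_def by auto
    obtain h where h: "continuous_map (prod_topology unit_interval Y) Y h" "\<And>y. h (0, y) = fjoin_proj q (\<psi>' y)"
      "\<And>y. h (1, y) = y" "\<And>t. 0 \<le> t \<Longrightarrow> t \<le> 1 \<Longrightarrow> h (t, y0) = y0"
      using N(4) unfolding pointed_homotopic_def homotopic_with_def by auto
    let ?h = "\<lambda>x. (g (fst x, fst (snd x)), h (fst x, snd (snd x)))"
    have z: "continuous_map (prod_topology unit_interval ?Z) (kprod X Y) snd"
      using continuous_map_comp [OF Zid continuous_map_snd [of unit_interval ?Z]] by simp
    show ?thesis
    proof (rule pointed_homotopicI [OF z0, where h = ?h])
      show "continuous_map (prod_topology unit_interval ?Z) (kprod X Y) ?h"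
        by (intro continuous_map_into_kprod [OF k_space_interval_prod [OF kZ]] continuous_map_comp_pair [OF g(1)]
            continuous_map_comp_pair [OF h(1)] continuous_map_fst
            continuous_map_comp [OF continuous_map_kprod_fst z] continuous_map_comp [OF continuous_map_kprod_snd z])
      fix z assume z: "z \<in> topspace ?Z"
      then have "fst z \<in> topspace X" "snd z \<in> topspace Y" using XKYL by (auto simp: tZ)
      then show "?h (0, z) = (fjoin_proj ?pq \<circ> \<Phi>) z"
        using fjoin_shuffle_drop(3) [OF \<phi>m \<psi>m w [OF z]] by (simp add: g h \<Phi>_def D_def)
    qed (simp_all add: g h)
  qed
  have secat: "secat_along ?Z id ?EF ?pq \<le> enat ?N"
    by (rule secat_along_le [OF p H(3,1) q H(4,2) kZ HZ z0 \<Phi> \<Phi>h])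
  let ?Phi = "Phi_map n m ?A e0 ?B f0 \<circ> cjoin_map (njoin n ?A) (njoin m ?B) Hp Hq"
  let ?D = "\<lambda>c. fjoin_drop ?N (kprod ?A ?B) (map_prod to_point to_point)
      (fjoin_shuffle (Suc n) (Suc m) ?A to_point ?B to_point (fst c) (snd c))"
  have Hm: "Hp s \<in> topspace (njoin n ?A)" "Hq t \<in> topspace (njoin m ?B)"
    if "s \<in> topspace S" "t \<in> topspace T" for s t
    using Hp(1) Hq(1) that by (auto simp: continuous_map_def)
  have Phi: "?Phi (cone_pt S s u, cone_pt T t v) = ?D (join_extend n ?A e0 (Hp s) u, join_extend m ?B f0 (Hq t) v)"
    if st: "s \<in> topspace S" "0 \<le> u" "u \<le> 1" "t \<in> topspace T" "0 \<le> v" "v \<le> 1" "u = 0 \<or> v = 0" for s u t v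
  proof -
    have "Hp \<in> topspace S \<rightarrow> topspace (njoin n ?A)" "Hq \<in> topspace T \<rightarrow> topspace (njoin m ?B)"
      using Hp(1) Hq(1) by (auto simp: continuous_map_def)
    then show ?thesis
      using st by (simp add: cjoin_map_def cone_map_pt Phi_map_cone_pt [OF Hm [OF st(1,4)] eA fB])
  qed
  \<comment> \<open>\<open>Phi_map\<close> and \<open>cone_map\<close> are written with
    representatives. Continuity of the composite is obtained by identifying it with the shuffle of
    these two continuous maps on the cones.\<close>
  have cone_ext: "\<exists>G. continuous_map (cone R) (njoin (Suc i) A) G \<and>
      (\<forall>s\<in>topspace R. \<forall>u\<in>{0..1}. G (cone_pt R s u) = join_extend i A a0 (f s) u)"
    if f: "continuous_map R (njoin i A) f" and a0: "a0 \<in> topspace A" and kR: "k_space R"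
    for R :: "'r topology" and A :: "'a topology" and i a0 f
  proof -
    have fm: "f s \<in> topspace (njoin i A)" if "s \<in> topspace R" for s
      using f that by (auto simp: continuous_map_def)
    have jc: "continuous_map (prod_topology unit_interval (prod_topology R unit_interval)) (njoin (Suc i) A)
        (\<lambda>x. join_extend i A a0 (f (fst (snd x))) (snd (snd x)))"
      using continuous_map_comp_pair [OF continuous_map_join_extend [OF a0, of i] proj_cont(2)
          continuous_map_comp [OF f proj_cont(1)]] by simp
    obtain G where G: "continuous_map (prod_topology unit_interval (cone R)) (njoin (Suc i) A) G"
      "\<And>r s u. \<lbrakk>0 \<le> r; r \<le> 1; s \<in> topspace R; 0 \<le> u; u \<le> 1\<rbrakk> \<Longrightarrow> G (r, cone_pt R s u) = join_extend i A a0 (f s) u"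
    proof (rule cone_family_lift [OF kR jc])
      fix s s' assume "s \<in> topspace R" "s' \<in> topspace R"
      then show "join_extend i A a0 (f (fst (snd (r, (s, 1))))) (snd (snd (r, (s, 1)))) =
          join_extend i A a0 (f (fst (snd (r, (s', 1))))) (snd (snd (r, (s', 1))))" for r :: real
        unfolding fst_conv snd_conv by (intro join_extend_apex fm a0)
    qed auto
    have "continuous_map (cone R) (njoin (Suc i) A) (\<lambda>c. G (0, c))"
      by (rule continuous_map_comp_pair [OF G(1)]) auto
    then show ?thesis using G(2) by (intro exI[of _ "\<lambda>c. G (0, c)"]) auto
  qed
  obtain GS where GS: "continuous_map (cone S) (njoin (Suc n) ?A) GS"
    "\<And>s u. s \<in> topspace S \<Longrightarrow> 0 \<le> u \<Longrightarrow> u \<le> 1 \<Longrightarrow> GS (cone_pt S s u) = join_extend n ?A e0 (Hp s) u"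
    using cone_ext [OF Hp(1) eA k(5)] by auto
  obtain GT where GT: "continuous_map (cone T) (njoin (Suc m) ?B) GT"
    "\<And>s u. s \<in> topspace T \<Longrightarrow> 0 \<le> u \<Longrightarrow> u \<le> 1 \<Longrightarrow> GT (cone_pt T s u) = join_extend m ?B f0 (Hq s) u"
    using cone_ext [OF Hq(1) fB k(6)] by auto
  have PhiG: "?Phi x = ?D (GS (fst x), GT (snd x))"
    "fjoin_weight (GS (fst x)) (Suc n) = 0 \<or> fjoin_weight (GT (snd x)) (Suc m) = 0"
    if x: "x \<in> topspace ?C" for x
  proof -
    obtain s u t v where e: "s \<in> topspace S" "0 \<le> u" "u \<le> 1" "t \<in> topspace T" "0 \<le> v" "v \<le> 1"
      "u = 0 \<or> v = 0" "x = (cone_pt S s u, cone_pt T t v)"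
      using x by (rule cjoin_cases)
    show "?Phi x = ?D (GS (fst x), GT (snd x))"
      unfolding e(8) Phi [OF e(1-7)] using e GS(2) GT(2) by simp
    show "fjoin_weight (GS (fst x)) (Suc n) = 0 \<or> fjoin_weight (GT (snd x)) (Suc m) = 0"
      using e GS(2) GT(2) join_extend_mem(2) [OF Hm(1) [OF e(1,4)] eA e(2,3)]
        join_extend_mem(2) [OF Hm(2) [OF e(1,4)] fB e(5,6)] by auto
  qed
  have hAB: "Hausdorff_space ?A" "Hausdorff_space ?B"
    using H by (simp_all add: fibre_def Hausdorff_space_subtopology)
  note Cid = continuous_map_cjoin [of S T]
  have Phi_c: "continuous_map ?C (njoin ?N (kprod ?A ?B)) ?Phi"
  proof (rule continuous_map_eq)
    have "continuous_map ?C (kprod (njoin (Suc n) ?A) (njoin (Suc m) ?B)) (\<lambda>x. (GS (fst x), GT (snd x)))"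
      using continuous_map_comp [OF continuous_map_kprod_map [OF GS(1) GT(1)] Cid] by simp
    from continuous_map_fjoin_shuffle_drop [OF hAB this]
    show "continuous_map ?C (njoin ?N (kprod ?A ?B)) (\<lambda>x. ?D (GS (fst x), GT (snd x)))"
      unfolding psi_map_eq_fjoin_shuffle(2) using PhiG(2) by simp
  qed (use PhiG(1) in auto)
  have Phi_0: "?Phi (cjoin_basept S s0 T t0) = njoin_basept ?N (kprod ?A ?B) (e0, f0)"
    unfolding cjoin_basept_def Phi [OF mem(5) order_refl zero_le_one mem(6) order_refl zero_le_one disjI1 [OF refl]]
      Hp(2) Hq(2) join_extend_basept [OF eA] join_extend_basept [OF fB] fst_conv snd_conv fjoin_shuffle_basept [OF eA fB]
    by (simp add: fjoin_basept_def psi_map_eq_fjoin_shuffle(3))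
  have kC: "k_space ?C"
    unfolding cjoin_def by (intro k_space_union_topology k_space_kprod)
  have c0: "cjoin_basept S s0 T t0 \<in> topspace ?C"
    unfolding cjoin_basept_def by (rule cone_pt_in_cjoin [OF mem(5,6)])
  have "pointed_homotopic ?C (cjoin_basept S s0 T t0) ?J ?b (\<Phi> \<circ> W_map \<alpha>' \<beta>') (fjoin_incl ?N ?EF ?pq \<circ> ?Phi)"
  proof (rule pointed_homotopicI [OF c0, where h = "\<lambda>x. D (M (fst x, fst (snd x)), N (fst x, snd (snd x)))"])
    let ?Q = "prod_topology unit_interval ?C"
    have z: "continuous_map ?Q (kprod (cone S) (cone T)) snd"
      using continuous_map_comp [OF Cid continuous_map_snd [of unit_interval ?C]] by simp
    have "continuous_map ?Q (kprod ?Jp ?Jq) (\<lambda>x. (M (fst x, fst (snd x)), N (fst x, snd (snd x))))"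
      by (intro continuous_map_into_kprod [OF k_space_interval_prod [OF kC]] continuous_map_comp_pair [OF M(5)]
          continuous_map_comp_pair [OF N(5)] continuous_map_fst
          continuous_map_comp [OF continuous_map_kprod_fst z] continuous_map_comp [OF continuous_map_kprod_snd z])
    then show "continuous_map ?Q ?J (\<lambda>x. D (M (fst x, fst (snd x)), N (fst x, snd (snd x))))"
    proof (rule D)
      fix x assume "x \<in> topspace ?Q"
      then obtain r c where x: "x = (r, c)" "0 \<le> r" "r \<le> 1" "c \<in> topspace ?C" by auto
      obtain s u t v where e: "s \<in> topspace S" "0 \<le> u" "u \<le> 1" "t \<in> topspace T" "0 \<le> v" "v \<le> 1"
        "u = 0 \<or> v = 0" "c = (cone_pt S s u, cone_pt T t v)"
        using x(4) by (rule cjoin_cases)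
      then show "fjoin_weight (fst (M (fst x, fst (snd x)), N (fst x, snd (snd x)))) (Suc n) = 0 \<or>
          fjoin_weight (snd (M (fst x, fst (snd x)), N (fst x, snd (snd x)))) (Suc m) = 0"
        using M(8) [of r s] N(8) [of r t] x by auto
    qed
  next
    fix x assume x: "x \<in> topspace ?C"
    then obtain s u t v where e: "s \<in> topspace S" "0 \<le> u" "u \<le> 1" "t \<in> topspace T" "0 \<le> v" "v \<le> 1"
      "u = 0 \<or> v = 0" "x = (cone_pt S s u, cone_pt T t v)"
      by (rule cjoin_cases)
    note cS = cone_pt_mem [OF e(1-3)] and cT = cone_pt_mem [OF e(4-6)]
    show "D (M (fst (0, x), fst (snd (0, x))), N (fst (0, x), snd (snd (0, x)))) = (\<Phi> \<circ> W_map \<alpha>' \<beta>') x"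
      by (simp add: e(8) M(6) [OF cS] N(6) [OF cT] \<Phi>_def W_map_def)
    let ?c = "join_extend n ?A e0 (Hp s) u" and ?d = "join_extend m ?B f0 (Hq t) v"
    note jc = join_extend_mem [OF Hm(1) [OF e(1,4)] eA e(2,3)] and jd = join_extend_mem [OF Hm(2) [OF e(1,4)] fB e(5,6)]
    have w: "fjoin_weight ?c (Suc n) = 0 \<or> fjoin_weight ?d (Suc m) = 0" using jc(2) jd(2) e(7) by simp
    note sd = fjoin_shuffle_drop(1,2) [OF jc(1) jd(1) w]
    have "fjoin_incl ?N ?EF ?pq (?D (?c, ?d)) = fjoin_drop ?N ?EF ?pq (fjoin_incl (Suc ?N) ?EF ?pq
        (fjoin_shuffle (Suc n) (Suc m) ?A to_point ?B to_point ?c ?d))"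
    proof -
      \<comment> \<open>Changing the base from \<open>unit \<times> unit\<close> to
        \<open>unit\<close> makes the inclusion of the join of the fibre applicable.\<close>
      have "?D (?c, ?d) = fjoin_drop ?N (kprod ?A ?B) to_point (fjoin_shuffle (Suc n) (Suc m) ?A to_point ?B to_point ?c ?d)"
        by (simp only: fjoin_drop_def psi_map_eq_fjoin_shuffle(3) fst_conv snd_conv)
      then show ?thesis
        using fjoin_incl_drop [of "fjoin_shuffle (Suc n) (Suc m) ?A to_point ?B to_point ?c ?d" ?N ?EF ?pq "(x0, y0)"]
          sd unfolding fib psi_map_eq_fjoin_shuffle(2) by simp
    qed
    also have "\<dots> = D (fjoin_incl (Suc n) E p ?c, fjoin_incl (Suc m) F q ?d)"
      using fjoin_incl_shuffle [OF pq(1,2) H(1,2) jc(1) jd(1)] by (simp add: D_def)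
    finally show "D (M (fst (1, x), fst (snd (1, x))), N (fst (1, x), snd (snd (1, x)))) =
        (fjoin_incl ?N ?EF ?pq \<circ> ?Phi) x"
      using Phi [OF e(1-7)] by (simp add: e(8) M(7) [OF e(1-3)] N(7) [OF e(4-6)])
  next
    fix r :: real assume "0 \<le> r" "r \<le> 1"
    then show "D (M (fst (r, cjoin_basept S s0 T t0), fst (snd (r, cjoin_basept S s0 T t0))),
        N (fst (r, cjoin_basept S s0 T t0), snd (snd (r, cjoin_basept S s0 T t0)))) = ?b"
      using fjoin_shuffle_basept [OF mem(3,4)] by (simp add: cjoin_basept_def M(9) N(9) D_def)
  qed
  then have "pointed_homotopic ?C (cjoin_basept S s0 T t0) ?J ?b (fjoin_incl ?N ?EF ?pq \<circ> ?Phi) (\<Phi> \<circ> W_map \<alpha>' \<beta>')"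
    unfolding pointed_homotopic_def by (rule homotopic_with_symD)
  then have "is_Hopf_invariant ?N ?EF (e0, f0) (kprod X Y) (x0, y0) ?pq ?Z ?C (cjoin_basept S s0 T t0)
      (W_map \<alpha>' \<beta>') \<Phi> ?Phi"
    unfolding is_Hopf_invariant_def homotopy_lifting_def pointed_map_def fib
    using \<Phi> \<Phi>0 \<Phi>h Phi_c Phi_0 by blast
  then have "pointed_class ?C (cjoin_basept S s0 T t0) (njoin ?N (kprod ?A ?B)) (njoin_basept ?N (kprod ?A ?B) (e0, f0)) ?Phi
      \<in> Hopf_set ?N ?EF (e0, f0) (kprod X Y) (x0, y0) ?pq ?Z ?C (cjoin_basept S s0 T t0) (W_map \<alpha>' \<beta>')"
    unfolding Hopf_set_def fib by blast
  with secat show ?thesis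
    unfolding Suc_eq_plus1 by blast
qed

end
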